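(* Let $T:[-1,1]\to\mathbb{R}$ be a measurable map such that the pushforward of Lebesgue measure on $[-1,1]$ by $T$ is absolutely continuous with respect to Lebesgue measure. Let $\sigma>0$ and consider the random dynamical system $$X_{n+1}=\tau(T(X_n)+\Omega_n),$$ where $(\Omega_n)$ are i.i.d. random variables with law $\mathcal{N}(0,\sigma^2)$ and $\tau$ is the periodic boundary condition. Then: (1) The system admits a unique stationary probability measure $\mu_\sigma=f_\sigma m$, and its density $f_\sigma$ is real-analytic. (2) For every $\phi\in L^2(m)$ the Birkhoff average $\frac1N\sum_{n=0}^{N-1}\phi(X_n)$ converges almost surely to $\int\phi\,d\mu_\sigma$ as $N\to\infty$ (for $\mu_\sigma$-almost every initial condition $X_0=x_0$ and almost every realization of the noise). (3) This integral can be rigorously enclosed with arbitrary precision by the Fourier–Galerkin algorithm described in the context: whenever $k,n\in\mathbb{N}$ satisfy $C_{k,n}<1$ and $g$ is a trigonometric polynomial of degree at most $k$ with $\int_{-1}^1 g\,dm=1$, one has $\left|\int\phi\,d\mu_\sigma-\int\phi\, g\,dm\right|\le\|\phi\|_{L^2}\,E_{k,n}(g)$ for every $\phi\in L^2(m)$; and for every $\eta>0$ there exist such $k,n,g$ with $E_{k,n}(g)<\eta$.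
   Context: $m$ is (non-normalized) Lebesgue measure on $[-1,1]$; $L^p=L^p([-1,1],m)$. $\tau:\mathbb{R}\to[-1,1)$ is $\tau(x)=x-2\lfloor (x+1)/2\rfloor$. $\rho_\sigma(x)=\frac{1}{\sigma\sqrt{2\pi}}e^{-x^2/(2\sigma^2)}$. A probability measure $\mu$ on $[-1,1]$ is stationary if, when $X_0$ has law $\mu$ and is independent of the noise, $X_1$ has law $\mu$ (equivalently, $\rho_\sigma^{\mathbb{N}}\times\mu$ is invariant under the skew product $(\omega,x)\mapsto(s(\omega),\tau(T(x)+\omega_0))$, $s$ the left shift). The annealed Perron–Frobenius operator, acting on densities, is $P_\sigma f(x)=\int_{-1}^1\sum_{j\in\mathbb{Z}}\rho_\sigma(x+2j-T(y))f(y)\,dy$. Fourier–Galerkin algorithm: let $\mathcal{F}(f)[j]=\frac12\int_{-1}^1f(x)e^{-j\pi i x}dx$, $\pi_kf(x)=\sum_{|j|\le k}\mathcal{F}(f)[j]e^{j\pi i x}$, and $P_{\sigma,k}=\pi_kP_\sigma\pi_k$. A trigonometric polynomial of degree at most $k$ is a linear combination of $e^{j\pi i x}$, $|j|\le k$. Let $\mathcal{U}_0=\{f\in L^2:\int f\,dm=0\}$ and $C_{k,i}=\|P_{\sigma,k}^i|_{\mathcal{U}_0}\|_{L^2\to L^2}$ for $i\ge0$. Put $$\Gamma_{\sigma,k}=\sqrt{\tfrac{1}{\sigma\sqrt\pi}\coth\left(\tfrac{1}{2\sigma^2}\right)}\,e^{-\sigma^2\pi^2k^2/2},\qquad \Gamma^{(1)}_{\sigma,k}=\sum_{|j|>k}e^{-\sigma^2\pi^2j^2/2},$$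 $$\Delta_k=\Gamma_{\sigma,k}(1+\Gamma^{(1)}_{\sigma,k})+\|\rho_\sigma\|_{L^2(\mathbb{R})}\sqrt{\coth\left(\tfrac1{2\sigma^2}\right)}\,\Gamma^{(1)}_{\sigma,k},$$ and, when $C_{k,n}<1$, $$E_{k,n}(g)=\frac{1}{1-C_{k,n}}\sum_{i=0}^{n-1}C_{k,i}\left(\Delta_k+\|P_{\sigma,k}g-g\|_{L^2}\right).$$ The algorithm takes $g$ to be an approximate fixed point of $P_{\sigma,k}$ and outputs $\int\phi\,g\,dm$ with error radius $\|\phi\|_{L^2}E_{k,n}(g)$. *)

theory Defs
  imports "HOL-Probability.Probability"
begin

section \<open>The random dynamical system\<close>

text \<open>Lebesgue measure on the Borel sets of \<open>[-1,1]\<close>, not normalised (total mass 2).\<close>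

definition lebI :: "real measure" where
  "lebI = restrict_space lborel {-1..1}"

definition wrap :: "real \<Rightarrow> real" where
  "wrap x = x - 2 * of_int \<lfloor>(x + 1) / 2\<rfloor>"

definition gauss :: "real \<Rightarrow> real measure" where
  "gauss \<sigma> = density lborel (\<lambda>x. ennreal (normal_density 0 \<sigma> x))"

primrec orbit :: "(real \<Rightarrow> real) \<Rightarrow> (nat \<Rightarrow> real) \<Rightarrow> real \<Rightarrow> nat \<Rightarrow> real" where
  "orbit T w x 0 = x"
| "orbit T w x (Suc n) = wrap (T (orbit T w x n) + w n)"

text \<open>The joint law of an initial state with law \<open>\<mu>\<close> and an independent noise variable is the
  product measure, so the condition says that the state after one step has law \<open>\<mu>\<close> again.\<close>

definition stationary :: "(real \<Rightarrow> real) \<Rightarrow> real \<Rightarrow> real measure \<Rightarrow> bool" where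
  "stationary T \<sigma> \<mu> \<longleftrightarrow>
     prob_space \<mu> \<and> sets \<mu> = sets (restrict_space borel {-1..1}) \<and>
     distr (\<mu> \<Otimes>\<^sub>M gauss \<sigma>) (restrict_space borel {-1..1}) (\<lambda>(x, w). wrap (T x + w)) = \<mu>"

text \<open>Power series expansions are required relative to \<open>S\<close>, so that on a closed interval only
  the values of \<open>f\<close> on that interval matter; at an end point this means that \<open>f\<close> has an analytic
  extension to a neighbourhood.\<close>

definition real_analytic_on :: "(real \<Rightarrow> real) \<Rightarrow> real set \<Rightarrow> bool" where
  "real_analytic_on f S \<longleftrightarrow>
     (\<forall>x\<in>S. \<exists>r>0. \<exists>a :: nat \<Rightarrow> real. \<forall>y\<in>S. \<bar>y - x\<bar> < r \<longrightarrow> (\<lambda>n. a n * (y - x) ^ n) sums f y)"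

section \<open>Complex \<open>L\<^sup>2\<close> functions on \<open>[-1,1]\<close>\<close>

text \<open>Elements of \<open>L\<^sup>2\<close> are represented by Borel functions, without passing to the quotient by
  almost everywhere equality; values outside \<open>[-1,1]\<close> are irrelevant.\<close>

definition L2I :: "(real \<Rightarrow> complex) set" where
  "L2I = {f. f \<in> borel_measurable lebI \<and> integrable lebI (\<lambda>x. (cmod (f x))\<^sup>2)}"

definition norm_L2I :: "(real \<Rightarrow> complex) \<Rightarrow> real" where
  "norm_L2I f = sqrt (LINT x|lebI. (cmod (f x))\<^sup>2)"

definition U0 :: "(real \<Rightarrow> complex) set" where
  "U0 = {f \<in> L2I. (LINT x|lebI. f x) = 0}"

definition opnorm_L2I :: "((real \<Rightarrow> complex) \<Rightarrow> real \<Rightarrow> complex) \<Rightarrow> (real \<Rightarrow> complex) set \<Rightarrow> real" where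
  "opnorm_L2I A V = (SUP f\<in>{f \<in> V. norm_L2I f \<le> 1}. norm_L2I (A f))"

section \<open>The Fourier--Galerkin discretisation\<close>

definition e_mode :: "int \<Rightarrow> real \<Rightarrow> complex" where
  "e_mode j x = exp (of_int j * of_real pi * \<i> * of_real x)"

definition fourier_coeff :: "(real \<Rightarrow> complex) \<Rightarrow> int \<Rightarrow> complex" where
  "fourier_coeff f j = 1 / 2 * (LINT x|lebI. f x * e_mode (- j) x)"

definition proj :: "nat \<Rightarrow> (real \<Rightarrow> complex) \<Rightarrow> real \<Rightarrow> complex" where
  "proj k f x = (\<Sum>j = - int k..int k. fourier_coeff f j * e_mode j x)"

definition trig_poly :: "nat \<Rightarrow> (real \<Rightarrow> complex) \<Rightarrow> bool" where
  "trig_poly k g \<longleftrightarrow> (\<exists>c :: int \<Rightarrow> complex. \<forall>x. g x = (\<Sum>j = - int k..int k. c j * e_mode j x))"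

definition PF :: "(real \<Rightarrow> real) \<Rightarrow> real \<Rightarrow> (real \<Rightarrow> complex) \<Rightarrow> real \<Rightarrow> complex" where
  "PF T \<sigma> f x =
     (LINT y|lebI. of_real (\<Sum>\<^sub>\<infinity>j\<in>(UNIV :: int set). normal_density 0 \<sigma> (x + 2 * of_int j - T y)) * f y)"

definition PFk :: "(real \<Rightarrow> real) \<Rightarrow> real \<Rightarrow> nat \<Rightarrow> (real \<Rightarrow> complex) \<Rightarrow> real \<Rightarrow> complex" where
  "PFk T \<sigma> k = proj k \<circ> PF T \<sigma> \<circ> proj k"

definition C_const :: "(real \<Rightarrow> real) \<Rightarrow> real \<Rightarrow> nat \<Rightarrow> nat \<Rightarrow> real" where
  "C_const T \<sigma> k i = opnorm_L2I (PFk T \<sigma> k ^^ i) U0"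

section \<open>The error bound\<close>

definition coth :: "real \<Rightarrow> real" where
  "coth x = cosh x / sinh x"

definition Gam :: "real \<Rightarrow> nat \<Rightarrow> real" where
  "Gam \<sigma> k = sqrt (1 / (\<sigma> * sqrt pi) * coth (1 / (2 * \<sigma>\<^sup>2))) * exp (- (\<sigma>\<^sup>2 * pi\<^sup>2 * (real k)\<^sup>2 / 2))"

definition Gam1 :: "real \<Rightarrow> nat \<Rightarrow> real" where
  "Gam1 \<sigma> k = (\<Sum>\<^sub>\<infinity>j\<in>{j :: int. \<bar>j\<bar> > int k}. exp (- (\<sigma>\<^sup>2 * pi\<^sup>2 * (of_int j)\<^sup>2 / 2)))"

definition norm_rho :: "real \<Rightarrow> real" where
  "norm_rho \<sigma> = sqrt (LINT x|lborel. (normal_density 0 \<sigma> x)\<^sup>2)"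

definition Delta :: "real \<Rightarrow> nat \<Rightarrow> real" where
  "Delta \<sigma> k = Gam \<sigma> k * (1 + Gam1 \<sigma> k) + norm_rho \<sigma> * sqrt (coth (1 / (2 * \<sigma>\<^sup>2))) * Gam1 \<sigma> k"

definition Err :: "(real \<Rightarrow> real) \<Rightarrow> real \<Rightarrow> nat \<Rightarrow> nat \<Rightarrow> (real \<Rightarrow> complex) \<Rightarrow> real" where
  "Err T \<sigma> k n g =
     1 / (1 - C_const T \<sigma> k n) *
     (\<Sum>i<n. C_const T \<sigma> k i * (Delta \<sigma> k + norm_L2I (\<lambda>x. PFk T \<sigma> k g x - g x)))"

end

theory Submission
  imports Defs "HOL-Complex_Analysis.Cauchy_Integral_Formula" "HOL-Library.Discrete_Functions"
    "HOL-Real_Asymp.Real_Asymp"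
begin

text \<open>
  One step of the system from \<open>y\<close> has the density \<open>x \<mapsto> p (x - T y)\<close> on \<open>[-1,1]\<close>, where \<open>p\<close> is the
  Gaussian density summed over the translates by \<open>2\<int>\<close> (\<open>kern\<close>). Everything rests on two properties of
  this kernel, both uniform in \<open>y\<close>.

  The first is a Doeblin bound: \<open>p \<ge> \<rho>\<^sub>\<sigma>(1) > 0\<close>. Subtracting the constant \<open>\<rho>\<^sub>\<sigma>(1)\<close> from the
  kernel does not change the image of a function of mean zero, so the annealed operator \<open>P\<close> contracts
  such functions in \<open>L\<^sup>1\<close> by \<open>r = 1 - 2\<rho>\<^sub>\<sigma>(1)\<close> (\<open>PF_contraction\<close>). Iterating \<open>P\<close> from the uniform
  density gives an invariant density, and the contraction shows that it is the only one, because the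
  law after one step always has a density.

  The second is Poisson summation (\<open>kern_eq_theta\<close>): the Fourier coefficients of \<open>p\<close> are
  \<open>exp (-\<sigma>\<^sup>2\<pi>\<^sup>2j\<^sup>2/2) / 2\<close>, and \<open>p\<close> is the sum of its Fourier series. Those of an invariant density decay
  at the same rate, so its Fourier series extends to an entire function, which gives analyticity. The tail of the
  series also bounds \<open>P - \<pi>\<^sub>k P\<close>, in the sup norm by \<open>\<Gamma>\<^sup>(\<^sup>1\<^sup>)/2\<close> and in \<open>L\<^sup>2\<close> by \<open>\<Gamma>\<close>, relative to the
  \<open>L\<^sup>1\<close> norm of the argument; hence \<open>\<parallel>(P - P\<^sub>k) f\<parallel> \<le> \<Delta>\<^sub>k\<close> for the invariant density \<open>f\<close>
  (\<open>consistency_error\<close>).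

  For the enclosure, \<open>d = f - g\<close> has mean zero and \<open>d - P\<^sub>k\<^sup>n d\<close> telescopes into
  \<open>\<Sum>i<n. P\<^sub>k\<^sup>i (d - P\<^sub>k d)\<close>, where \<open>d - P\<^sub>k d\<close> is the consistency error minus the residual of \<open>g\<close>; this
  gives \<open>\<parallel>d\<parallel> \<le> E\<^bsub>k,n\<^esub>(g)\<close> (\<open>galerkin_error\<close>). For precision, the operator \<open>P (1 - \<pi>\<^sub>k)\<close> need not
  be small at a rate independent of \<open>T\<close>, but since \<open>\<pi>\<^sub>k\<close> is idempotent the powers of \<open>P\<^sub>k\<close> only involve \<open>\<pi>\<^sub>k P\<close>, which
  contracts functions of mean zero in \<open>L\<^sup>1\<close> by \<open>r + \<Gamma>\<^sup>(\<^sup>1\<^sup>)\<close>. So \<open>C\<^bsub>k,n\<^esub> \<le> 1/2\<close> for one \<open>n\<close> and all large \<open>k\<close>,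
  and \<open>g = \<pi>\<^sub>k f\<close> has a residual that tends to 0 with \<open>k\<close> (\<open>Err_arbitrarily_small\<close>).

  For the Birkhoff averages, the Doeblin bound makes the correlations of the stationary chain decay
  geometrically, so the variance of a sum of \<open>n\<close> terms is \<open>O(n)\<close>. Chebyshev along the squares and
  monotonicity in between give the strong law for nonnegative observables, and a general observable
  is split into four nonnegative parts (\<open>strong_law_chain\<close>).
\<close>

section \<open>The wrapped Gaussian kernel\<close>

text \<open>The density at \<open>u\<close> of the wrapped noise on a circle of length 2.\<close>

definition kern :: "real \<Rightarrow> real \<Rightarrow> real" where
  "kern \<sigma> u = (\<Sum>\<^sub>\<infinity>j\<in>(UNIV :: int set). normal_density 0 \<sigma> (u + 2 * of_int j))"

text \<open>An exponential majorant turns sums over translates into geometric series; the constant comes from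
  \<open>(\<bar>x\<bar> - \<sigma>\<^sup>2)\<^sup>2 \<ge> 0\<close>.\<close>

lemma normal_density_le_exp:
  assumes "\<sigma> > 0"
  shows "normal_density 0 \<sigma> x \<le> exp (\<sigma>\<^sup>2 / 2) / sqrt (2 * pi * \<sigma>\<^sup>2) * exp (- \<bar>x\<bar>)"
proof -
  have "- (x - 0)\<^sup>2 / (2 * \<sigma>\<^sup>2) \<le> \<sigma>\<^sup>2 / 2 + - \<bar>x\<bar>"
  proof -
    have "0 \<le> (\<bar>x\<bar> - \<sigma>\<^sup>2)\<^sup>2" by simp
    also have "\<dots> = x\<^sup>2 - 2 * \<sigma>\<^sup>2 * \<bar>x\<bar> + \<sigma>\<^sup>2 * \<sigma>\<^sup>2"
      by (simp add: power2_eq_square algebra_simps)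
    finally show ?thesis using assms by (simp add: field_simps power2_eq_square)
  qed
  then have "exp (- (x - 0)\<^sup>2 / (2 * \<sigma>\<^sup>2)) \<le> exp (\<sigma>\<^sup>2 / 2) * exp (- \<bar>x\<bar>)"
    by (simp add: exp_add [symmetric])
  then show ?thesis
    unfolding normal_density_def by (simp add: divide_right_mono)
qed

lemma summable_on_int_even:
  fixes g :: "nat \<Rightarrow> real"
  assumes "summable g" "\<And>n. g n \<ge> 0"
  shows "(\<lambda>j::int. g (nat \<bar>j\<bar>)) summable_on UNIV"
proof -
  have g: "g summable_on UNIV"
    using assms by (intro norm_summable_imp_summable_on) auto
  have 1: "(\<lambda>j::int. g (nat \<bar>j\<bar>)) summable_on (range int)"
    using g by (subst summable_on_reindex) (auto simp: o_def)
  have 2: "(\<lambda>j::int. g (nat \<bar>j\<bar>)) summable_on (range (\<lambda>n. - int n))"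
    using g by (subst summable_on_reindex) (auto simp: o_def inj_on_def)
  have "x \<in> range int \<union> range (\<lambda>n. - int n)" for x
    by (cases x rule: int_cases2) auto
  then have "UNIV = range int \<union> range (\<lambda>n. - int n)"
    by blast
  with summable_on_union[OF 1 2] show ?thesis by simp
qed

lemma summable_on_exp_int: "(\<lambda>j::int. exp (- 2 * \<bar>real_of_int j\<bar>)) summable_on UNIV"
proof -
  have "summable (\<lambda>n. exp (-2::real) ^ n)" by (intro summable_geometric) auto
  then have "summable (\<lambda>n. exp (-2 * real n))" by (simp add: exp_of_nat_mult[symmetric] mult.commute)
  from summable_on_int_even[OF this] show ?thesis by simp
qed

lemma normal_density_shift_bound:
  assumes "\<sigma> > 0" "\<bar>u\<bar> \<le> R"
  shows "norm (normal_density 0 \<sigma> (u + 2 * of_int j)) \<le>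
     exp (\<sigma>\<^sup>2 / 2) / sqrt (2 * pi * \<sigma>\<^sup>2) * exp R * exp (- 2 * \<bar>real_of_int j\<bar>)"
proof -
  have "exp (- \<bar>u + 2 * of_int j\<bar>) \<le> exp R * exp (- 2 * \<bar>real_of_int j\<bar>)"
    using assms(2) unfolding exp_add[symmetric] by simp
  then have "exp (\<sigma>\<^sup>2 / 2) / sqrt (2 * pi * \<sigma>\<^sup>2) * exp (- \<bar>u + 2 * of_int j\<bar>) \<le>
     exp (\<sigma>\<^sup>2 / 2) / sqrt (2 * pi * \<sigma>\<^sup>2) * (exp R * exp (- 2 * \<bar>real_of_int j\<bar>))"
    by (intro mult_left_mono) auto
  with normal_density_le_exp[OF assms(1), of "u + 2 * of_int j"] show ?thesis
    by (simp add: mult.assoc)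
qed

lemma kern_has_sum:
  assumes "\<sigma> > 0"
  shows "((\<lambda>j::int. normal_density 0 \<sigma> (u + 2 * of_int j)) has_sum kern \<sigma> u) UNIV"
proof -
  have "(\<lambda>j::int. exp (\<sigma>\<^sup>2 / 2) / sqrt (2 * pi * \<sigma>\<^sup>2) * exp \<bar>u\<bar> * exp (- 2 * \<bar>real_of_int j\<bar>)) summable_on UNIV"
    by (intro summable_on_cmult_right summable_on_exp_int)
  then have "(\<lambda>j::int. normal_density 0 \<sigma> (u + 2 * of_int j)) summable_on UNIV"
    by (rule summable_on_comparison_test)
       (use normal_density_shift_bound[OF assms order_refl, of u] in auto)
  then show ?thesis unfolding kern_def by (rule has_sum_infsum)
qed

lemma continuous_kern:
  assumes "\<sigma> > 0"
  shows "continuous_on UNIV (kern \<sigma>)"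
proof -
  have *: "continuous_on {-R<..<R} (kern \<sigma>)" for R
  proof -
    have "uniform_limit {-R<..<R} (\<lambda>X u. \<Sum>j\<in>X. normal_density 0 \<sigma> (u + 2 * of_int j))
       (\<lambda>u. \<Sum>\<^sub>\<infinity>j\<in>(UNIV::int set). normal_density 0 \<sigma> (u + 2 * of_int j)) (finite_subsets_at_top UNIV)"
    proof (rule Weierstrass_m_test_general)
      show "norm (normal_density 0 \<sigma> (u + 2 * of_int j)) \<le>
         exp (\<sigma>\<^sup>2 / 2) / sqrt (2 * pi * \<sigma>\<^sup>2) * exp R * exp (- 2 * \<bar>real_of_int j\<bar>)"
        if "u \<in> {-R<..<R}" for j u
        using that by (intro normal_density_shift_bound assms) auto
      show "(\<lambda>j::int. exp (\<sigma>\<^sup>2 / 2) / sqrt (2 * pi * \<sigma>\<^sup>2) * exp R * exp (- 2 * \<bar>real_of_int j\<bar>)) summable_on UNIV"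
        by (intro summable_on_cmult_right summable_on_exp_int)
    qed
    then show ?thesis
      unfolding kern_def
      by (rule uniform_limit_theorem[rotated])
         (use assms in \<open>auto simp: normal_density_def intro!: always_eventually continuous_intros\<close>)
  qed
  have "isCont (kern \<sigma>) x" for x
  proof -
    have "x \<in> {-(\<bar>x\<bar>+1)<..<\<bar>x\<bar>+1}" by auto
    with *[of "\<bar>x\<bar>+1"] show ?thesis
      using continuous_on_eq_continuous_at open_greaterThanLessThan by blast
  qed
  then show ?thesis by (simp add: continuous_at_imp_continuous_on)
qed

lemma kern_borel: "\<sigma> > 0 \<Longrightarrow> kern \<sigma> \<in> borel_measurable borel"
  by (intro borel_measurable_continuous_onI continuous_kern)

lemma kern_periodic: "kern \<sigma> (u + 2 * of_int n) = kern \<sigma> u"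
proof -
  have "bij_betw (\<lambda>j. j + n) UNIV (UNIV::int set)"
    by (rule bij_betwI[where g = "\<lambda>j. j - n"]) auto
  from infsum_reindex_bij_betw[OF this, of "\<lambda>j. normal_density 0 \<sigma> (u + 2 * of_int j)"]
  show ?thesis unfolding kern_def by (simp add: algebra_simps)
qed

lemma kern_minus: "kern \<sigma> (- u) = kern \<sigma> u"
proof -
  have "bij_betw uminus UNIV (UNIV::int set)"
    by (rule bij_betwI[where g = uminus]) auto
  from infsum_reindex_bij_betw[OF this, of "\<lambda>j. normal_density 0 \<sigma> (u + 2 * of_int j)"]
  have "kern \<sigma> u = (\<Sum>\<^sub>\<infinity>j\<in>(UNIV::int set). normal_density 0 \<sigma> (u - 2 * of_int j))"
    unfolding kern_def by simp
  also have "(\<lambda>j::int. normal_density 0 \<sigma> (u - 2 * of_int j)) = (\<lambda>j. normal_density 0 \<sigma> (- u + 2 * of_int j))"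
    by (simp add: normal_density_def power2_commute)
  finally show ?thesis unfolding kern_def by simp
qed

lemma wrap_eq: "wrap x = x + 2 * of_int (- \<lfloor>(x + 1) / 2\<rfloor>)"
  by (simp add: wrap_def)

lemma wrap_range: "wrap x \<in> {-1..<1}"
proof -
  have "of_int \<lfloor>(x + 1) / 2\<rfloor> \<le> (x + 1) / 2" "(x + 1) / 2 < of_int \<lfloor>(x + 1) / 2\<rfloor> + 1"
    by linarith+
  then show ?thesis by (auto simp: wrap_def field_simps)
qed

lemma wrap_shift: "x \<in> {-1..<1} \<Longrightarrow> wrap (x + 2 * of_int j) = x"
proof -
  assume x: "x \<in> {-1..<1}"
  have "\<lfloor>(x + 2 * of_int j + 1) / 2\<rfloor> = j"
    using x by (intro floor_unique) (auto simp: field_simps)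
  then show ?thesis by (simp add: wrap_def)
qed

lemma wrap_borel [measurable]: "wrap \<in> borel_measurable borel"
  unfolding wrap_def by measurable

lemma kern_wrap: "kern \<sigma> (wrap x) = kern \<sigma> x"
  unfolding wrap_eq by (rule kern_periodic)

text \<open>Doeblin minorisation: every \<open>u\<close> has a translate by an even integer in \<open>[-1,1)\<close>, and that term of
  the sum already has the claimed size.\<close>

lemma kern_ge:
  assumes "\<sigma> > 0"
  shows "normal_density 0 \<sigma> 1 \<le> kern \<sigma> u"
proof -
  define j where "j = - \<lfloor>(u + 1) / 2\<rfloor>"
  have w: "u + 2 * of_int j = wrap u" by (simp add: j_def wrap_eq)
  have "\<bar>wrap u\<bar> \<le> 1" using wrap_range[of u] by auto
  then have "(wrap u)\<^sup>2 \<le> 1" by (simp add: abs_square_le_1)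
  then have "- 1\<^sup>2 / (2 * \<sigma>\<^sup>2) \<le> - (wrap u)\<^sup>2 / (2 * \<sigma>\<^sup>2)"
    using assms by (intro divide_right_mono) auto
  then have le: "normal_density 0 \<sigma> 1 \<le> normal_density 0 \<sigma> (u + 2 * of_int j)"
    unfolding w normal_density_def using assms by (intro mult_left_mono) auto
  have has_sum_single_j: "((\<lambda>j. normal_density 0 \<sigma> (u + 2 * of_int j)) has_sum normal_density 0 \<sigma> (u + 2 * of_int j)) {j}"
    by (simp add: has_sum_finite_iff)
  note le
  also have "\<dots> \<le> kern \<sigma> u"
    by (rule has_sum_mono2[OF has_sum_single_j kern_has_sum[OF assms, of u]]) auto
  finally show ?thesis .
qed

lemma kern_pos: "\<sigma> > 0 \<Longrightarrow> 0 < kern \<sigma> u"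
  using kern_ge[of \<sigma> u] normal_density_pos[of \<sigma> 0 1] by linarith

lemma kern_bounded:
  assumes "\<sigma> > 0"
  shows "\<exists>B>0. \<forall>u. kern \<sigma> u \<le> B"
proof -
  have "bounded (kern \<sigma> ` {-1..1})"
    by (intro compact_imp_bounded compact_continuous_image continuous_on_subset[OF continuous_kern[OF assms]]) auto
  then obtain B where B: "B > 0" "\<And>x. x \<in> {-1..1} \<Longrightarrow> norm (kern \<sigma> x) \<le> B"
    unfolding bounded_pos by auto
  have "kern \<sigma> u \<le> B" for u
    using B(2)[of "wrap u"] wrap_range[of u] by (auto simp: kern_wrap)
  with B(1) show ?thesis by blast
qed

section \<open>Folding the line onto the circle\<close>

lemma ennreal_kern:
  assumes "\<sigma> > 0"
  shows "ennreal (kern \<sigma> u) = (\<integral>\<^sup>+j. ennreal (normal_density 0 \<sigma> (u + 2 * of_int j)) \<partial>count_space (UNIV::int set))"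
proof -
  let ?f = "\<lambda>j::int. normal_density 0 \<sigma> (u + 2 * of_int j)"
  have "?f summable_on UNIV" using kern_has_sum[OF assms] by (rule has_sum_imp_summable)
  then have "(\<lambda>j. norm (?f j)) summable_on UNIV"
    by (rule summable_on_iff_abs_summable_on_real[THEN iffD1])
  then have *: "Infinite_Set_Sum.abs_summable_on ?f UNIV" unfolding abs_summable_equivalent .
  show ?thesis
    by (subst nn_integral_conv_infsetsum[OF *]) (auto simp: infsetsum_infsum[OF *] kern_def)
qed

lemma sets_lebI: "sets lebI = sets (restrict_space borel {-1..1})"
  unfolding lebI_def by (intro sets_restrict_space_cong) simp

lemma space_lebI [simp]: "space lebI = {-1..1}"
  unfolding lebI_def by (simp add: space_restrict_space)

lemma measurable_lebI_borel: "h \<in> borel \<rightarrow>\<^sub>M N \<Longrightarrow> h \<in> lebI \<rightarrow>\<^sub>M N"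
  unfolding lebI_def by (intro measurable_restrict_space1) simp

text \<open>The Borel sets of \<open>[-1,1]\<close> form a different \<open>\<sigma>\<close>-algebra from those of the line; this is the
  inclusion map, and the next two are its versions on products.\<close>

lemma lebI_id [measurable (raw)]: "(\<lambda>x. x) \<in> lebI \<rightarrow>\<^sub>M borel"
  by (rule measurable_lebI_borel) simp

lemma lebI_fst [measurable (raw)]: "(\<lambda>p. fst p) \<in> lebI \<Otimes>\<^sub>M M \<rightarrow>\<^sub>M borel"
  by (rule measurable_compose[OF measurable_fst lebI_id])

lemma lebI_snd [measurable (raw)]: "(\<lambda>p. snd p) \<in> M \<Otimes>\<^sub>M lebI \<rightarrow>\<^sub>M borel"
  by (rule measurable_compose[OF measurable_snd lebI_id])

lemma nn_integral_lebI:
  assumes [measurable]: "h \<in> borel_measurable borel"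
  shows "(\<integral>\<^sup>+x. h x \<partial>lebI) = (\<integral>\<^sup>+x. h x * indicator {-1..<1} x \<partial>lborel)"
proof -
  have "(\<integral>\<^sup>+x. h x \<partial>lebI) = (\<integral>\<^sup>+x. h x * indicator {-1..1} x \<partial>lborel)"
    unfolding lebI_def by (subst nn_integral_restrict_space) auto
  also have "\<dots> = (\<integral>\<^sup>+x. h x * indicator {-1..<1} x \<partial>lborel)"
  proof (rule nn_integral_cong_AE)
    show "AE x in lborel. h x * indicator {-1..1} x = h x * indicator {-1..<1} x"
      using AE_lborel_singleton[of "1::real"] by eventually_elim (auto simp: indicator_def)
  qed
  finally show ?thesis .
qed

text \<open>Each real number is uniquely \<open>x + 2 j\<close> with \<open>x \<in> [-1,1)\<close>; Tonelli exchanges the sum over \<open>j\<close> with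
  the integral.\<close>

lemma nn_integral_fold:
  assumes [measurable]: "h \<in> borel_measurable borel"
  shows "(\<integral>\<^sup>+u. h u \<partial>lborel) =
    (\<integral>\<^sup>+x. (\<integral>\<^sup>+j. h (x + 2 * of_int j) \<partial>count_space (UNIV::int set)) \<partial>lebI)"
proof -
  interpret C: sigma_finite_measure "count_space (UNIV::int set)"
    by (rule sigma_finite_measure_count_space_countable) simp
  interpret P: pair_sigma_finite lborel "count_space (UNIV::int set)" ..
  have "(\<integral>\<^sup>+u. h u \<partial>lborel) =
    (\<integral>\<^sup>+u. (\<integral>\<^sup>+j. h u * indicator {-1..<1} (u + 2 * of_int (- j)) \<partial>count_space (UNIV::int set)) \<partial>lborel)"
  proof (intro nn_integral_cong)
    fix u :: real
    define k where "k = \<lfloor>(u + 1) / 2\<rfloor>"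
    have "u + 2 * of_int (- j) \<in> {-1..<1} \<longleftrightarrow> j = k" for j
      unfolding k_def by (auto simp: floor_eq_iff field_simps eq_commute[of j])
    then have "indicator {-1..<1} (u + 2 * of_int (- j)) = (indicator {k} j :: ennreal)" for j
      by (auto simp: indicator_def)
    then show "h u = (\<integral>\<^sup>+j. h u * indicator {-1..<1} (u + 2 * of_int (- j)) \<partial>count_space (UNIV::int set))"
      by (subst nn_integral_count_space'[of "{k}"]) auto
  qed
  also have "\<dots> = (\<integral>\<^sup>+j. (\<integral>\<^sup>+u. h u * indicator {-1..<1} (u + 2 * of_int (- j)) \<partial>lborel) \<partial>count_space (UNIV::int set))"
    by (rule P.Fubini'[of "\<lambda>u j. h u * indicator {-1..<1} (u + 2 * of_int (- j))", symmetric]) measurable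
  also have "\<dots> = (\<integral>\<^sup>+j. (\<integral>\<^sup>+x. h (x + 2 * of_int j) * indicator {-1..<1} x \<partial>lborel) \<partial>count_space (UNIV::int set))"
  proof (rule nn_integral_cong)
    fix j :: int
    have "(\<integral>\<^sup>+u. h u * indicator {-1..<1} (u + 2 * of_int (- j)) \<partial>lborel) =
       (\<integral>\<^sup>+x. h (2 * of_int j + 1 * x) * indicator {-1..<1} (2 * of_int j + 1 * x + 2 * of_int (- j)) \<partial>lborel)"
      by (subst nn_integral_real_affine[where c = 1 and t = "2 * of_int j"]) (auto simp: ac_simps)
    then show "(\<integral>\<^sup>+u. h u * indicator {-1..<1} (u + 2 * of_int (- j)) \<partial>lborel) =
       (\<integral>\<^sup>+x. h (x + 2 * of_int j) * indicator {-1..<1} x \<partial>lborel)"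
      by (simp add: add.commute)
  qed
  also have "\<dots> = (\<integral>\<^sup>+x. (\<integral>\<^sup>+j. h (x + 2 * of_int j) * indicator {-1..<1} x \<partial>count_space (UNIV::int set)) \<partial>lborel)"
    by (rule P.Fubini'[of "\<lambda>x j. h (x + 2 * of_int j) * indicator {-1..<1} x"]) measurable
  also have "\<dots> = (\<integral>\<^sup>+x. (\<integral>\<^sup>+j. h (x + 2 * of_int j) \<partial>count_space (UNIV::int set)) * indicator {-1..<1} x \<partial>lborel)"
    by (subst nn_integral_multc) auto
  also have "\<dots> = (\<integral>\<^sup>+x. (\<integral>\<^sup>+j. h (x + 2 * of_int j) \<partial>count_space (UNIV::int set)) \<partial>lebI)"
    by (subst nn_integral_lebI) auto
  finally show ?thesis .
qed

lemma sets_gauss [measurable_cong, simp]: "sets (gauss \<sigma>) = sets borel"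
  by (simp add: gauss_def)

lemma space_gauss [simp]: "space (gauss \<sigma>) = UNIV"
  by (simp add: gauss_def)

lemma prob_space_gauss: "\<sigma> > 0 \<Longrightarrow> prob_space (gauss \<sigma>)"
  unfolding gauss_def by (rule prob_space_normal_density)

lemma nn_integral_gauss_wrap:
  assumes "\<sigma> > 0" and [measurable]: "h \<in> borel_measurable borel"
  shows "(\<integral>\<^sup>+w. h (wrap (a + w)) \<partial>gauss \<sigma>) = (\<integral>\<^sup>+x. ennreal (kern \<sigma> (x - a)) * h x \<partial>lebI)"
proof -
  interpret C: sigma_finite_measure "count_space (UNIV::int set)"
    by (rule sigma_finite_measure_count_space_countable) simp
  have [measurable]: "kern \<sigma> \<in> borel_measurable borel" using assms(1) by (rule kern_borel)
  have "(\<integral>\<^sup>+w. h (wrap (a + w)) \<partial>gauss \<sigma>) =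
     (\<integral>\<^sup>+w. ennreal (normal_density 0 \<sigma> w) * h (wrap (a + w)) \<partial>lborel)"
    unfolding gauss_def by (subst nn_integral_density) auto
  also have "\<dots> = (\<integral>\<^sup>+u. ennreal (normal_density 0 \<sigma> (- a + 1 * u)) * h (wrap (a + (- a + 1 * u))) \<partial>lborel)"
    by (subst nn_integral_real_affine[where c = 1 and t = "- a"]) auto
  also have "\<dots> = (\<integral>\<^sup>+u. ennreal (normal_density 0 \<sigma> (u - a)) * h (wrap u) \<partial>lborel)"
    by (simp add: algebra_simps)
  also have "\<dots> = (\<integral>\<^sup>+x. (\<integral>\<^sup>+j. ennreal (normal_density 0 \<sigma> (x + 2 * of_int j - a)) * h (wrap (x + 2 * of_int j))
      \<partial>count_space (UNIV::int set)) * indicator {-1..<1} x \<partial>lborel)"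
    by (subst nn_integral_fold, simp, subst nn_integral_lebI) auto
  also have "\<dots> = (\<integral>\<^sup>+x. (\<integral>\<^sup>+j. ennreal (normal_density 0 \<sigma> (x - a + 2 * of_int j)) \<partial>count_space (UNIV::int set)) * h x
       * indicator {-1..<1} x \<partial>lborel)"
  proof (intro nn_integral_cong)
    fix x :: real
    show "(\<integral>\<^sup>+j. ennreal (normal_density 0 \<sigma> (x + 2 * of_int j - a)) * h (wrap (x + 2 * of_int j))
      \<partial>count_space (UNIV::int set)) * indicator {-1..<1} x =
     (\<integral>\<^sup>+j. ennreal (normal_density 0 \<sigma> (x - a + 2 * of_int j)) \<partial>count_space (UNIV::int set)) * h x
       * indicator {-1..<1} x"
    proof (cases "x \<in> {-1..<1}")
      case True
      have eq: "x + 2 * of_int j - a = x - a + 2 * of_int j" for j by simp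
      show ?thesis
        unfolding eq wrap_shift[OF True] by (subst nn_integral_multc) auto
    qed simp
  qed
  also have "\<dots> = (\<integral>\<^sup>+x. ennreal (kern \<sigma> (x - a)) * h x \<partial>lebI)"
    by (subst nn_integral_lebI) (auto simp: ennreal_kern[OF assms(1)])
  finally show ?thesis .
qed

lemma kern_borel_lebI: "\<sigma> > 0 \<Longrightarrow> (\<lambda>x. kern \<sigma> (x - a)) \<in> borel_measurable lebI"
proof -
  assume "\<sigma> > 0"
  then have [measurable]: "kern \<sigma> \<in> borel_measurable borel" by (rule kern_borel)
  show ?thesis by (intro measurable_lebI_borel) measurable
qed

text \<open>This is where the random dynamics meets the kernel: folding identifies the law of one noisy step.\<close>

lemma distr_gauss_wrap:
  assumes "\<sigma> > 0"
  shows "distr (gauss \<sigma>) (restrict_space borel {-1..1}) (\<lambda>w. wrap (a + w)) = density lebI (\<lambda>x. ennreal (kern \<sigma> (x - a)))"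
proof (rule measure_eqI)
  have [measurable]: "kern \<sigma> \<in> borel_measurable borel" using assms by (rule kern_borel)
  have m: "(\<lambda>w. wrap (a + w)) \<in> gauss \<sigma> \<rightarrow>\<^sub>M restrict_space borel {-1..1}"
    using wrap_range by (intro measurable_restrict_space2) (auto simp: less_imp_le)
  fix A assume "A \<in> sets (distr (gauss \<sigma>) (restrict_space borel {-1..1}) (\<lambda>w. wrap (a + w)))"
  then have A: "A \<in> sets (restrict_space borel {-1..1::real})" by simp
  then have [measurable]: "A \<in> sets borel" by (auto simp: sets_restrict_space)
  have [measurable]: "A \<in> sets lebI" using A by (simp add: sets_lebI)
  have "emeasure (distr (gauss \<sigma>) (restrict_space borel {-1..1}) (\<lambda>w. wrap (a + w))) A =
      (\<integral>\<^sup>+w. indicator A (wrap (a + w)) \<partial>gauss \<sigma>)"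
    using m A by (subst nn_integral_indicator[symmetric], simp, subst nn_integral_distr) auto
  also have "\<dots> = (\<integral>\<^sup>+x. ennreal (kern \<sigma> (x - a)) * indicator A x \<partial>lebI)"
    by (rule nn_integral_gauss_wrap[OF assms]) simp
  also have "\<dots> = emeasure (density lebI (\<lambda>x. ennreal (kern \<sigma> (x - a)))) A"
    using kern_borel_lebI[OF assms] by (subst emeasure_density) auto
  finally show "emeasure (distr (gauss \<sigma>) (restrict_space borel {-1..1}) (\<lambda>w. wrap (a + w))) A =
     emeasure (density lebI (\<lambda>x. ennreal (kern \<sigma> (x - a)))) A" .
qed (simp add: sets_lebI)

lemma integral_kern_shift:
  fixes h :: "real \<Rightarrow> complex"
  assumes "\<sigma> > 0" and [measurable]: "h \<in> borel_measurable borel"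
  shows "(LINT x|lebI. of_real (kern \<sigma> (x - a)) * h x) = (LINT w|gauss \<sigma>. h (wrap (a + w)))"
proof -
  have m: "(\<lambda>w. wrap (a + w)) \<in> gauss \<sigma> \<rightarrow>\<^sub>M restrict_space borel {-1..1}"
    using wrap_range by (intro measurable_restrict_space2) (auto simp: less_imp_le)
  have "(LINT w|gauss \<sigma>. h (wrap (a + w))) =
     (LINT x|distr (gauss \<sigma>) (restrict_space borel {-1..1}) (\<lambda>w. wrap (a + w)). h x)"
    using m by (intro integral_distr[symmetric] measurable_restrict_space1) auto
  also have "\<dots> = (LINT x|lebI. kern \<sigma> (x - a) *\<^sub>R h x)"
    unfolding distr_gauss_wrap[OF assms(1)] using kern_borel_lebI[OF assms(1)] kern_pos[OF assms(1)]
    by (intro integral_density) (auto intro: less_imp_le measurable_lebI_borel)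
  finally show ?thesis by (simp add: scaleR_conv_of_real)
qed

section \<open>Fourier modes and Poisson summation\<close>

lemma finite_measure_lebI: "finite_measure lebI"
  by (rule finite_measureI) (simp add: lebI_def emeasure_restrict_space space_restrict_space)

lemma measure_lebI [simp]: "measure lebI {-1..1} = 2"
  by (simp add: lebI_def measure_restrict_space)

lemma e_mode_add: "e_mode j (x + y) = e_mode j x * e_mode j y"
  by (simp add: e_mode_def exp_add[symmetric] algebra_simps)

lemma e_mode_add_index: "e_mode (i + j) x = e_mode i x * e_mode j x"
  by (simp add: e_mode_def exp_add[symmetric] algebra_simps)

lemma e_mode_0 [simp]: "e_mode 0 x = 1" "e_mode j 0 = 1"
  by (simp_all add: e_mode_def)

lemma e_mode_cis: "e_mode j x = cis (of_int j * pi * x)"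
  by (simp add: e_mode_def cis_conv_exp mult_ac)

lemma norm_e_mode [simp]: "cmod (e_mode j x) = 1"
  by (simp add: e_mode_cis)

lemma cnj_e_mode: "cnj (e_mode j x) = e_mode (- j) x"
  by (simp add: e_mode_cis cis_cnj)

lemma e_mode_minus: "e_mode j (- x) = e_mode (- j) x"
  by (simp add: e_mode_cis)

lemma e_mode_period: "e_mode j (x + 2 * of_int n) = e_mode j x"
proof -
  have "of_int j * pi * (2 * of_int n) = 2 * pi * of_int (j * n)" by simp
  then have "e_mode j (2 * of_int n) = 1"
    unfolding e_mode_cis by (metis cis_multiple_2pi Ints_of_int)
  then show ?thesis by (simp add: e_mode_add)
qed

lemma e_mode_wrap: "e_mode j (wrap x) = e_mode j x"
  unfolding wrap_eq by (rule e_mode_period)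

lemma continuous_e_mode [continuous_intros]: "continuous_on A (e_mode j)"
  unfolding e_mode_def by (intro continuous_intros)

lemma e_mode_borel [measurable]: "e_mode j \<in> borel_measurable borel"
  by (intro borel_measurable_continuous_onI continuous_e_mode)

lemma integral_e_mode: "(LINT x|lebI. e_mode j x) = (if j = 0 then 2 else 0)"
proof (cases "j = 0")
  case True
  then show ?thesis by (simp add: scaleR_conv_of_real)
next
  case False
  let ?F = "\<lambda>x. e_mode j x / (of_int j * of_real pi * \<i>)"
  have "(?F has_vector_derivative e_mode j x) (at x within {-1..1})" for x
    unfolding e_mode_def using False
    by (auto intro!: derivative_eq_intros simp: field_simps has_field_derivative_def
        intro: has_vector_derivative_real_field)
  then have "(LBINT x. indicator {-1..1} x *\<^sub>R e_mode j x) = ?F 1 - ?F (-1)"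
    by (intro integral_FTC_Icc continuous_e_mode) auto
  also have "\<dots> = 0" using e_mode_period[of j "-1" 1] by simp
  also have "(LBINT x. indicator {-1..1} x *\<^sub>R e_mode j x) = (LINT x|lebI. e_mode j x)"
    unfolding lebI_def by (subst integral_restrict_space) auto
  finally show ?thesis using False by simp
qed

text \<open>The characteristic function of the noise at \<open>\<pi> t\<close>; at an integer it is twice a Fourier coefficient
  of the kernel.\<close>

definition gauss_coeff :: "real \<Rightarrow> real \<Rightarrow> real" where
  "gauss_coeff \<sigma> t = exp (- (\<sigma>\<^sup>2 * pi\<^sup>2 * t\<^sup>2 / 2))"

lemma gauss_coeff_minus [simp]: "gauss_coeff \<sigma> (- t) = gauss_coeff \<sigma> t"
  by (simp add: gauss_coeff_def)

lemma gauss_coeff_0 [simp]: "gauss_coeff \<sigma> 0 = 1"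
  by (simp add: gauss_coeff_def)

lemma gauss_coeff_pos [simp]: "0 < gauss_coeff \<sigma> t"
  by (simp add: gauss_coeff_def)

lemma integral_gauss_e_mode:
  assumes "\<sigma> > 0"
  shows "(LINT w|gauss \<sigma>. e_mode j w) = of_real (gauss_coeff \<sigma> (of_int j))"
proof -
  have "(LINT w|gauss \<sigma>. e_mode j w) = (LINT w|lborel. normal_density 0 \<sigma> w *\<^sub>R e_mode j w)"
    unfolding gauss_def by (intro integral_density) auto
  also have "\<dots> = \<bar>\<sigma>\<bar> *\<^sub>R (LINT w|lborel. normal_density 0 \<sigma> (0 + \<sigma> * w) *\<^sub>R e_mode j (0 + \<sigma> * w))"
    using assms by (intro lborel_integral_real_affine) auto
  also have "\<dots> = (LINT w|lborel. \<sigma> *\<^sub>R (normal_density 0 \<sigma> (\<sigma> * w) *\<^sub>R e_mode j (\<sigma> * w)))"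
    using assms by (subst integral_scaleR_right[symmetric]) auto
  also have "\<dots> = (LINT w|lborel. std_normal_density w *\<^sub>R iexp ((of_int j * pi * \<sigma>) * w))"
  proof (intro Bochner_Integration.integral_cong refl)
    fix w :: real
    have "\<sigma> * normal_density 0 \<sigma> (\<sigma> * w) = std_normal_density w"
      using assms by (simp add: normal_density_def real_sqrt_mult power_mult_distrib field_simps)
    then show "\<sigma> *\<^sub>R (normal_density 0 \<sigma> (\<sigma> * w) *\<^sub>R e_mode j (\<sigma> * w)) =
        std_normal_density w *\<^sub>R iexp ((of_int j * pi * \<sigma>) * w)"
      by (simp add: e_mode_def mult_ac)
  qed
  also have "\<dots> = char std_normal_distribution (of_int j * pi * \<sigma>)"
    unfolding char_def by (subst integral_density) auto
  also have "\<dots> = of_real (gauss_coeff \<sigma> (of_int j))"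
    unfolding char_std_normal_distribution gauss_coeff_def by (simp add: power_mult_distrib mult_ac)
  finally show ?thesis .
qed

text \<open>The modes do not see the folding, so their integral against the kernel is the characteristic
  function of the unfolded Gaussian.\<close>

lemma integral_kern_e_mode:
  assumes "\<sigma> > 0"
  shows "(LINT x|lebI. of_real (kern \<sigma> (x - a)) * e_mode j x) = of_real (gauss_coeff \<sigma> (of_int j)) * e_mode j a"
proof -
  have "(LINT x|lebI. of_real (kern \<sigma> (x - a)) * e_mode j x) = (LINT w|gauss \<sigma>. e_mode j (wrap (a + w)))"
    by (rule integral_kern_shift) (use assms in auto)
  also have "\<dots> = e_mode j a * (LINT w|gauss \<sigma>. e_mode j w)"
    by (simp add: e_mode_wrap e_mode_add)
  finally show ?thesis by (simp add: integral_gauss_e_mode[OF assms])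
qed

text \<open>Sums over \<open>-m..m\<close> are treated as partial sums of a series indexed by the naturals, which gives
  access to the Weierstrass test and to dominated convergence.\<close>

lemma sum_symmetric_int:
  fixes F :: "int \<Rightarrow> 'b :: ab_group_add"
  shows "(\<Sum>j = - int m..int m. F j) = F 0 + (\<Sum>i<m. F (int (Suc i)) + F (- int (Suc i)))"
proof (induction m)
  case (Suc m)
  have "{- int (Suc m)..int (Suc m)} = insert (int (Suc m)) (insert (- int (Suc m)) {- int m..int m})"
    by auto
  then have "(\<Sum>j = - int (Suc m)..int (Suc m). F j) = F (int (Suc m)) + (F (- int (Suc m)) + (\<Sum>j = - int m..int m. F j))"
    by simp
  with Suc show ?case by (simp add: algebra_simps)
qed simp

text \<open>Completing the square. The linear term \<open>b t\<close> is what the growth of a mode on a horizontal strip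
  of the complex plane contributes.\<close>

lemma exp_gauss_le:
  fixes b c t :: real
  assumes "c > 0"
  shows "exp (b * t - c * t\<^sup>2) \<le> exp ((b + 1)\<^sup>2 / (4 * c)) * exp (- t)"
proof -
  have "0 \<le> (2 * c * t - (b + 1))\<^sup>2 / (4 * c)" using assms by simp
  also have "\<dots> = c * t\<^sup>2 - (b + 1) * t + (b + 1)\<^sup>2 / (4 * c)"
    using assms by (simp add: power2_eq_square field_simps)
  finally have "b * t - c * t\<^sup>2 \<le> (b + 1)\<^sup>2 / (4 * c) + - t" by (simp add: algebra_simps)
  then show ?thesis unfolding exp_add[symmetric] by simp
qed

lemma summable_exp_gauss:
  fixes b c :: real
  assumes "c > 0"
  shows "summable (\<lambda>i. exp (b * real i - c * (real i)\<^sup>2))"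
proof (rule summable_comparison_test')
  have "summable (\<lambda>i. exp (-1::real) ^ i)" by (intro summable_geometric) auto
  then show "summable (\<lambda>i. exp ((b + 1)\<^sup>2 / (4 * c)) * exp (- real i))"
    by (intro summable_mult) (simp add: exp_of_nat_mult[symmetric])
  show "norm (exp (b * real i - c * (real i)\<^sup>2)) \<le> exp ((b + 1)\<^sup>2 / (4 * c)) * exp (- real i)" for i
    using exp_gauss_le[OF assms] by simp
qed

lemma summable_gauss_coeff: "\<sigma> > 0 \<Longrightarrow> summable (\<lambda>i. gauss_coeff \<sigma> (real i))"
  using summable_exp_gauss[of "\<sigma>\<^sup>2 * pi\<^sup>2 / 2" 0] by (simp add: gauss_coeff_def)

text \<open>Partial sums of the Fourier series of the kernel, in real form.\<close>

definition theta_sum :: "real \<Rightarrow> nat \<Rightarrow> real \<Rightarrow> real" where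
  "theta_sum \<sigma> m u = 1 / 2 + (\<Sum>i<m. gauss_coeff \<sigma> (real (Suc i)) * cos (pi * real (Suc i) * u))"

lemma theta_sum_e_mode:
  "complex_of_real (theta_sum \<sigma> m u) = (\<Sum>j = - int m..int m. of_real (gauss_coeff \<sigma> (of_int j) / 2) * e_mode j u)"
proof -
  have *: "e_mode (int (Suc i)) u + e_mode (- int (Suc i)) u = of_real (2 * cos (pi * real (Suc i) * u))" for i
    unfolding cnj_e_mode[symmetric] complex_add_cnj by (simp add: e_mode_cis mult_ac)
  have **: "of_real (gauss_coeff \<sigma> (of_int (int (Suc i))) / 2) * e_mode (int (Suc i)) u +
      of_real (gauss_coeff \<sigma> (of_int (- int (Suc i))) / 2) * e_mode (- int (Suc i)) u =
     complex_of_real (gauss_coeff \<sigma> (real (Suc i)) * cos (pi * real (Suc i) * u))" for i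
  proof -
    have "of_real (gauss_coeff \<sigma> (of_int (int (Suc i))) / 2) * e_mode (int (Suc i)) u +
      of_real (gauss_coeff \<sigma> (of_int (- int (Suc i))) / 2) * e_mode (- int (Suc i)) u =
      of_real (gauss_coeff \<sigma> (real (Suc i)) / 2) * (e_mode (int (Suc i)) u + e_mode (- int (Suc i)) u)"
      unfolding of_int_minus gauss_coeff_minus of_int_of_nat_eq by (simp only: distrib_left)
    then show ?thesis unfolding * by (simp del: of_nat_Suc)
  qed
  show ?thesis
    unfolding sum_symmetric_int ** theta_sum_def by simp
qed

definition theta :: "real \<Rightarrow> real \<Rightarrow> real" where
  "theta \<sigma> u = 1 / 2 + (\<Sum>i. gauss_coeff \<sigma> (real (Suc i)) * cos (pi * real (Suc i) * u))"

lemma theta_sum_uniform: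
  assumes "\<sigma> > 0"
  shows "uniform_limit A (theta_sum \<sigma>) (theta \<sigma>) sequentially"
proof -
  have "uniform_limit A (\<lambda>m u. \<Sum>i<m. gauss_coeff \<sigma> (real (Suc i)) * cos (pi * real (Suc i) * u))
     (\<lambda>u. \<Sum>i. gauss_coeff \<sigma> (real (Suc i)) * cos (pi * real (Suc i) * u)) sequentially"
  proof (rule Weierstrass_m_test)
    show "summable (\<lambda>i. gauss_coeff \<sigma> (real (Suc i)))"
      using summable_gauss_coeff[OF assms] by (simp add: summable_Suc_iff[of "\<lambda>i. gauss_coeff \<sigma> (real i)"] del: of_nat_Suc)
    show "norm (gauss_coeff \<sigma> (real (Suc i)) * cos (pi * real (Suc i) * u)) \<le> gauss_coeff \<sigma> (real (Suc i))" for i u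
      using mult_left_mono[OF abs_cos_le_one, of "gauss_coeff \<sigma> (real (Suc i))" "pi * real (Suc i) * u"]
      by (simp add: abs_mult abs_of_pos less_imp_le del: of_nat_Suc)
  qed
  then show ?thesis
    unfolding theta_sum_def [abs_def] theta_def [abs_def]
    by (intro uniform_limit_intros)
qed

lemma theta_sum_LIMSEQ: "\<sigma> > 0 \<Longrightarrow> (\<lambda>m. theta_sum \<sigma> m u) \<longlonglongrightarrow> theta \<sigma> u"
  using tendsto_uniform_limitI[OF theta_sum_uniform[of \<sigma> UNIV]] by auto

lemma continuous_theta_sum: "continuous_on A (theta_sum \<sigma> m)"
  unfolding theta_sum_def by (intro continuous_intros)

lemma continuous_theta: "\<sigma> > 0 \<Longrightarrow> continuous_on A (theta \<sigma>)"
  by (rule uniform_limit_theorem[OF _ theta_sum_uniform]) (auto intro: always_eventually continuous_theta_sum)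

lemma theta_minus: "theta \<sigma> (- u) = theta \<sigma> u"
  by (simp add: theta_def)

lemma theta_wrap:
  assumes "\<sigma> > 0"
  shows "theta \<sigma> (wrap u) = theta \<sigma> u"
proof (rule LIMSEQ_unique)
  have "complex_of_real (theta_sum \<sigma> m (wrap u)) = of_real (theta_sum \<sigma> m u)" for m
    unfolding theta_sum_e_mode by (simp add: e_mode_wrap)
  then have *: "theta_sum \<sigma> m (wrap u) = theta_sum \<sigma> m u" for m by simp
  show "(\<lambda>m. theta_sum \<sigma> m u) \<longlonglongrightarrow> theta \<sigma> (wrap u)"
    using theta_sum_LIMSEQ[OF assms, of "wrap u"] unfolding * .
qed (rule theta_sum_LIMSEQ[OF assms])

lemma borel_measurable_theta_sum [measurable]: "theta_sum \<sigma> m \<in> borel_measurable borel"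
  by (intro borel_measurable_continuous_onI continuous_theta_sum)

lemma borel_measurable_theta: "\<sigma> > 0 \<Longrightarrow> theta \<sigma> \<in> borel_measurable borel"
  by (intro borel_measurable_continuous_onI continuous_theta)

lemma theta_sum_diff_le:
  assumes "\<sigma> > 0" "k \<le> m"
  shows "\<bar>theta_sum \<sigma> m u - theta_sum \<sigma> k u\<bar> \<le> (\<Sum>i = k..<m. gauss_coeff \<sigma> (real (Suc i)))"
proof -
  have "{..<m} = {..<k} \<union> {k..<m}" using assms by auto
  then have "theta_sum \<sigma> m u - theta_sum \<sigma> k u = (\<Sum>i = k..<m. gauss_coeff \<sigma> (real (Suc i)) * cos (pi * real (Suc i) * u))"
    unfolding theta_sum_def by (simp add: sum.union_disjoint ivl_disj_int del: of_nat_Suc)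
  also have "\<bar>\<dots>\<bar> \<le> (\<Sum>i = k..<m. gauss_coeff \<sigma> (real (Suc i)))"
  proof (rule order_trans[OF sum_abs], rule sum_mono)
    fix i
    show "\<bar>gauss_coeff \<sigma> (real (Suc i)) * cos (pi * real (Suc i) * u)\<bar> \<le> gauss_coeff \<sigma> (real (Suc i))"
      using mult_left_mono[OF abs_cos_le_one, of "gauss_coeff \<sigma> (real (Suc i))" "pi * real (Suc i) * u"]
      by (simp add: abs_mult abs_of_pos less_imp_le del: of_nat_Suc)
  qed
  finally show ?thesis .
qed

lemma theta_sum_bound: "\<sigma> > 0 \<Longrightarrow> \<bar>theta_sum \<sigma> m u\<bar> \<le> 1 / 2 + (\<Sum>i. gauss_coeff \<sigma> (real (Suc i)))"
proof -
  assume \<sigma>: "\<sigma> > 0"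
  have "\<bar>theta_sum \<sigma> m u - theta_sum \<sigma> 0 u\<bar> \<le> (\<Sum>i = 0..<m. gauss_coeff \<sigma> (real (Suc i)))"
    using \<sigma> by (rule theta_sum_diff_le) simp
  also have "\<dots> \<le> (\<Sum>i. gauss_coeff \<sigma> (real (Suc i)))"
    using summable_gauss_coeff[OF \<sigma>]
    by (intro sum_le_suminf) (auto simp: summable_Suc_iff[of "\<lambda>i. gauss_coeff \<sigma> (real i)"] less_imp_le simp del: of_nat_Suc)
  finally show ?thesis by (simp add: theta_sum_def)
qed

lemma integrable_lebI_bounded:
  fixes h :: "real \<Rightarrow> 'b :: {banach, second_countable_topology}"
  assumes "h \<in> borel_measurable lebI" "\<And>x. x \<in> {-1..1} \<Longrightarrow> norm (h x) \<le> B"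
  shows "integrable lebI h"
proof -
  interpret finite_measure lebI by (rule finite_measure_lebI)
  show ?thesis
    by (rule integrable_const_bound[where B = B]) (use assms in auto)
qed

lemma integral_theta_e_mode:
  assumes "\<sigma> > 0"
  shows "(LINT x|lebI. of_real (theta \<sigma> x) * e_mode j x) = of_real (gauss_coeff \<sigma> (of_int j))"
proof (rule LIMSEQ_unique)
  let ?B = "1 / 2 + (\<Sum>i. gauss_coeff \<sigma> (real (Suc i)))"
  have [measurable]: "theta \<sigma> \<in> borel_measurable borel" using assms by (rule borel_measurable_theta)
  show "(\<lambda>m. LINT x|lebI. of_real (theta_sum \<sigma> m x) * e_mode j x) \<longlonglongrightarrow> (LINT x|lebI. of_real (theta \<sigma> x) * e_mode j x)"
  proof (rule integral_dominated_convergence[where w = "\<lambda>_. ?B"])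
    show "integrable lebI (\<lambda>_. ?B)" by (rule integrable_lebI_bounded) auto
    show "AE x in lebI. (\<lambda>m. of_real (theta_sum \<sigma> m x) * e_mode j x) \<longlonglongrightarrow> of_real (theta \<sigma> x) * e_mode j x"
      by (intro AE_I2 tendsto_intros theta_sum_LIMSEQ assms)
    show "AE x in lebI. norm (of_real (theta_sum \<sigma> m x) * e_mode j x) \<le> ?B" for m
      by (intro AE_I2) (simp add: norm_mult theta_sum_bound[OF assms] del: of_nat_Suc)
  qed measurable
  have "(LINT x|lebI. of_real (theta_sum \<sigma> m x) * e_mode j x) = of_real (gauss_coeff \<sigma> (of_int j))" if "m \<ge> nat \<bar>j\<bar>" for m
  proof -
    have "(LINT x|lebI. of_real (theta_sum \<sigma> m x) * e_mode j x) =
       (LINT x|lebI. (\<Sum>l = - int m..int m. of_real (gauss_coeff \<sigma> (of_int l) / 2) * e_mode (l + j) x))"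
      unfolding theta_sum_e_mode sum_distrib_right e_mode_add_index mult.assoc ..
    also have "\<dots> = (\<Sum>l = - int m..int m. (LINT x|lebI. of_real (gauss_coeff \<sigma> (of_int l) / 2) * e_mode (l + j) x))"
      by (intro Bochner_Integration.integral_sum integrable_mult_right integrable_lebI_bounded[where B = 1])
         (auto intro: measurable_lebI_borel)
    also have "\<dots> = (\<Sum>l = - int m..int m. if l = - j then of_real (gauss_coeff \<sigma> (of_int j)) else 0)"
    proof (intro sum.cong refl)
      fix l
      show "(LINT x|lebI. of_real (gauss_coeff \<sigma> (of_int l) / 2) * e_mode (l + j) x) =
          (if l = - j then of_real (gauss_coeff \<sigma> (of_int j)) else 0)"
      proof (cases "l = - j")
        case True
        show ?thesis unfolding True by (simp add: integral_e_mode scaleR_conv_of_real)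
      qed (simp add: integral_e_mode eq_neg_iff_add_eq_0)
    qed
    also have "\<dots> = of_real (gauss_coeff \<sigma> (of_int j))"
      using that by (subst sum.delta) auto
    finally show ?thesis .
  qed
  then show "(\<lambda>m. LINT x|lebI. of_real (theta_sum \<sigma> m x) * e_mode j x) \<longlonglongrightarrow> of_real (gauss_coeff \<sigma> (of_int j))"
    by (intro tendsto_eventually eventually_sequentiallyI[of "nat \<bar>j\<bar>"])
qed

text \<open>Completeness of the trigonometric system, in the even case that is needed. An even function on
  \<open>[-1,1]\<close> is a continuous function of \<open>cos (\<pi> u)\<close>, so it can be approximated uniformly by polynomials in
  \<open>cos (\<pi> u)\<close>. Those are trigonometric polynomials, hence orthogonal to \<open>d\<close>, and \<open>\<integral> d\<^sup>2\<close> vanishes.\<close>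

lemma even_orthogonal_imp_zero:
  fixes d :: "real \<Rightarrow> real"
  assumes cont: "continuous_on UNIV d" and even: "\<And>u. d (- u) = d u"
    and orth: "\<And>j. (LINT x|lebI. of_real (d x) * e_mode j x) = 0"
    and u: "u \<in> {-1..1}"
  shows "d u = 0"
proof -
  have [measurable]: "d \<in> borel_measurable borel" using cont by (rule borel_measurable_continuous_onI)
  have "bounded (d ` {-1..1})"
    by (intro compact_imp_bounded compact_continuous_image continuous_on_subset[OF cont]) auto
  then obtain B where B: "B > 0" "\<And>x. x \<in> {-1..1} \<Longrightarrow> \<bar>d x\<bar> \<le> B"
    unfolding bounded_pos by auto
  have int: "integrable lebI (\<lambda>x. of_real (d x * cos (pi * x) ^ n) * e_mode j x)" for n j
  proof (rule integrable_lebI_bounded[where B = B])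
    show "norm (of_real (d x * cos (pi * x) ^ n) * e_mode j x) \<le> B" if "x \<in> {-1..1}" for x
    proof -
      have "\<bar>d x\<bar> * \<bar>cos (pi * x)\<bar> ^ n \<le> B * 1"
        using B that by (intro mult_mono power_le_one) auto
      then show ?thesis by (simp add: norm_mult norm_power abs_mult power_abs)
    qed
  qed measurable
  have cos_pow: "(LINT x|lebI. of_real (d x * cos (pi * x) ^ n) * e_mode j x) = 0" for n j
  proof (induction n arbitrary: j)
    case 0 then show ?case using orth by simp
  next
    case (Suc n)
    have *: "complex_of_real (cos (pi * x)) = (e_mode 1 x + e_mode (-1) x) / 2" for x
      unfolding e_mode_cis complex_eq_iff by simp
    have "complex_of_real (d x * cos (pi * x) ^ Suc n) * e_mode j x =
        (of_real (d x * cos (pi * x) ^ n) * e_mode (j + 1) x + of_real (d x * cos (pi * x) ^ n) * e_mode (j + (-1)) x) / 2" for x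
      unfolding power_Suc of_real_mult * e_mode_add_index by (simp add: field_simps)
    then have "(LINT x|lebI. of_real (d x * cos (pi * x) ^ Suc n) * e_mode j x) =
      (LINT x|lebI. (of_real (d x * cos (pi * x) ^ n) * e_mode (j + 1) x + of_real (d x * cos (pi * x) ^ n) * e_mode (j + (-1)) x) / 2)"
      by presburger
    also have "\<dots> = ((LINT x|lebI. of_real (d x * cos (pi * x) ^ n) * e_mode (j + 1) x) +
        (LINT x|lebI. of_real (d x * cos (pi * x) ^ n) * e_mode (j + (-1)) x)) / 2"
      using int by simp
    finally show ?case using Suc by simp
  qed
  have cos_pow': "integrable lebI (\<lambda>x. d x * cos (pi * x) ^ n)" "(LINT x|lebI. d x * cos (pi * x) ^ n) = 0" for n
  proof -
    have "integrable lebI (\<lambda>x. Re (of_real (d x * cos (pi * x) ^ n) * e_mode 0 x))"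
      using int by (rule integrable_Re)
    then show "integrable lebI (\<lambda>x. d x * cos (pi * x) ^ n)" by simp
    have "complex_of_real (LINT x|lebI. d x * cos (pi * x) ^ n) = 0"
      using cos_pow[of n 0] by (simp add: integral_complex_of_real[symmetric] del: integral_complex_of_real)
    then show "(LINT x|lebI. d x * cos (pi * x) ^ n) = 0" by simp
  qed
  have intsq: "integrable lebI (\<lambda>x. (d x)\<^sup>2)"
  proof (rule integrable_lebI_bounded[where B = "B\<^sup>2"])
    show "norm ((d x)\<^sup>2) \<le> B\<^sup>2" if "x \<in> {-1..1}" for x
      using power_mono[OF B(2)[OF that], of 2] by simp
  qed measurable
  have "(LINT x|lebI. (d x)\<^sup>2) \<le> 0 + e" if e: "e > 0" for e
  proof -
    define e' where "e' = e / (2 * B)"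
    have e': "e' > 0" using e B by (simp add: e'_def)
    have "continuous_on {-1..1} (\<lambda>t. d (arccos t / pi))"
      by (intro continuous_on_compose2[OF cont] continuous_intros continuous_on_arccos') auto
    then obtain q where q: "real_polynomial_function q" "\<And>t. t \<in> {-1..1} \<Longrightarrow> \<bar>d (arccos t / pi) - q t\<bar> < e'"
      using Stone_Weierstrass_real_polynomial_function[of "{-1..1}" "\<lambda>t. d (arccos t / pi)" e'] e' by auto
    from q(1) obtain c n where c: "q = (\<lambda>x. \<Sum>i\<le>n. c i * x ^ i)"
      unfolding real_polynomial_function_iff_sum by blast
    have appr: "\<bar>d x - q (cos (pi * x))\<bar> \<le> e'" if x: "x \<in> {-1..1}" for x
    proof -
      have "arccos (cos (pi * x)) = pi * \<bar>x\<bar>"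
      proof -
        have "pi * \<bar>x\<bar> \<le> pi" using x by (intro mult_left_le) auto
        then have "arccos (cos (pi * \<bar>x\<bar>)) = pi * \<bar>x\<bar>" by (intro arccos_cos) auto
        moreover have "cos (pi * \<bar>x\<bar>) = cos (pi * x)" by (cases "x \<ge> 0") auto
        ultimately show ?thesis by simp
      qed
      then have "d (arccos (cos (pi * x)) / pi) = d \<bar>x\<bar>" by simp
      also have "\<dots> = d x" using even[of x] by (cases "x \<ge> 0") auto
      finally show ?thesis using q(2)[of "cos (pi * x)"] by simp
    qed
    have iq: "integrable lebI (\<lambda>x. d x * q (cos (pi * x)))"
      unfolding c sum_distrib_left using cos_pow'(1) by (auto simp: mult.left_commute[of "d _"])
    have "(LINT x|lebI. d x * q (cos (pi * x))) = (\<Sum>i\<le>n. c i * (LINT x|lebI. d x * cos (pi * x) ^ i))"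
      unfolding c sum_distrib_left using cos_pow'(1) by (simp add: mult.left_commute[of "d _"])
    also have "\<dots> = 0" by (simp add: cos_pow'(2))
    finally have q0: "(LINT x|lebI. d x * q (cos (pi * x))) = 0" .
    have "(LINT x|lebI. (d x)\<^sup>2) = (LINT x|lebI. (d x)\<^sup>2 - d x * q (cos (pi * x)))"
      using intsq iq q0 by simp
    also have "\<dots> \<le> (LINT x|lebI. B * e')"
    proof (rule integral_mono)
      show "integrable lebI (\<lambda>x. (d x)\<^sup>2 - d x * q (cos (pi * x)))" using intsq iq by simp
      show "integrable lebI (\<lambda>x. B * e')" by (rule integrable_lebI_bounded) auto
      fix x assume "x \<in> space lebI"
      then have x: "x \<in> {-1..1}" by simp
      have "(d x)\<^sup>2 - d x * q (cos (pi * x)) = d x * (d x - q (cos (pi * x)))"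
        by (simp add: power2_eq_square algebra_simps)
      also have "\<dots> \<le> \<bar>d x\<bar> * \<bar>d x - q (cos (pi * x))\<bar>" by (simp flip: abs_mult)
      also have "\<dots> \<le> B * e'" using B(2)[OF x] appr[OF x] by (intro mult_mono) auto
      finally show "(d x)\<^sup>2 - d x * q (cos (pi * x)) \<le> B * e'" .
    qed
    also have "\<dots> = e" using B by (simp add: e'_def)
    finally show ?thesis by simp
  qed
  then have "(LINT x|lebI. (d x)\<^sup>2) \<le> 0" by (rule field_le_epsilon)
  then have L0: "(LINT x|lebI. (d x)\<^sup>2) = 0" by (intro antisym integral_nonneg_AE) auto
  have "(LINT x|lebI. (d x)\<^sup>2) = (LBINT x:{-1..1}. (d x)\<^sup>2)"
    unfolding lebI_def set_lebesgue_integral_def by (subst integral_restrict_space) auto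
  also have "\<dots> = integral {-1..1} (\<lambda>x. (d x)\<^sup>2)"
    using intsq unfolding lebI_def set_integrable_def
    by (intro set_borel_integral_eq_integral) (auto simp: integrable_restrict_space set_integrable_def)
  finally have "integral {-1..1} (\<lambda>x. (d x)\<^sup>2) = 0" using L0 by simp
  moreover have c2: "continuous_on {-1..1} (\<lambda>x. (d x)\<^sup>2)"
    by (intro continuous_intros continuous_on_subset[OF cont]) auto
  ultimately have "(d u)\<^sup>2 = 0"
    using u by (subst (asm) integral_eq_0_iff) auto
  then show ?thesis by simp
qed

text \<open>Poisson summation: both sides are continuous and even with the same Fourier coefficients.
  Continuity makes this hold at every point, not just almost everywhere, so the identity may be
  substituted at the points \<open>x - T y\<close>.\<close>

lemma kern_eq_theta:
  assumes "\<sigma> > 0"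
  shows "kern \<sigma> u = theta \<sigma> u"
proof -
  let ?d = "\<lambda>u. kern \<sigma> u - theta \<sigma> u"
  have [measurable]: "theta \<sigma> \<in> borel_measurable borel" "kern \<sigma> \<in> borel_measurable borel"
    using assms by (auto intro: borel_measurable_theta kern_borel)
  obtain B where B: "B > 0" "\<And>u. kern \<sigma> u \<le> B" using kern_bounded[OF assms] by auto
  have bt: "\<bar>theta \<sigma> u\<bar> \<le> 1 / 2 + (\<Sum>i. gauss_coeff \<sigma> (real (Suc i)))" for u
    using theta_sum_bound[OF assms] by (intro LIMSEQ_le_const2[OF tendsto_rabs[OF theta_sum_LIMSEQ[OF assms]]]) auto
  have "?d v = 0" if "v \<in> {-1..1}" for v
  proof (rule even_orthogonal_imp_zero[OF _ _ _ that])
    show "continuous_on UNIV ?d" by (intro continuous_intros continuous_kern continuous_theta assms)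
    show "?d (- u) = ?d u" for u by (simp add: kern_minus theta_minus)
    show "(LINT x|lebI. of_real (?d x) * e_mode j x) = 0" for j
    proof -
      have i1: "integrable lebI (\<lambda>x. of_real (kern \<sigma> x) * e_mode j x)"
      proof (rule integrable_lebI_bounded[where B = B])
        show "norm (of_real (kern \<sigma> x) * e_mode j x) \<le> B" for x
          using B(2)[of x] kern_pos[OF assms, of x] by (simp add: norm_mult)
      qed measurable
      have i2: "integrable lebI (\<lambda>x. of_real (theta \<sigma> x) * e_mode j x)"
      proof (rule integrable_lebI_bounded)
        show "norm (of_real (theta \<sigma> x) * e_mode j x) \<le> 1 / 2 + (\<Sum>i. gauss_coeff \<sigma> (real (Suc i)))" for x
          using bt[of x] by (simp add: norm_mult)
      qed measurable
      have "(LINT x|lebI. of_real (?d x) * e_mode j x) =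
         (LINT x|lebI. of_real (kern \<sigma> x) * e_mode j x) - (LINT x|lebI. of_real (theta \<sigma> x) * e_mode j x)"
        using i1 i2 by (simp add: left_diff_distrib)
      also have "\<dots> = 0" using integral_kern_e_mode[OF assms, of 0 j] integral_theta_e_mode[OF assms, of j] by simp
      finally show ?thesis .
    qed
  qed
  from this[of "wrap u"] show ?thesis
    using wrap_range[of u] by (simp add: kern_wrap theta_wrap[OF assms])
qed

section \<open>Truncation of the Fourier series of the kernel\<close>

lemma exp_sq: "(exp x)\<^sup>2 = exp (2 * x :: real)"
  by (simp add: exp_double)

lemma has_sum_int_symmetric:
  fixes g :: "nat \<Rightarrow> real"
  assumes "summable g" "\<And>n. 0 \<le> g n"
  shows "((\<lambda>j::int. g (nat \<bar>j\<bar>)) has_sum (2 * (\<Sum>i. g (i + Suc k)))) {j. \<bar>j\<bar> > int k}"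
proof -
  let ?s = "\<Sum>i. g (i + Suc k)"
  let ?g = "\<lambda>j::int. g (nat \<bar>j\<bar>)"
  let ?P = "range (\<lambda>i. int (i + Suc k))" and ?N = "range (\<lambda>i. - int (i + Suc k))"
  have "summable (\<lambda>i. g (i + Suc k))" using assms(1) by (rule summable_ignore_initial_segment)
  then have s: "((\<lambda>i. g (i + Suc k)) has_sum ?s) UNIV"
    using assms(2) by (intro norm_summable_imp_has_sum summable_sums) auto
  have 1: "(?g has_sum ?s) ?P"
    using s by (subst has_sum_reindex) (auto simp: o_def inj_on_def nat_add_distrib simp del: of_nat_add of_nat_Suc)
  have 2: "(?g has_sum ?s) ?N"
    using s by (subst has_sum_reindex) (auto simp: o_def inj_on_def simp del: of_nat_add of_nat_Suc)
  have "j \<in> ?P \<union> ?N \<longleftrightarrow> \<bar>j\<bar> > int k" for j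
  proof
    assume "\<bar>j\<bar> > int k"
    then have "j = int (nat (\<bar>j\<bar> - int (Suc k)) + Suc k) \<or> j = - int (nat (\<bar>j\<bar> - int (Suc k)) + Suc k)" by auto
    then show "j \<in> ?P \<union> ?N" by blast
  qed auto
  then have "{j. \<bar>j\<bar> > int k} = ?P \<union> ?N" by blast
  moreover have "?P \<inter> ?N = {}" by auto
  ultimately show ?thesis using has_sum_Un_disjoint[OF 1 2] by (simp only: mult_2)
qed

lemma Gam1_eq:
  assumes "\<sigma> > 0"
  shows "Gam1 \<sigma> k = 2 * (\<Sum>i. gauss_coeff \<sigma> (real (i + Suc k)))"
proof -
  have "((\<lambda>j::int. gauss_coeff \<sigma> (real (nat \<bar>j\<bar>))) has_sum (2 * (\<Sum>i. gauss_coeff \<sigma> (real (i + Suc k))))) {j. \<bar>j\<bar> > int k}"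
    by (rule has_sum_int_symmetric) (auto simp: summable_gauss_coeff assms less_imp_le)
  moreover have "gauss_coeff \<sigma> (real (nat \<bar>j\<bar>)) = exp (- (\<sigma>\<^sup>2 * pi\<^sup>2 * (of_int j)\<^sup>2 / 2))" for j
    by (simp add: gauss_coeff_def)
  ultimately show ?thesis unfolding Gam1_def by (simp add: infsumI)
qed

lemma Gam1_nonneg: "\<sigma> > 0 \<Longrightarrow> 0 \<le> Gam1 \<sigma> k"
  unfolding Gam1_def by (intro infsum_nonneg) auto

lemma Gam1_tendsto: 
  assumes "\<sigma> > 0"
  shows "Gam1 \<sigma> \<longlonglongrightarrow> 0"
proof -
  have s: "summable (\<lambda>i. gauss_coeff \<sigma> (real i))" by (rule summable_gauss_coeff[OF assms])
  have "(\<Sum>i. gauss_coeff \<sigma> (real (i + Suc k))) = (\<Sum>i. gauss_coeff \<sigma> (real i)) - (\<Sum>i<Suc k. gauss_coeff \<sigma> (real i))" for k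
    by (rule suminf_minus_initial_segment[OF s])
  then have "Gam1 \<sigma> = (\<lambda>k. 2 * ((\<Sum>i. gauss_coeff \<sigma> (real i)) - (\<Sum>i<Suc k. gauss_coeff \<sigma> (real i))))"
    by (simp add: fun_eq_iff Gam1_eq[OF assms])
  moreover have "(\<lambda>k. 2 * ((\<Sum>i. gauss_coeff \<sigma> (real i)) - (\<Sum>i<Suc k. gauss_coeff \<sigma> (real i)))) \<longlonglongrightarrow> 2 * ((\<Sum>i. gauss_coeff \<sigma> (real i)) - (\<Sum>i. gauss_coeff \<sigma> (real i)))"
    by (intro tendsto_intros LIMSEQ_Suc[OF summable_LIMSEQ[OF s]])
  ultimately show ?thesis by simp
qed

text \<open>The coefficients over two-sided indices carry the factor \<open>1/2\<close>, which is why only half of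
  \<open>\<Gamma>\<^sup>(\<^sup>1\<^sup>)\<close> appears.\<close>

lemma kern_tail_sup:
  assumes "\<sigma> > 0"
  shows "\<bar>kern \<sigma> u - theta_sum \<sigma> k u\<bar> \<le> Gam1 \<sigma> k / 2"
proof -
  have s: "summable (\<lambda>i. gauss_coeff \<sigma> (real (i + Suc k)))"
    using summable_ignore_initial_segment[OF summable_gauss_coeff[OF assms]] by blast
  have "\<bar>theta_sum \<sigma> m u - theta_sum \<sigma> k u\<bar> \<le> Gam1 \<sigma> k / 2" if "k \<le> m" for m
  proof -
    have "\<bar>theta_sum \<sigma> m u - theta_sum \<sigma> k u\<bar> \<le> (\<Sum>i = k..<m. gauss_coeff \<sigma> (real (Suc i)))"
      by (rule theta_sum_diff_le[OF assms that])
    also have "\<dots> = (\<Sum>i<m - k. gauss_coeff \<sigma> (real (i + Suc k)))"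
      using that sum.shift_bounds_nat_ivl[of "\<lambda>i. gauss_coeff \<sigma> (real (Suc i))" 0 k "m - k"]
      by (simp add: atLeast0LessThan del: of_nat_Suc of_nat_add)
    also have "\<dots> \<le> (\<Sum>i. gauss_coeff \<sigma> (real (i + Suc k)))"
      by (rule sum_le_suminf[OF s]) (auto simp: less_imp_le)
    finally show ?thesis by (simp add: Gam1_eq[OF assms])
  qed
  moreover have "(\<lambda>m. \<bar>theta_sum \<sigma> m u - theta_sum \<sigma> k u\<bar>) \<longlonglongrightarrow> \<bar>theta \<sigma> u - theta_sum \<sigma> k u\<bar>"
    by (intro tendsto_intros theta_sum_LIMSEQ assms)
  ultimately show ?thesis
    unfolding kern_eq_theta[OF assms] by (intro LIMSEQ_le_const2) auto
qed

lemma integral_cos: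
  "(LINT x|lebI. cos (pi * of_int n * (x - a))) = (if n = 0 then 2 else 0)"
proof -
  have eq: "cos (pi * of_int n * (x - a)) = Re (e_mode n x * e_mode (- n) a)" for x
    by (simp add: e_mode_cis cos_diff[symmetric] algebra_simps cis_mult)
  have i: "integrable lebI (\<lambda>x. e_mode n x * e_mode (- n) a)"
    by (rule integrable_lebI_bounded[where B = 1]) (rule measurable_lebI_borel, measurable, simp add: norm_mult)
  have "(LINT x|lebI. cos (pi * of_int n * (x - a))) = Re (LINT x|lebI. e_mode n x * e_mode (- n) a)"
    unfolding eq using i by (rule integral_Re)
  also have "\<dots> = (if n = 0 then 2 else 0)" by (simp add: integral_e_mode)
  finally show ?thesis .
qed

lemma integrable_cos: "integrable lebI (\<lambda>x. cos (pi * of_int n * (x - a)))"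
  by (rule integrable_lebI_bounded[where B = 1]) (intro measurable_lebI_borel borel_measurable_continuous_onI continuous_intros, simp)

lemma integral_cos_cos:
  "integrable lebI (\<lambda>x. cos (pi * real (Suc i) * (x - a)) * cos (pi * real (Suc l) * (x - a)))"
  "(LINT x|lebI. cos (pi * real (Suc i) * (x - a)) * cos (pi * real (Suc l) * (x - a))) = (if i = l then 1 else 0)"
proof -
  have eq: "cos (pi * real (Suc i) * (x - a)) * cos (pi * real (Suc l) * (x - a)) =
     (cos (pi * of_int (int i - int l) * (x - a)) + cos (pi * of_int (int i + int l + 2) * (x - a))) / 2" for x
    unfolding cos_times_cos by (simp add: algebra_simps)
  show "integrable lebI (\<lambda>x. cos (pi * real (Suc i) * (x - a)) * cos (pi * real (Suc l) * (x - a)))"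
    unfolding eq by (intro Bochner_Integration.integrable_divide Bochner_Integration.integrable_add integrable_cos) 
  show "(LINT x|lebI. cos (pi * real (Suc i) * (x - a)) * cos (pi * real (Suc l) * (x - a))) = (if i = l then 1 else 0)"
    unfolding eq integral_divide_zero
    by (subst Bochner_Integration.integral_add) (intro integrable_cos | simp only: integral_cos | simp)+
qed

lemma integral_cos_sum_sq:
  fixes c :: "nat \<Rightarrow> real"
  assumes "finite A"
  shows "(LINT x|lebI. (\<Sum>i\<in>A. c i * cos (pi * real (Suc i) * (x - a)))\<^sup>2) = (\<Sum>i\<in>A. (c i)\<^sup>2)"
proof -
  let ?C = "\<lambda>i x. cos (pi * real (Suc i) * (x - a))"
  have "(\<Sum>i\<in>A. c i * ?C i x)\<^sup>2 = (\<Sum>i\<in>A. \<Sum>l\<in>A. c i * c l * (?C i x * ?C l x))" for x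
    unfolding power2_eq_square sum_product by (intro sum.cong refl) (simp only: mult_ac)
  then have "(LINT x|lebI. (\<Sum>i\<in>A. c i * ?C i x)\<^sup>2) = (LINT x|lebI. (\<Sum>i\<in>A. \<Sum>l\<in>A. c i * c l * (?C i x * ?C l x)))"
    by presburger
  also have "\<dots> = (\<Sum>i\<in>A. \<Sum>l\<in>A. c i * c l * (if i = l then 1 else 0))"
    using integral_cos_cos(1)[of _ a] 
    by (subst Bochner_Integration.integral_sum; (intro Bochner_Integration.integrable_sum integrable_mult_right)?)
       (auto simp only: integral_cos_cos(2) Bochner_Integration.integral_sum integrable_mult_right integral_mult_right_zero intro!: sum.cong)
  also have "\<dots> = (\<Sum>i\<in>A. (c i)\<^sup>2)"
    using assms by (intro sum.cong refl) (simp add: power2_eq_square if_distrib sum.delta cong: if_cong)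
  finally show ?thesis .
qed

text \<open>Squaring a coefficient amounts to rescaling the noise by \<open>sqrt 2\<close>. Sums of squared coefficients
  are therefore theta values themselves, and Poisson summation evaluates them.\<close>

lemma gauss_coeff_sq: "(gauss_coeff \<sigma> t)\<^sup>2 = gauss_coeff (sqrt 2 * \<sigma>) t"
  by (simp add: gauss_coeff_def exp_sq power_mult_distrib)

lemma theta_zero: "theta \<sigma> 0 = 1 / 2 + (\<Sum>i. gauss_coeff \<sigma> (real (Suc i)))"
  by (simp add: theta_def)

lemma norm_rho_sq:
  assumes "\<sigma> > 0"
  shows "(norm_rho \<sigma>)\<^sup>2 = 1 / (2 * \<sigma> * sqrt pi)"
proof -
  have eq: "(normal_density 0 \<sigma> x)\<^sup>2 = 1 / (2 * \<sigma> * sqrt pi) * normal_density 0 (\<sigma> / sqrt 2) x" for x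
  proof -
    have "(normal_density 0 \<sigma> x)\<^sup>2 = 1 / (2 * pi * \<sigma>\<^sup>2) * exp (- (x\<^sup>2 / \<sigma>\<^sup>2))"
      by (simp add: normal_density_def power_mult_distrib power_divide exp_sq)
    moreover have "normal_density 0 (\<sigma> / sqrt 2) x = 1 / (sqrt pi * \<sigma>) * exp (- (x\<^sup>2 / \<sigma>\<^sup>2))"
      using assms by (simp add: normal_density_def power_divide real_sqrt_mult)
    moreover have "1 / (2 * pi * \<sigma>\<^sup>2) = 1 / (2 * \<sigma> * sqrt pi) * (1 / (sqrt pi * \<sigma>))"
      by (simp add: power2_eq_square)
    ultimately show ?thesis by simp
  qed
  have "(LINT x|lborel. (normal_density 0 \<sigma> x)\<^sup>2) = 1 / (2 * \<sigma> * sqrt pi)"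
    unfolding eq using assms by simp
  then show ?thesis unfolding norm_rho_def using assms by simp
qed

lemma coth_half: "s > 0 \<Longrightarrow> coth (s / 2) = (1 + exp (- s)) / (1 - exp (- s))"
proof -
  assume s: "s > 0"
  have e: "exp (- s) = exp (- (s / 2)) * exp (- (s / 2))" "1 = exp (s / 2) * exp (- (s / 2))"
    by (simp_all add: exp_add[symmetric])
  have "(1 + exp (- s)) / (1 - exp (- s)) = ((exp (s / 2) + exp (- (s / 2))) * exp (- (s / 2))) / ((exp (s / 2) - exp (- (s / 2))) * exp (- (s / 2)))"
    unfolding e(1) by (subst (1 2) e(2)) (simp only: distrib_right left_diff_distrib)
  also have "\<dots> = (exp (s / 2) + exp (- (s / 2))) / (exp (s / 2) - exp (- (s / 2)))" by simp
  also have "\<dots> = ((exp (s / 2) + exp (- (s / 2))) / 2) / ((exp (s / 2) - exp (- (s / 2))) / 2)"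
    by (simp only: divide_divide_eq_left divide_divide_eq_right)
  finally show ?thesis unfolding coth_def cosh_field_def sinh_field_def by (rule sym)
qed

lemma coth_ge_1: "s > 0 \<Longrightarrow> coth s \<ge> 1"
proof -
  assume s: "s > 0"
  then have "0 < exp (- (2 * s))" "exp (- (2 * s)) < 1" by auto
  then show ?thesis using coth_half[of "2 * s"] s by (simp add: le_divide_eq)
qed

text \<open>By Poisson summation at noise level \<open>sqrt 2 * \<sigma>\<close> the left side is
  \<open>\<parallel>\<rho>\<^sub>\<sigma>\<parallel>\<^sup>2 \<Sum>j. q ^ (j\<^sup>2)\<close> with \<open>q = exp (- 1 / \<sigma>\<^sup>2)\<close>. Since \<open>j\<^sup>2 \<ge> \<bar>j\<bar>\<close>, the geometric series
  \<open>\<Sum>j. q ^ \<bar>j\<bar> = coth (1 / (2 \<sigma>\<^sup>2))\<close> dominates.\<close>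

lemma theta_sqrt2_le:
  assumes "\<sigma> > 0"
  shows "theta (sqrt 2 * \<sigma>) 0 \<le> (norm_rho \<sigma>)\<^sup>2 * coth (1 / (2 * \<sigma>\<^sup>2))"
proof -
  define q where "q = exp (- (1 / \<sigma>\<^sup>2))"
  have q: "0 < q" "q < 1" using assms by (auto simp: q_def)
  have "summable (\<lambda>i. q ^ i)" using q by (intro summable_geometric) auto
  from has_sum_int_symmetric[OF this, of 0] q
  have "((\<lambda>j::int. q ^ nat \<bar>j\<bar>) has_sum (2 * (\<Sum>i. q ^ (i + 1)))) {j. \<bar>j\<bar> > 0}" by simp
  moreover have "(\<Sum>i. q ^ (i + 1)) = q / (1 - q)"
    using q by (simp add: suminf_mult suminf_geometric summable_geometric)
  ultimately have 1: "((\<lambda>j::int. q ^ nat \<bar>j\<bar>) has_sum (2 * (q / (1 - q)))) {j. \<bar>j\<bar> > 0}" by simp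
  have 2: "((\<lambda>j::int. q ^ nat \<bar>j\<bar>) has_sum 1) {0}" by (simp add: has_sum_finite_iff)
  have "{0} \<union> {j::int. \<bar>j\<bar> > 0} = UNIV" by auto
  with has_sum_Un_disjoint[OF 2 1] have "((\<lambda>j::int. q ^ nat \<bar>j\<bar>) has_sum (1 + 2 * (q / (1 - q)))) UNIV" by auto
  moreover have "1 + 2 * (q / (1 - q)) = coth (1 / (2 * \<sigma>\<^sup>2))"
    using coth_half[of "1 / \<sigma>\<^sup>2"] q assms by (simp add: q_def[symmetric] field_simps)
  ultimately have A: "((\<lambda>j::int. (norm_rho \<sigma>)\<^sup>2 * q ^ nat \<bar>j\<bar>) has_sum ((norm_rho \<sigma>)\<^sup>2 * coth (1 / (2 * \<sigma>\<^sup>2)))) UNIV"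
    by (intro has_sum_cmult_right) simp
  have \<sigma>2: "sqrt 2 * \<sigma> > 0" using assms by simp
  have le: "normal_density 0 (sqrt 2 * \<sigma>) (0 + 2 * of_int j) \<le> (norm_rho \<sigma>)\<^sup>2 * q ^ nat \<bar>j\<bar>" for j
  proof -
    have "normal_density 0 (sqrt 2 * \<sigma>) (0 + 2 * of_int j) = (norm_rho \<sigma>)\<^sup>2 * exp (- ((of_int j)\<^sup>2 / \<sigma>\<^sup>2))"
      using assms unfolding norm_rho_sq[OF assms]
      by (simp add: normal_density_def power_mult_distrib real_sqrt_mult field_simps)
    also have "\<dots> \<le> (norm_rho \<sigma>)\<^sup>2 * exp (- (of_int \<bar>j\<bar> / \<sigma>\<^sup>2))"
    proof -
      have "\<bar>j\<bar> \<le> j\<^sup>2" by (cases "j = 0") (auto simp: power2_eq_square abs_mult_self_eq[of j, symmetric] simp del: abs_mult_self_eq)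
      then have "real_of_int \<bar>j\<bar> \<le> (of_int j)\<^sup>2" by (metis of_int_le_iff of_int_power)
      then show ?thesis using assms by (intro mult_left_mono) (auto intro: divide_right_mono)
    qed
    also have "exp (- (of_int \<bar>j\<bar> / \<sigma>\<^sup>2)) = q ^ nat \<bar>j\<bar>"
      unfolding q_def exp_of_nat_mult[symmetric] by simp
    finally show ?thesis .
  qed
  show ?thesis
    unfolding kern_eq_theta[OF \<sigma>2, symmetric]
    using kern_has_sum[OF \<sigma>2, of 0] A le by (rule has_sum_mono)
qed

lemma integral_kern_diff_sq_LIMSEQ:
  assumes \<sigma>: "\<sigma> > 0" and [measurable]: "h \<in> borel_measurable borel" and h: "\<And>x. \<bar>h x\<bar> \<le> B"
  shows "(\<lambda>m. LINT x|lebI. (theta_sum \<sigma> m (x - a) - h x)\<^sup>2) \<longlonglongrightarrow> (LINT x|lebI. (kern \<sigma> (x - a) - h x)\<^sup>2)"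
proof -
  let ?B = "1 / 2 + (\<Sum>i. gauss_coeff \<sigma> (real (Suc i))) + B"
  have [measurable]: "kern \<sigma> \<in> borel_measurable borel" using \<sigma> by (rule kern_borel)
  show ?thesis
  proof (rule integral_dominated_convergence[where w = "\<lambda>_. ?B\<^sup>2"])
    show "integrable lebI (\<lambda>_. ?B\<^sup>2)" by (rule integrable_lebI_bounded) auto
    show "AE x in lebI. (\<lambda>m. (theta_sum \<sigma> m (x - a) - h x)\<^sup>2) \<longlonglongrightarrow> (kern \<sigma> (x - a) - h x)\<^sup>2"
      unfolding kern_eq_theta[OF \<sigma>] by (intro AE_I2 tendsto_intros theta_sum_LIMSEQ \<sigma>)
    show "AE x in lebI. norm ((theta_sum \<sigma> m (x - a) - h x)\<^sup>2) \<le> ?B\<^sup>2" for m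
    proof (rule AE_I2)
      fix x
      have "\<bar>theta_sum \<sigma> m (x - a) - h x\<bar> \<le> ?B"
        using theta_sum_bound[OF \<sigma>, of m "x - a"] h[of x] by linarith
      from power_mono[OF this, of 2] show "norm ((theta_sum \<sigma> m (x - a) - h x)\<^sup>2) \<le> ?B\<^sup>2" by simp
    qed
  qed measurable
qed

lemma summable_gauss_coeff_sq:
  assumes "\<sigma> > 0"
  shows "summable (\<lambda>i. (gauss_coeff \<sigma> (real (Suc i)))\<^sup>2)"
  unfolding gauss_coeff_sq using summable_gauss_coeff[of "sqrt 2 * \<sigma>"] assms
  by (simp add: summable_Suc_iff[of "\<lambda>i. gauss_coeff (sqrt 2 * \<sigma>) (real i)"] del: of_nat_Suc)

text \<open>Parseval for the partial sums gives \<open>theta (sqrt 2 * \<sigma>) 0\<close> in the limit.\<close>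

lemma kern_L2:
  assumes "\<sigma> > 0"
  shows "(LINT x|lebI. (kern \<sigma> (x - a))\<^sup>2) \<le> (norm_rho \<sigma> * sqrt (coth (1 / (2 * \<sigma>\<^sup>2))))\<^sup>2"
proof -
  let ?R = "\<lambda>m x. \<Sum>i<m. gauss_coeff \<sigma> (real (Suc i)) * cos (pi * real (Suc i) * (x - a))"
  have iC: "integrable lebI (\<lambda>x. cos (pi * real (Suc i) * (x - a)))" "(LINT x|lebI. cos (pi * real (Suc i) * (x - a))) = 0" for i
    using integrable_cos[of "int (Suc i)" a] integral_cos[of "int (Suc i)" a] by simp_all
  have "(LINT x|lebI. (theta_sum \<sigma> m (x - a) - 0)\<^sup>2) \<le> theta (sqrt 2 * \<sigma>) 0" for m
  proof -
    have iR: "integrable lebI (?R m)" "(LINT x|lebI. ?R m x) = 0"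
      using iC by (simp_all del: of_nat_Suc)
    have iRR: "integrable lebI (\<lambda>x. (?R m x)\<^sup>2)"
      unfolding power2_eq_square sum_product using integral_cos_cos(1)[of _ a]
      by (intro Bochner_Integration.integrable_sum) (simp del: of_nat_Suc add: mult_ac mult.left_commute[of "cos _" "gauss_coeff _ _"])
    have "(theta_sum \<sigma> m (x - a) - 0)\<^sup>2 = 1 / 4 + (?R m x + (?R m x)\<^sup>2)" for x
      unfolding theta_sum_def by (simp add: power2_eq_square algebra_simps del: of_nat_Suc)
    then have "(LINT x|lebI. (theta_sum \<sigma> m (x - a) - 0)\<^sup>2) = (LINT x|lebI. 1 / 4 + (?R m x + (?R m x)\<^sup>2))"
      by presburger
    also have "\<dots> = 1 / 2 + (\<Sum>i<m. (gauss_coeff \<sigma> (real (Suc i)))\<^sup>2)"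
    proof -
      have "integrable lebI (\<lambda>x. 1 / 4 :: real)" by (rule integrable_lebI_bounded[where B = 1]) auto
      with iR iRR show ?thesis by (simp add: integral_cos_sum_sq del: of_nat_Suc)
    qed
    also have "\<dots> \<le> 1 / 2 + (\<Sum>i. (gauss_coeff \<sigma> (real (Suc i)))\<^sup>2)"
      using summable_gauss_coeff_sq[OF assms] by (intro add_left_mono sum_le_suminf) auto
    also have "\<dots> = theta (sqrt 2 * \<sigma>) 0" using assms by (simp add: theta_zero gauss_coeff_sq)
    finally show ?thesis .
  qed
  moreover have "(\<lambda>m. LINT x|lebI. (theta_sum \<sigma> m (x - a) - 0)\<^sup>2) \<longlonglongrightarrow> (LINT x|lebI. (kern \<sigma> (x - a) - 0)\<^sup>2)"
    by (rule integral_kern_diff_sq_LIMSEQ[OF assms, where B = 0]) auto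
  ultimately have "(LINT x|lebI. (kern \<sigma> (x - a) - 0)\<^sup>2) \<le> theta (sqrt 2 * \<sigma>) 0"
    by (intro LIMSEQ_le_const2) auto
  also have "\<dots> \<le> (norm_rho \<sigma>)\<^sup>2 * coth (1 / (2 * \<sigma>\<^sup>2))" by (rule theta_sqrt2_le[OF assms])
  also have "\<dots> = (norm_rho \<sigma> * sqrt (coth (1 / (2 * \<sigma>\<^sup>2))))\<^sup>2"
    using coth_ge_1[of "1 / (2 * \<sigma>\<^sup>2)"] assms by (simp add: power_mult_distrib)
  finally show ?thesis by simp
qed

text \<open>Parseval for the tail; \<open>(k + l)\<^sup>2 \<ge> k\<^sup>2 + l\<^sup>2\<close> factors out \<open>exp (- \<sigma>\<^sup>2\<pi>\<^sup>2k\<^sup>2)\<close> and leaves the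
  sum of all squared coefficients.\<close>

lemma kern_tail_L2:
  assumes "\<sigma> > 0"
  shows "(LINT x|lebI. (kern \<sigma> (x - a) - theta_sum \<sigma> k (x - a))\<^sup>2) \<le> (Gam \<sigma> k)\<^sup>2"
proof -
  let ?g = "\<lambda>i. (gauss_coeff \<sigma> (real (Suc i)))\<^sup>2"
  let ?E = "exp (- (\<sigma>\<^sup>2 * pi\<^sup>2 * (real k)\<^sup>2))"
  have g: "summable ?g" by (rule summable_gauss_coeff_sq[OF assms])
  have "(LINT x|lebI. (theta_sum \<sigma> m (x - a) - theta_sum \<sigma> k (x - a))\<^sup>2) \<le> ?E * theta (sqrt 2 * \<sigma>) 0" if "k \<le> m" for m
  proof -
    have "{..<m} = {..<k} \<union> {k..<m}" using that by auto
    then have "theta_sum \<sigma> m (x - a) - theta_sum \<sigma> k (x - a) = (\<Sum>i = k..<m. gauss_coeff \<sigma> (real (Suc i)) * cos (pi * real (Suc i) * (x - a)))" for x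
      unfolding theta_sum_def by (simp add: sum.union_disjoint ivl_disj_int del: of_nat_Suc)
    then have "(LINT x|lebI. (theta_sum \<sigma> m (x - a) - theta_sum \<sigma> k (x - a))\<^sup>2) = (\<Sum>i = k..<m. ?g i)"
      by (simp add: integral_cos_sum_sq del: of_nat_Suc)
    also have "\<dots> = (\<Sum>i<m - k. ?g (i + k))"
      using that sum.shift_bounds_nat_ivl[of ?g 0 k "m - k"]
      by (simp add: atLeast0LessThan del: of_nat_Suc of_nat_add)
    also have "\<dots> \<le> (\<Sum>i<m - k. ?E * ?g i)"
    proof (rule sum_mono)
      fix i
      have "(real (Suc (i + k)))\<^sup>2 \<ge> (real k)\<^sup>2 + (real (Suc i))\<^sup>2" by (simp add: power2_eq_square algebra_simps)
      then have "\<sigma>\<^sup>2 * pi\<^sup>2 * ((real k)\<^sup>2 + (real (Suc i))\<^sup>2) \<le> \<sigma>\<^sup>2 * pi\<^sup>2 * (real (Suc (i + k)))\<^sup>2"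
        by (intro mult_left_mono) auto
      then have "- (\<sigma>\<^sup>2 * pi\<^sup>2 * (real (Suc (i + k)))\<^sup>2) \<le> - (\<sigma>\<^sup>2 * pi\<^sup>2 * (real k)\<^sup>2) + - (\<sigma>\<^sup>2 * pi\<^sup>2 * (real (Suc i))\<^sup>2)"
        by (simp only: distrib_left)
      then have le: "exp (- (\<sigma>\<^sup>2 * pi\<^sup>2 * (real (Suc (i + k)))\<^sup>2)) \<le> ?E * exp (- (\<sigma>\<^sup>2 * pi\<^sup>2 * (real (Suc i))\<^sup>2))"
        unfolding exp_add[symmetric] by simp
      have "?g l = exp (- (\<sigma>\<^sup>2 * pi\<^sup>2 * (real (Suc l))\<^sup>2))" for l
        by (simp add: gauss_coeff_def exp_sq del: of_nat_Suc)
      with le show "?g (i + k) \<le> ?E * ?g i" by (simp only:)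
    qed
    also have "\<dots> = ?E * (\<Sum>i<m - k. ?g i)" by (rule sum_distrib_left[symmetric])
    also have "\<dots> \<le> ?E * (\<Sum>i. ?g i)"
      using g by (intro mult_left_mono sum_le_suminf) auto
    also have "\<dots> \<le> ?E * theta (sqrt 2 * \<sigma>) 0"
      using assms by (intro mult_left_mono) (auto simp: theta_zero gauss_coeff_sq)
    finally show ?thesis .
  qed
  moreover have "(\<lambda>m. LINT x|lebI. (theta_sum \<sigma> m (x - a) - theta_sum \<sigma> k (x - a))\<^sup>2) \<longlonglongrightarrow> (LINT x|lebI. (kern \<sigma> (x - a) - theta_sum \<sigma> k (x - a))\<^sup>2)"
    by (rule integral_kern_diff_sq_LIMSEQ[OF assms _ theta_sum_bound[OF assms]]) auto
  ultimately have "(LINT x|lebI. (kern \<sigma> (x - a) - theta_sum \<sigma> k (x - a))\<^sup>2) \<le> ?E * theta (sqrt 2 * \<sigma>) 0"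
    by (intro LIMSEQ_le_const2) auto
  also have "\<dots> \<le> ?E * ((norm_rho \<sigma>)\<^sup>2 * coth (1 / (2 * \<sigma>\<^sup>2)))"
    by (intro mult_left_mono theta_sqrt2_le[OF assms]) auto
  also have "\<dots> \<le> ?E * (1 / (\<sigma> * sqrt pi) * coth (1 / (2 * \<sigma>\<^sup>2)))"
    using coth_ge_1[of "1 / (2 * \<sigma>\<^sup>2)"] assms unfolding norm_rho_sq[OF assms]
    by (intro mult_left_mono mult_right_mono) (auto simp: field_simps)
  also have "\<dots> = (Gam \<sigma> k)\<^sup>2"
    using coth_ge_1[of "1 / (2 * \<sigma>\<^sup>2)"] assms
    by (simp add: Gam_def power_mult_distrib exp_sq)
  finally show ?thesis .
qed

lemma Gam_nonneg: "\<sigma> > 0 \<Longrightarrow> 0 \<le> Gam \<sigma> k"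
  using coth_ge_1[of "1 / (2 * \<sigma>\<^sup>2)"] by (auto simp: Gam_def)

lemma Gam_tendsto:
  assumes "\<sigma> > 0"
  shows "Gam \<sigma> \<longlonglongrightarrow> 0"
proof -
  have "(\<lambda>k. gauss_coeff \<sigma> (real k)) \<longlonglongrightarrow> 0" by (rule summable_LIMSEQ_zero[OF summable_gauss_coeff[OF assms]])
  from tendsto_mult_right_zero[OF this, of "sqrt (1 / (\<sigma> * sqrt pi) * coth (1 / (2 * \<sigma>\<^sup>2)))"]
  show ?thesis unfolding Gam_def [abs_def] gauss_coeff_def .
qed

section \<open>Square integrable functions and Fourier projections\<close>

lemma Cauchy_Schwarz_integral:
  fixes u v :: "'a \<Rightarrow> real"
  assumes [measurable]: "u \<in> borel_measurable M" "v \<in> borel_measurable M"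
    and u2: "integrable M (\<lambda>x. (u x)\<^sup>2)" and v2: "integrable M (\<lambda>x. (v x)\<^sup>2)"
  shows "integrable M (\<lambda>x. u x * v x)" "(LINT x|M. \<bar>u x * v x\<bar>)\<^sup>2 \<le> (LINT x|M. (u x)\<^sup>2) * (LINT x|M. (v x)\<^sup>2)"
proof -
  show i: "integrable M (\<lambda>x. u x * v x)"
  proof (rule Bochner_Integration.integrable_bound)
    show "integrable M (\<lambda>x. (u x)\<^sup>2 + (v x)\<^sup>2)" using u2 v2 by simp
    show "AE x in M. norm (u x * v x) \<le> norm ((u x)\<^sup>2 + (v x)\<^sup>2)"
    proof (rule AE_I2)
      fix x
      have "2 * (\<bar>u x\<bar> * \<bar>v x\<bar>) \<le> (u x)\<^sup>2 + (v x)\<^sup>2"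
        using sum_squares_bound[of "\<bar>u x\<bar>" "\<bar>v x\<bar>"] by simp
      moreover have "0 \<le> \<bar>u x\<bar> * \<bar>v x\<bar>" by simp
      ultimately have "\<bar>u x\<bar> * \<bar>v x\<bar> \<le> (u x)\<^sup>2 + (v x)\<^sup>2" by linarith
      then show "norm (u x * v x) \<le> norm ((u x)\<^sup>2 + (v x)\<^sup>2)" by (simp add: abs_mult)
    qed
  qed measurable
  have "(\<integral>\<^sup>+x. ennreal \<bar>u x\<bar> * ennreal \<bar>v x\<bar> \<partial>M)\<^sup>2 \<le> (\<integral>\<^sup>+x. (ennreal \<bar>u x\<bar>)\<^sup>2 \<partial>M) * (\<integral>\<^sup>+x. (ennreal \<bar>v x\<bar>)\<^sup>2 \<partial>M)"
    by (rule Cauchy_Schwarz_nn_integral) measurable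
  moreover have "(\<integral>\<^sup>+x. ennreal \<bar>u x\<bar> * ennreal \<bar>v x\<bar> \<partial>M) = ennreal (LINT x|M. \<bar>u x * v x\<bar>)"
    using integrable_abs[OF i] by (subst nn_integral_eq_integral[symmetric]) (auto simp: abs_mult ennreal_mult)
  moreover have "(\<integral>\<^sup>+x. (ennreal \<bar>u x\<bar>)\<^sup>2 \<partial>M) = ennreal (LINT x|M. (u x)\<^sup>2)"
    using u2 by (subst nn_integral_eq_integral[symmetric]) (auto simp: ennreal_power)
  moreover have "(\<integral>\<^sup>+x. (ennreal \<bar>v x\<bar>)\<^sup>2 \<partial>M) = ennreal (LINT x|M. (v x)\<^sup>2)"
    using v2 by (subst nn_integral_eq_integral[symmetric]) (auto simp: ennreal_power)
  ultimately have "(ennreal (LINT x|M. \<bar>u x * v x\<bar>))\<^sup>2 \<le> ennreal (LINT x|M. (u x)\<^sup>2) * ennreal (LINT x|M. (v x)\<^sup>2)"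
    by simp
  then have "ennreal ((LINT x|M. \<bar>u x * v x\<bar>)\<^sup>2) \<le> ennreal ((LINT x|M. (u x)\<^sup>2) * (LINT x|M. (v x)\<^sup>2))"
    by (simp add: ennreal_power ennreal_mult integral_nonneg_AE)
  then show "(LINT x|M. \<bar>u x * v x\<bar>)\<^sup>2 \<le> (LINT x|M. (u x)\<^sup>2) * (LINT x|M. (v x)\<^sup>2)"
    by (subst (asm) ennreal_le_iff) (auto intro!: mult_nonneg_nonneg integral_nonneg_AE)
qed

lemma L2I_measurable: "f \<in> L2I \<Longrightarrow> f \<in> borel_measurable lebI"
  by (simp add: L2I_def)

lemma L2I_integrable_sq: "f \<in> L2I \<Longrightarrow> integrable lebI (\<lambda>x. (cmod (f x))\<^sup>2)"
  by (simp add: L2I_def)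

lemma norm_L2I_nonneg [simp]: "0 \<le> norm_L2I f"
  by (simp add: norm_L2I_def integral_nonneg_AE)

lemma norm_L2I_sq: "(norm_L2I f)\<^sup>2 = (LINT x|lebI. (cmod (f x))\<^sup>2)"
  by (simp add: norm_L2I_def integral_nonneg_AE)

lemma L2I_cong: "f \<in> L2I \<Longrightarrow> (\<And>x. x \<in> {-1..1} \<Longrightarrow> f x = g x) \<Longrightarrow> g \<in> L2I"
proof -
  assume f: "f \<in> L2I" and eq: "\<And>x. x \<in> {-1..1} \<Longrightarrow> f x = g x"
  have "g \<in> borel_measurable lebI"
    using L2I_measurable[OF f] by (subst measurable_cong[of _ _ f]) (auto simp: eq)
  moreover have "integrable lebI (\<lambda>x. (cmod (g x))\<^sup>2)"
    using L2I_integrable_sq[OF f] by (subst Bochner_Integration.integrable_cong[OF refl, of _ _ "\<lambda>x. (cmod (f x))\<^sup>2"]) (auto simp: eq)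
  ultimately show ?thesis by (simp add: L2I_def)
qed

lemma L2I_bounded:
  assumes "f \<in> borel_measurable lebI" "\<And>x. x \<in> {-1..1} \<Longrightarrow> cmod (f x) \<le> B"
  shows "f \<in> L2I" "norm_L2I f \<le> sqrt 2 * B"
proof -
  have B: "0 \<le> B" by (rule order_trans[OF norm_ge_zero assms(2)[of 0]]) simp
  have i: "integrable lebI (\<lambda>x. (cmod (f x))\<^sup>2)"
    by (rule integrable_lebI_bounded[where B = "B\<^sup>2"]) (use assms in \<open>auto intro!: power_mono\<close>)
  with assms(1) show "f \<in> L2I" by (simp add: L2I_def)
  have "(norm_L2I f)\<^sup>2 \<le> (LINT x|lebI. B\<^sup>2)"
    unfolding norm_L2I_sq
    by (rule integral_mono[OF i]) (use assms in \<open>auto intro!: power_mono integrable_lebI_bounded[where B = "B\<^sup>2"]\<close>)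
  also have "\<dots> = (sqrt 2 * B)\<^sup>2" by (simp add: power_mult_distrib)
  finally show "norm_L2I f \<le> sqrt 2 * B" using B by (rule_tac power2_le_imp_le) auto
qed

lemma L2I_Cauchy_Schwarz:
  assumes f: "f \<in> L2I" and g: "g \<in> L2I"
  shows "integrable lebI (\<lambda>x. f x * g x)" "(LINT x|lebI. cmod (f x) * cmod (g x)) \<le> norm_L2I f * norm_L2I g"
    "cmod (LINT x|lebI. f x * g x) \<le> norm_L2I f * norm_L2I g"
proof -
  note [measurable] = L2I_measurable[OF f] L2I_measurable[OF g]
  have i: "integrable lebI (\<lambda>x. cmod (f x) * cmod (g x))"
    and le: "(LINT x|lebI. \<bar>cmod (f x) * cmod (g x)\<bar>)\<^sup>2 \<le> (LINT x|lebI. (cmod (f x))\<^sup>2) * (LINT x|lebI. (cmod (g x))\<^sup>2)"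
    using Cauchy_Schwarz_integral[of "\<lambda>x. cmod (f x)" lebI "\<lambda>x. cmod (g x)"] L2I_integrable_sq[OF f] L2I_integrable_sq[OF g]
    by auto
  show "integrable lebI (\<lambda>x. f x * g x)"
    by (rule Bochner_Integration.integrable_bound[OF i]) (measurable, simp add: norm_mult)
  have "(LINT x|lebI. cmod (f x) * cmod (g x))\<^sup>2 \<le> (norm_L2I f * norm_L2I g)\<^sup>2"
    using le by (simp add: power_mult_distrib norm_L2I_sq)
  then show *: "(LINT x|lebI. cmod (f x) * cmod (g x)) \<le> norm_L2I f * norm_L2I g"
    by (rule power2_le_imp_le) simp
  have "cmod (LINT x|lebI. f x * g x) \<le> (LINT x|lebI. cmod (f x * g x))"
    by (rule integral_norm_bound)
  with * show "cmod (LINT x|lebI. f x * g x) \<le> norm_L2I f * norm_L2I g" by (simp add: norm_mult)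
qed

lemma const_L2I: "(\<lambda>_. c) \<in> L2I" "norm_L2I (\<lambda>_. c) = sqrt 2 * cmod c"
proof -
  show "(\<lambda>_. c) \<in> L2I" by (rule L2I_bounded(1)[where B = "cmod c"]) auto
  show "norm_L2I (\<lambda>_. c) = sqrt 2 * cmod c" by (simp add: norm_L2I_def real_sqrt_mult)
qed

lemma L2I_integrable: "f \<in> L2I \<Longrightarrow> integrable lebI f"
  using L2I_Cauchy_Schwarz(1)[OF _ const_L2I(1)[of 1], of f] by simp

lemma L2I_norm1_le: "f \<in> L2I \<Longrightarrow> (LINT x|lebI. cmod (f x)) \<le> sqrt 2 * norm_L2I f"
  using L2I_Cauchy_Schwarz(2)[OF _ const_L2I(1)[of 1], of f] by (simp add: const_L2I mult.commute)

lemma L2I_cmult: "f \<in> L2I \<Longrightarrow> (\<lambda>x. c * f x) \<in> L2I"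
  unfolding L2I_def by (auto simp: norm_mult power_mult_distrib)

lemma norm_L2I_cmult: "norm_L2I (\<lambda>x. c * f x) = cmod c * norm_L2I f"
  by (simp add: norm_L2I_def norm_mult power_mult_distrib real_sqrt_mult)

lemma L2I_add:
  assumes f: "f \<in> L2I" and g: "g \<in> L2I"
  shows "(\<lambda>x. f x + g x) \<in> L2I" "norm_L2I (\<lambda>x. f x + g x) \<le> norm_L2I f + norm_L2I g"
proof -
  note [measurable] = L2I_measurable[OF f] L2I_measurable[OF g]
  have i: "integrable lebI (\<lambda>x. cmod (f x) * cmod (g x))"
    using Cauchy_Schwarz_integral(1)[of "\<lambda>x. cmod (f x)" lebI "\<lambda>x. cmod (g x)"] L2I_integrable_sq[OF f] L2I_integrable_sq[OF g]
    by auto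
  have i2: "integrable lebI (\<lambda>x. (cmod (f x))\<^sup>2 + 2 * (cmod (f x) * cmod (g x)) + (cmod (g x))\<^sup>2)"
    using i L2I_integrable_sq[OF f] L2I_integrable_sq[OF g] by simp
  have le: "(cmod (f x + g x))\<^sup>2 \<le> (cmod (f x))\<^sup>2 + 2 * (cmod (f x) * cmod (g x)) + (cmod (g x))\<^sup>2" for x
    using power_mono[OF norm_triangle_ineq[of "f x" "g x"], of 2] by (simp add: power2_sum algebra_simps)
  have i3: "integrable lebI (\<lambda>x. (cmod (f x + g x))\<^sup>2)"
    by (rule Bochner_Integration.integrable_bound[OF i2]) (use le in \<open>auto intro!: AE_I2 order_trans[OF _ abs_ge_self]\<close>)
  then show "(\<lambda>x. f x + g x) \<in> L2I" by (simp add: L2I_def)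
  have "(norm_L2I (\<lambda>x. f x + g x))\<^sup>2 \<le> (LINT x|lebI. (cmod (f x))\<^sup>2 + 2 * (cmod (f x) * cmod (g x)) + (cmod (g x))\<^sup>2)"
    unfolding norm_L2I_sq by (rule integral_mono[OF i3 i2 le])
  also have "\<dots> = (norm_L2I f)\<^sup>2 + 2 * (LINT x|lebI. cmod (f x) * cmod (g x)) + (norm_L2I g)\<^sup>2"
    unfolding norm_L2I_sq using i L2I_integrable_sq[OF f] L2I_integrable_sq[OF g] by simp
  also have "\<dots> \<le> (norm_L2I f + norm_L2I g)\<^sup>2"
    using L2I_Cauchy_Schwarz(2)[OF f g] by (simp add: power2_sum algebra_simps)
  finally show "norm_L2I (\<lambda>x. f x + g x) \<le> norm_L2I f + norm_L2I g"
    by (rule power2_le_imp_le) simp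
qed

lemma L2I_diff:
  assumes f: "f \<in> L2I" and g: "g \<in> L2I"
  shows "(\<lambda>x. f x - g x) \<in> L2I" "norm_L2I (\<lambda>x. f x - g x) \<le> norm_L2I f + norm_L2I g"
  using L2I_add[OF f L2I_cmult[OF g, of "-1"]] norm_L2I_cmult[of "-1" g] by simp_all

lemma L2I_sum:
  assumes "finite A" "\<And>i. i \<in> A \<Longrightarrow> f i \<in> L2I"
  shows "(\<lambda>x. \<Sum>i\<in>A. f i x) \<in> L2I" "norm_L2I (\<lambda>x. \<Sum>i\<in>A. f i x) \<le> (\<Sum>i\<in>A. norm_L2I (f i))"
  using assms
proof (induction A rule: finite_induct)
  case empty
  { case 1 show ?case using const_L2I(1)[of 0] by simp }
  { case 2 show ?case using const_L2I(2)[of 0] by simp }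
next
  case (insert a A)
  { case 1 then show ?case using insert L2I_add(1)[of "f a" "\<lambda>x. \<Sum>i\<in>A. f i x"] by simp }
  { case 2 then show ?case using insert L2I_add[of "f a" "\<lambda>x. \<Sum>i\<in>A. f i x"] by (simp add: order_trans) }
qed

lemma integrable_times_e_mode: "integrable lebI f \<Longrightarrow> integrable lebI (\<lambda>x. f x * e_mode j x)"
  by (rule Bochner_Integration.integrable_bound[where f = f])
     (auto simp: norm_mult intro!: measurable_lebI_borel borel_measurable_times dest: borel_measurable_integrable)

lemma trig_sum_bounded: "cmod (\<Sum>j\<in>A. c j * e_mode j x) \<le> (\<Sum>j\<in>A. cmod (c j))"
  by (rule order_trans[OF norm_sum]) (simp add: norm_mult)

lemma trig_sum_borel [measurable]: "(\<lambda>x. \<Sum>j\<in>A. c j * e_mode j x) \<in> borel_measurable borel"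
  by measurable

lemma trig_sum_L2I: "(\<lambda>x. \<Sum>j\<in>A. c j * e_mode j x) \<in> L2I"
  by (rule L2I_bounded(1)[OF _ trig_sum_bounded]) (intro measurable_lebI_borel trig_sum_borel)

lemma fourier_coeff_trig_sum:
  assumes "finite A"
  shows "fourier_coeff (\<lambda>x. \<Sum>j\<in>A. c j * e_mode j x) l = (if l \<in> A then c l else 0)"
proof -
  have "(LINT x|lebI. (\<Sum>j\<in>A. c j * e_mode j x) * e_mode (- l) x) = (LINT x|lebI. (\<Sum>j\<in>A. c j * e_mode (j - l) x))"
    using e_mode_add_index[of _ "- l"] by (simp add: sum_distrib_right mult.assoc)
  also have "\<dots> = (\<Sum>j\<in>A. (LINT x|lebI. c j * e_mode (j - l) x))"
    by (intro Bochner_Integration.integral_sum integrable_mult_right integrable_lebI_bounded[where B = 1])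
       (auto intro: measurable_lebI_borel)
  also have "\<dots> = (\<Sum>j\<in>A. if j = l then 2 * c l else 0)"
    by (intro sum.cong) (auto simp: integral_e_mode)
  also have "\<dots> = (if l \<in> A then 2 * c l else 0)"
    using assms by (simp add: sum.delta)
  finally show ?thesis by (simp add: fourier_coeff_def)
qed

lemma integral_times_cnj_trig_sum:
  assumes "finite A" "integrable lebI f"
  shows "(LINT x|lebI. f x * cnj (\<Sum>j\<in>A. c j * e_mode j x)) = 2 * (\<Sum>j\<in>A. cnj (c j) * fourier_coeff f j)"
proof -
  have "(LINT x|lebI. f x * cnj (\<Sum>j\<in>A. c j * e_mode j x)) = (LINT x|lebI. (\<Sum>j\<in>A. cnj (c j) * (f x * e_mode (- j) x)))"
    by (simp add: sum_distrib_left cnj_e_mode mult_ac)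
  also have "\<dots> = (\<Sum>j\<in>A. cnj (c j) * (LINT x|lebI. f x * e_mode (- j) x))"
    by (simp add: integrable_times_e_mode[OF assms(2)])
  finally show ?thesis by (simp add: fourier_coeff_def sum_distrib_left mult_ac)
qed

lemma norm_trig_sum:
  assumes "finite A"
  shows "(norm_L2I (\<lambda>x. \<Sum>j\<in>A. c j * e_mode j x))\<^sup>2 = 2 * (\<Sum>j\<in>A. (cmod (c j))\<^sup>2)"
proof -
  let ?f = "\<lambda>x. \<Sum>j\<in>A. c j * e_mode j x"
  have "complex_of_real ((norm_L2I ?f)\<^sup>2) = (LINT x|lebI. ?f x * cnj (?f x))"
    unfolding norm_L2I_sq complex_norm_square[symmetric] by (rule integral_complex_of_real[symmetric])
  also have "\<dots> = 2 * (\<Sum>j\<in>A. cnj (c j) * fourier_coeff ?f j)"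
    by (rule integral_times_cnj_trig_sum[OF assms L2I_integrable[OF trig_sum_L2I]])
  also have "\<dots> = 2 * (\<Sum>j\<in>A. cnj (c j) * c j)"
    by (simp add: fourier_coeff_trig_sum[OF assms])
  also have "\<dots> = complex_of_real (2 * (\<Sum>j\<in>A. (cmod (c j))\<^sup>2))"
    by (simp add: complex_norm_square[symmetric] mult.commute[of "cnj _"])
  finally show ?thesis by (simp only: of_real_eq_iff)
qed

lemma proj_L2I: "proj k f \<in> L2I"
  unfolding proj_def [abs_def] by (rule trig_sum_L2I)

lemma proj_borel [measurable]: "proj k f \<in> borel_measurable borel"
  unfolding proj_def [abs_def] by measurable

lemma trig_poly_proj: "trig_poly k (proj k f)"
  unfolding trig_poly_def proj_def by blast

lemma trig_poly_L2I: "trig_poly k g \<Longrightarrow> g \<in> L2I"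
proof -
  assume "trig_poly k g"
  then obtain c where "g = (\<lambda>x. \<Sum>j = - int k..int k. c j * e_mode j x)"
    unfolding trig_poly_def by (auto simp: fun_eq_iff)
  then show ?thesis using trig_sum_L2I by simp
qed

lemma fourier_coeff_proj: "\<bar>j\<bar> \<le> int k \<Longrightarrow> fourier_coeff (proj k f) j = fourier_coeff f j"
  unfolding proj_def [abs_def] by (subst fourier_coeff_trig_sum) auto

lemma proj_proj: "proj k (proj k f) = proj k f"
  by (rule ext) (simp add: proj_def[of k "proj k f"] fourier_coeff_proj abs_le_iff, simp add: proj_def)

lemma integral_proj: "(LINT x|lebI. proj k f x) = (LINT x|lebI. f x)"
  using fourier_coeff_proj[of 0 k f] by (simp add: fourier_coeff_def)

text \<open>Bessel: expand \<open>\<parallel>f - \<pi>\<^sub>k f\<parallel>\<^sup>2 \<ge> 0\<close>.\<close>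

lemma norm_proj_le:
  assumes f: "f \<in> L2I"
  shows "norm_L2I (proj k f) \<le> norm_L2I f"
proof -
  let ?A = "{- int k..int k}"
  let ?S = "2 * (\<Sum>j\<in>?A. (cmod (fourier_coeff f j))\<^sup>2)"
  have n: "(norm_L2I (proj k f))\<^sup>2 = ?S"
    unfolding proj_def [abs_def] by (rule norm_trig_sum) simp
  have i: "integrable lebI (\<lambda>x. f x * cnj (proj k f x))"
  proof -
    have "cnj \<in> borel_measurable borel" by (intro borel_measurable_continuous_onI continuous_intros)
    from measurable_compose[OF _ this, of "proj k f" lebI] have "(\<lambda>x. cnj (proj k f x)) \<in> L2I"
      using proj_L2I[of k f] by (auto simp: L2I_def)
    with f show ?thesis by (rule L2I_Cauchy_Schwarz(1))
  qed
  have "(LINT x|lebI. f x * cnj (proj k f x)) = 2 * (\<Sum>j\<in>?A. cnj (fourier_coeff f j) * fourier_coeff f j)"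
    unfolding proj_def by (rule integral_times_cnj_trig_sum) (auto intro: L2I_integrable f)
  also have "\<dots> = complex_of_real ?S"
    by (simp add: complex_norm_square[symmetric] mult.commute[of "cnj _"])
  finally have c: "(LINT x|lebI. Re (f x * cnj (proj k f x))) = ?S"
    unfolding integral_Re[OF i] by (simp only: Re_complex_of_real)
  have "0 \<le> (LINT x|lebI. (cmod (f x - proj k f x))\<^sup>2)" by simp
  also have "\<dots> = (LINT x|lebI. (cmod (f x))\<^sup>2 - 2 * Re (f x * cnj (proj k f x)) + (cmod (proj k f x))\<^sup>2)"
  proof -
    have "(cmod (a - b))\<^sup>2 = (cmod a)\<^sup>2 - 2 * Re (a * cnj b) + (cmod b)\<^sup>2" for a b
      unfolding cmod_power2 by (simp add: power2_eq_square algebra_simps)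
    then show ?thesis by (simp only:)
  qed
  also have "\<dots> = (norm_L2I f)\<^sup>2 - 2 * ?S + ?S"
    unfolding n[symmetric] unfolding norm_L2I_sq
    using integrable_Re[OF i] L2I_integrable_sq[OF f] L2I_integrable_sq[OF proj_L2I, of k f]
    by (simp add: c n[unfolded norm_L2I_sq] del: complex_cnj_mult times_complex.sel)
  finally have "(norm_L2I (proj k f))\<^sup>2 \<le> (norm_L2I f)\<^sup>2" unfolding n by simp
  then show ?thesis by (rule power2_le_imp_le) simp
qed

lemma fourier_coeff_diff:
  assumes "integrable lebI f" "integrable lebI g"
  shows "fourier_coeff (\<lambda>x. f x - g x) j = fourier_coeff f j - fourier_coeff g j"
  unfolding fourier_coeff_def using assms[THEN integrable_times_e_mode, of "- j"]
  by (simp add: left_diff_distrib right_diff_distrib)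

lemma proj_diff:
  assumes "integrable lebI f" "integrable lebI g"
  shows "proj k (\<lambda>x. f x - g x) = (\<lambda>x. proj k f x - proj k g x)"
  unfolding proj_def [abs_def] fourier_coeff_diff[OF assms] by (simp add: left_diff_distrib sum_subtractf)

lemma proj_cmult: "proj k (\<lambda>x. c * f x) = (\<lambda>x. c * proj k f x)"
  unfolding proj_def [abs_def] fourier_coeff_def by (simp add: mult.assoc sum_distrib_left mult.left_commute)

section \<open>The annealed transfer operator\<close>

definition norm_L1I :: "(real \<Rightarrow> complex) \<Rightarrow> real" where
  "norm_L1I f = (LINT x|lebI. cmod (f x))"

lemma norm_L1I_nonneg [simp]: "0 \<le> norm_L1I f"
  by (simp add: norm_L1I_def)

lemma pair_sigma_finite_lebI: "pair_sigma_finite lebI lebI"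
proof -
  interpret finite_measure lebI by (rule finite_measure_lebI)
  show ?thesis by unfold_locales
qed

lemma integrable_bounded_kernel:
  fixes f :: "real \<Rightarrow> 'b :: {real_normed_field, banach, second_countable_topology}"
  assumes [measurable]: "case_prod K \<in> borel_measurable (lebI \<Otimes>\<^sub>M lebI)"
    and K: "\<And>x y. norm (K x y) \<le> B" and f: "integrable lebI f"
  shows "integrable (lebI \<Otimes>\<^sub>M lebI) (\<lambda>(x, y). K x y * f y)"
proof -
  interpret pair_sigma_finite lebI lebI by (rule pair_sigma_finite_lebI)
  note [measurable] = borel_measurable_integrable[OF f]
  have B: "0 \<le> B" by (rule order_trans[OF norm_ge_zero K])
  have "integrable (lebI \<Otimes>\<^sub>M lebI) (\<lambda>p. B * norm (f (snd p)))"
  proof (rule Fubini_integrable)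
    show "integrable lebI (\<lambda>x. LINT y|lebI. norm (B * norm (f (snd (x, y)))))"
      by (rule integrable_lebI_bounded[where B = "\<bar>LINT y|lebI. norm (B * norm (f y))\<bar>"]) auto
    show "AE x in lebI. integrable lebI (\<lambda>y. B * norm (f (snd (x, y))))" using f by simp
  qed measurable
  then show ?thesis
  proof (rule Bochner_Integration.integrable_bound)
    show "AE p in lebI \<Otimes>\<^sub>M lebI. norm (case p of (x, y) \<Rightarrow> K x y * f y) \<le> norm (B * norm (f (snd p)))"
      using B K by (auto simp: norm_mult intro!: mult_right_mono AE_I2)
  qed measurable
qed

locale noisy_map =
  fixes T :: "real \<Rightarrow> real" and \<sigma> :: real
  assumes T_meas [measurable]: "T \<in> borel_measurable lebI" and sigma_pos: "\<sigma> > 0"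
begin

lemma kern_measurable [measurable]: "kern \<sigma> \<in> borel_measurable borel"
  by (rule kern_borel[OF sigma_pos])

text \<open>Besides the transfer operator itself (\<open>G = kern \<sigma>\<close>), its projection and its truncation error have
  this form, with \<open>G\<close> a partial sum or a tail of the Fourier series. The bounds below are stated once
  for all of them.\<close>

definition kernel_op :: "(real \<Rightarrow> real) \<Rightarrow> (real \<Rightarrow> complex) \<Rightarrow> real \<Rightarrow> complex" where
  "kernel_op G f x = (LINT y|lebI. of_real (G (x - T y)) * f y)"

lemma PF_kernel_op: "PF T \<sigma> f x = kernel_op (kern \<sigma>) f x"
  unfolding PF_def kernel_op_def kern_def by (simp add: algebra_simps)

lemma kernel_op_borel:
  assumes [measurable]: "G \<in> borel_measurable borel" and f: "integrable lebI f"
  shows "kernel_op G f \<in> borel_measurable borel"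
proof -
  interpret finite_measure lebI by (rule finite_measure_lebI)
  note [measurable] = borel_measurable_integrable[OF f]
  show ?thesis unfolding kernel_op_def [abs_def] by measurable
qed

lemma kernel_op_integrable:
  fixes f :: "real \<Rightarrow> complex"
  assumes [measurable]: "G \<in> borel_measurable borel" and G: "\<And>u. \<bar>G u\<bar> \<le> B" and f: "integrable lebI f"
  shows "integrable lebI (\<lambda>y. of_real (G (x - T y)) * f y)"
proof -
  note [measurable] = borel_measurable_integrable[OF f]
  have "0 \<le> B" using G[of 0] by linarith
  then have ae: "AE y in lebI. norm (of_real (G (x - T y)) * f y) \<le> norm (B * cmod (f y))"
    using G by (intro AE_I2) (auto simp: norm_mult intro!: mult_right_mono)
  have i: "integrable lebI (\<lambda>y. B * cmod (f y))" using f by simp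
  show ?thesis by (rule Bochner_Integration.integrable_bound[OF i _ ae]) measurable
qed

lemma kernel_op_sup:
  assumes [measurable]: "G \<in> borel_measurable borel" and G: "\<And>u. \<bar>G u\<bar> \<le> B" and f: "integrable lebI f"
  shows "cmod (kernel_op G f x) \<le> B * norm_L1I f"
proof -
  have "cmod (kernel_op G f x) \<le> (LINT y|lebI. cmod (of_real (G (x - T y)) * f y))"
    unfolding kernel_op_def by (rule integral_norm_bound)
  also have "\<dots> \<le> (LINT y|lebI. B * cmod (f y))"
    using kernel_op_integrable[OF assms, of x] f G
    by (intro integral_mono) (auto simp: norm_mult intro!: mult_right_mono dest: integrable_norm)
  finally show ?thesis by (simp add: norm_L1I_def)
qed

text \<open>Cauchy--Schwarz with respect to the weight \<open>\<bar>f\<bar>\<close>, then Fubini: integrating \<open>G (x - T y)\<^sup>2\<close> over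
  \<open>x\<close> first bounds it by \<open>b\<^sup>2\<close> for every \<open>y\<close>.\<close>

lemma kernel_op_L2:
  assumes [measurable]: "G \<in> borel_measurable borel" and G: "\<And>u. \<bar>G u\<bar> \<le> B" and f: "integrable lebI f"
    and b: "0 \<le> b" "\<And>a. (LINT x|lebI. (G (x - a))\<^sup>2) \<le> b\<^sup>2"
  shows "kernel_op G f \<in> L2I" "norm_L2I (kernel_op G f) \<le> b * norm_L1I f"
proof -
  interpret pair_sigma_finite lebI lebI by (rule pair_sigma_finite_lebI)
  note [measurable] = borel_measurable_integrable[OF f]
  have [measurable]: "kernel_op G f \<in> borel_measurable borel" by (rule kernel_op_borel) (use f in auto)
  show L2: "kernel_op G f \<in> L2I"
    by (rule L2I_bounded(1)[where B = "B * norm_L1I f"]) (auto intro!: measurable_lebI_borel kernel_op_sup G f)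
  have f': "integrable lebI (\<lambda>y. cmod (f y))" using f by simp
  have G2: "norm ((G u)\<^sup>2) \<le> B\<^sup>2" for u using power_mono[OF G, of u 2] by simp
  have iG: "integrable (lebI \<Otimes>\<^sub>M lebI) (\<lambda>(x, y). (G (x - T y))\<^sup>2 * cmod (f y))"
    by (rule integrable_bounded_kernel[OF _ G2 f']) measurable
  have sq: "(cmod (kernel_op G f x))\<^sup>2 \<le> norm_L1I f * (LINT y|lebI. (G (x - T y))\<^sup>2 * cmod (f y))" for x
  proof -
    let ?u = "\<lambda>y. G (x - T y) * sqrt (cmod (f y))" and ?v = "\<lambda>y. sqrt (cmod (f y))"
    have i: "integrable lebI (\<lambda>y. (G (x - T y))\<^sup>2 * cmod (f y))"
      by (rule Bochner_Integration.integrable_bound[of _ "\<lambda>y. B\<^sup>2 * cmod (f y)"])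
         (use f G2 in \<open>auto simp: abs_mult intro!: mult_right_mono\<close>)
    have "cmod (kernel_op G f x) \<le> (LINT y|lebI. cmod (of_real (G (x - T y)) * f y))"
      unfolding kernel_op_def by (rule integral_norm_bound)
    also have "\<dots> = (LINT y|lebI. \<bar>?u y * ?v y\<bar>)"
      by (simp add: norm_mult abs_mult mult.assoc)
    finally have "(cmod (kernel_op G f x))\<^sup>2 \<le> (LINT y|lebI. \<bar>?u y * ?v y\<bar>)\<^sup>2" by (rule power_mono) simp
    also have "\<dots> \<le> (LINT y|lebI. (?u y)\<^sup>2) * (LINT y|lebI. (?v y)\<^sup>2)"
      by (rule Cauchy_Schwarz_integral(2)) (use i f in \<open>simp_all add: power_mult_distrib\<close>)
    finally show ?thesis by (simp add: power_mult_distrib norm_L1I_def mult.commute)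
  qed
  have "(LINT x|lebI. (LINT y|lebI. (G (x - T y))\<^sup>2 * cmod (f y))) = (LINT y|lebI. (LINT x|lebI. (G (x - T y))\<^sup>2 * cmod (f y)))"
    using Fubini_integral[OF iG] by simp
  also have "\<dots> = (LINT y|lebI. (LINT x|lebI. (G (x - T y))\<^sup>2) * cmod (f y))" by simp
  also have "\<dots> \<le> (LINT y|lebI. b\<^sup>2 * cmod (f y))"
  proof (rule integral_mono)
    show "integrable lebI (\<lambda>y. (LINT x|lebI. (G (x - T y))\<^sup>2) * cmod (f y))"
      using integrable_snd[OF iG] by simp
  qed (use f b in \<open>auto intro: mult_right_mono\<close>)
  also have "\<dots> = b\<^sup>2 * norm_L1I f" by (simp add: norm_L1I_def)
  finally have dbl: "(LINT x|lebI. (LINT y|lebI. (G (x - T y))\<^sup>2 * cmod (f y))) \<le> b\<^sup>2 * norm_L1I f" .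
  have "(norm_L2I (kernel_op G f))\<^sup>2 \<le> (LINT x|lebI. norm_L1I f * (LINT y|lebI. (G (x - T y))\<^sup>2 * cmod (f y)))"
    unfolding norm_L2I_sq using L2I_integrable_sq[OF L2] integrable_fst'[OF iG] sq
    by (intro integral_mono) auto
  also have "\<dots> = norm_L1I f * (LINT x|lebI. (LINT y|lebI. (G (x - T y))\<^sup>2 * cmod (f y)))" by simp
  also have "\<dots> \<le> norm_L1I f * (b\<^sup>2 * norm_L1I f)" by (rule mult_left_mono[OF dbl]) simp
  also have "\<dots> = (b * norm_L1I f)\<^sup>2" by (simp add: power2_eq_square)
  finally have "(norm_L2I (kernel_op G f))\<^sup>2 \<le> (b * norm_L1I f)\<^sup>2" .
  then show "norm_L2I (kernel_op G f) \<le> b * norm_L1I f"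
    by (rule power2_le_imp_le) (use b in simp)
qed

definition kern_bound :: real where "kern_bound = (SOME B. \<forall>u. kern \<sigma> u \<le> B)"

lemma kern_abs_le: "\<bar>kern \<sigma> u\<bar> \<le> kern_bound"
proof -
  have "\<exists>B. \<forall>u. kern \<sigma> u \<le> B" using kern_bounded[OF sigma_pos] by blast
  then have "\<forall>u. kern \<sigma> u \<le> kern_bound" unfolding kern_bound_def by (rule someI_ex)
  with kern_pos[OF sigma_pos, of u] show ?thesis by (simp add: abs_of_pos)
qed

lemma kern_bound_pos: "0 < kern_bound"
  using kern_abs_le[of 0] kern_pos[OF sigma_pos, of 0] by linarith

definition kern_norm :: real where "kern_norm = norm_rho \<sigma> * sqrt (coth (1 / (2 * \<sigma>\<^sup>2)))"

lemma kern_norm_nonneg: "0 \<le> kern_norm"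
  using coth_ge_1[of "1 / (2 * \<sigma>\<^sup>2)"] sigma_pos by (simp add: kern_norm_def norm_rho_def)

lemma PF_L2:
  assumes "integrable lebI f"
  shows "PF T \<sigma> f \<in> L2I" "norm_L2I (PF T \<sigma> f) \<le> kern_norm * norm_L1I f"
  using kernel_op_L2[OF kern_measurable kern_abs_le assms kern_norm_nonneg] kern_L2[OF sigma_pos]
  unfolding PF_kernel_op [abs_def] kern_norm_def by auto

lemma PF_sup: "integrable lebI f \<Longrightarrow> cmod (PF T \<sigma> f x) \<le> kern_bound * norm_L1I f"
  unfolding PF_kernel_op by (rule kernel_op_sup[OF kern_measurable kern_abs_le])

lemma PF_borel: "integrable lebI f \<Longrightarrow> PF T \<sigma> f \<in> borel_measurable borel"
  unfolding PF_kernel_op [abs_def] by (rule kernel_op_borel[OF kern_measurable])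

lemma PF_diff:
  assumes "integrable lebI f" "integrable lebI g"
  shows "PF T \<sigma> (\<lambda>x. f x - g x) = (\<lambda>x. PF T \<sigma> f x - PF T \<sigma> g x)"
  unfolding PF_kernel_op kernel_op_def
  using kernel_op_integrable[OF kern_measurable kern_abs_le assms(1)] kernel_op_integrable[OF kern_measurable kern_abs_le assms(2)]
  by (simp add: right_diff_distrib)

lemma PF_cmult: "PF T \<sigma> (\<lambda>x. c * f x) = (\<lambda>x. c * PF T \<sigma> f x)"
  unfolding PF_kernel_op kernel_op_def by (simp add: mult.left_commute[of _ c])

text \<open>In Fourier space the noise acts as a multiplier on the coefficients of the push-forward by \<open>T\<close>.\<close>

lemma fourier_coeff_PF:
  assumes f: "integrable lebI f"
  shows "fourier_coeff (PF T \<sigma> f) j = of_real (gauss_coeff \<sigma> (of_int j) / 2) * (LINT y|lebI. e_mode (- j) (T y) * f y)"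
proof -
  interpret pair_sigma_finite lebI lebI by (rule pair_sigma_finite_lebI)
  have i: "integrable (lebI \<Otimes>\<^sub>M lebI) (\<lambda>(x, y). (of_real (kern \<sigma> (x - T y)) * e_mode (- j) x) * f y)"
  proof (rule integrable_bounded_kernel[OF _ _ f])
    show "cmod (of_real (kern \<sigma> (x - T y)) * e_mode (- j) x) \<le> kern_bound" for x y
      using kern_abs_le by (simp add: norm_mult)
  qed measurable
  have "PF T \<sigma> f x * e_mode (- j) x = (LINT y|lebI. (of_real (kern \<sigma> (x - T y)) * e_mode (- j) x) * f y)" for x
  proof -
    have "PF T \<sigma> f x * e_mode (- j) x = (LINT y|lebI. of_real (kern \<sigma> (x - T y)) * f y * e_mode (- j) x)"
      unfolding PF_kernel_op kernel_op_def by (rule integral_mult_left_zero[symmetric])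
    then show ?thesis by (simp only: mult_ac)
  qed
  then have "(LINT x|lebI. PF T \<sigma> f x * e_mode (- j) x) =
      (LINT x|lebI. (LINT y|lebI. (of_real (kern \<sigma> (x - T y)) * e_mode (- j) x) * f y))"
    by (simp only:)
  also have "\<dots> = (LINT y|lebI. (LINT x|lebI. (of_real (kern \<sigma> (x - T y)) * e_mode (- j) x) * f y))"
    using Fubini_integral[OF i] by simp
  also have "\<dots> = (LINT y|lebI. of_real (gauss_coeff \<sigma> (of_int j)) * (e_mode (- j) (T y) * f y))"
    using integral_kern_e_mode[OF sigma_pos, of _ "- j"] by (simp add: mult_ac)
  finally show ?thesis by (simp add: fourier_coeff_def)
qed

lemma proj_PF:
  assumes f: "integrable lebI f"
  shows "proj k (PF T \<sigma> f) x = kernel_op (theta_sum \<sigma> k) f x"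
proof -
  note [measurable] = borel_measurable_integrable[OF f]
  have i: "integrable lebI (\<lambda>y. e_mode (- j) (T y) * f y)" for j
    by (rule Bochner_Integration.integrable_bound[OF f]) (auto simp: norm_mult)
  have "proj k (PF T \<sigma> f) x = (\<Sum>j = - int k..int k. (LINT y|lebI. of_real (gauss_coeff \<sigma> (of_int j) / 2) * e_mode j x * (e_mode (- j) (T y) * f y)))"
    unfolding proj_def fourier_coeff_PF[OF f] integral_mult_right_zero by (simp only: mult_ac)
  also have "\<dots> = (LINT y|lebI. (\<Sum>j = - int k..int k. of_real (gauss_coeff \<sigma> (of_int j) / 2) * e_mode j x * (e_mode (- j) (T y) * f y)))"
    using i by (intro Bochner_Integration.integral_sum[symmetric] integrable_mult_right) auto
  also have "\<dots> = kernel_op (theta_sum \<sigma> k) f x"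
    unfolding kernel_op_def theta_sum_e_mode sum_distrib_right
    by (simp add: e_mode_add[of _ x "- T _", simplified] e_mode_minus mult_ac)
  finally show ?thesis .
qed

lemma PF_minus_proj:
  assumes f: "integrable lebI f"
  shows "PF T \<sigma> f x - proj k (PF T \<sigma> f) x = kernel_op (\<lambda>u. kern \<sigma> u - theta_sum \<sigma> k u) f x"
  unfolding proj_PF[OF f] PF_kernel_op unfolding kernel_op_def
  using kernel_op_integrable[OF kern_measurable kern_abs_le f, where x = x]
    kernel_op_integrable[OF borel_measurable_theta_sum theta_sum_bound[OF sigma_pos] f, where x = x]
  by (simp add: left_diff_distrib)

lemma PF_tail_sup:
  assumes f: "integrable lebI f"
  shows "cmod (PF T \<sigma> f x - proj k (PF T \<sigma> f) x) \<le> Gam1 \<sigma> k / 2 * norm_L1I f"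
  unfolding PF_minus_proj[OF f] by (rule kernel_op_sup[OF _ kern_tail_sup[OF sigma_pos] f]) measurable

lemma PF_tail_L2:
  assumes f: "integrable lebI f"
  shows "norm_L2I (\<lambda>x. PF T \<sigma> f x - proj k (PF T \<sigma> f) x) \<le> Gam \<sigma> k * norm_L1I f"
  unfolding PF_minus_proj[OF f, abs_def]
  using kernel_op_L2(2)[OF _ kern_tail_sup[OF sigma_pos] f Gam_nonneg[OF sigma_pos] kern_tail_L2[OF sigma_pos], of k] by simp

lemma integral_PF:
  assumes "integrable lebI f"
  shows "(LINT x|lebI. PF T \<sigma> f x) = (LINT x|lebI. f x)"
  using fourier_coeff_PF[OF assms, of 0] by (simp add: fourier_coeff_def)

text \<open>The factor 2 is the length of the interval, over which the minorising constant is integrated.\<close>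

definition doeblin_rate :: real where "doeblin_rate = 1 - 2 * normal_density 0 \<sigma> 1"

lemma integral_kern: "(LINT x|lebI. kern \<sigma> (x - a)) = 1"
  using integral_kern_e_mode[OF sigma_pos, of a 0]
  by simp

lemma integrable_kern: "integrable lebI (\<lambda>x. kern \<sigma> (x - a))"
  by (rule integrable_lebI_bounded[where B = kern_bound]) (auto intro: kern_borel_lebI[OF sigma_pos] simp: kern_abs_le)

lemma doeblin_rate_less_1: "doeblin_rate < 1"
  using normal_density_pos[OF sigma_pos, of 0 1] by (simp add: doeblin_rate_def)

lemma integral_kern_minus: "(LINT x|lebI. kern \<sigma> (x - a) - normal_density 0 \<sigma> 1) = doeblin_rate"
proof -
  have "integrable lebI (\<lambda>x. normal_density 0 \<sigma> 1)" by (rule integrable_lebI_bounded) auto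
  with integrable_kern[of a] show ?thesis by (simp add: integral_kern doeblin_rate_def)
qed

lemma doeblin_rate_nonneg: "0 \<le> doeblin_rate"
proof -
  have "0 \<le> (LINT x|lebI. kern \<sigma> (x - 0) - normal_density 0 \<sigma> 1)"
    using kern_ge[OF sigma_pos] by (intro integral_nonneg_AE AE_I2) auto
  then show ?thesis unfolding integral_kern_minus .
qed

text \<open>The constant part of the kernel annihilates functions of mean zero; what remains is nonnegative and
  has total mass \<open>doeblin_rate\<close>.\<close>

lemma PF_contraction:
  assumes f: "integrable lebI f" and z: "(LINT x|lebI. f x) = 0"
  shows "norm_L1I (PF T \<sigma> f) \<le> doeblin_rate * norm_L1I f"
proof -
  interpret pair_sigma_finite lebI lebI by (rule pair_sigma_finite_lebI)
  note [measurable] = borel_measurable_integrable[OF f]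
  let ?c = "normal_density 0 \<sigma> 1"
  let ?G = "\<lambda>u. kern \<sigma> u - ?c"
  have G: "0 \<le> ?G u" "\<bar>?G u\<bar> \<le> kern_bound" for u
    using kern_ge[OF sigma_pos, of u] kern_abs_le[of u] normal_density_nonneg[of 0 \<sigma> 1] by linarith+
  have iG: "integrable (lebI \<Otimes>\<^sub>M lebI) (\<lambda>(x, y). ?G (x - T y) * cmod (f y))"
    by (rule integrable_bounded_kernel[where B = kern_bound]) (use G f in \<open>measurable, auto\<close>)
  have eq: "PF T \<sigma> f x = kernel_op ?G f x" for x
    unfolding PF_kernel_op kernel_op_def using kernel_op_integrable[OF kern_measurable kern_abs_le f, where x = x] f z
    by (simp add: left_diff_distrib)
  have le: "cmod (PF T \<sigma> f x) \<le> (LINT y|lebI. ?G (x - T y) * cmod (f y))" for x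
  proof -
    have "cmod (kernel_op ?G f x) \<le> (LINT y|lebI. cmod (of_real (?G (x - T y)) * f y))"
      unfolding kernel_op_def by (rule integral_norm_bound)
    also have "\<dots> = (LINT y|lebI. ?G (x - T y) * cmod (f y))"
      unfolding norm_mult norm_of_real using G(1) by (simp only: abs_of_nonneg)
    finally show ?thesis unfolding eq .
  qed
  have "norm_L1I (PF T \<sigma> f) \<le> (LINT x|lebI. (LINT y|lebI. ?G (x - T y) * cmod (f y)))"
    unfolding norm_L1I_def using L2I_integrable[OF PF_L2(1)[OF f]] integrable_fst'[OF iG] le
    by (intro integral_mono) auto
  also have "\<dots> = (LINT y|lebI. (LINT x|lebI. ?G (x - T y) * cmod (f y)))"
    using Fubini_integral[OF iG] by simp
  also have "\<dots> = doeblin_rate * norm_L1I f"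
    by (simp add: integral_kern_minus norm_L1I_def)
  finally show ?thesis .
qed

end


section \<open>Error bound for the Fourier--Galerkin scheme\<close>

context noisy_map
begin

abbreviation Pk :: "nat \<Rightarrow> (real \<Rightarrow> complex) \<Rightarrow> real \<Rightarrow> complex" where
  "Pk k \<equiv> PFk T \<sigma> k"

lemma Pk_eq: "Pk k h = proj k (PF T \<sigma> (proj k h))"
  by (simp add: PFk_def)

lemma proj_integrable: "integrable lebI (proj k h)"
  by (rule L2I_integrable[OF proj_L2I])

lemma norm_L1I_proj_le: "h \<in> L2I \<Longrightarrow> norm_L1I (proj k h) \<le> sqrt 2 * norm_L2I h"
  unfolding norm_L1I_def
  by (rule order_trans[OF L2I_norm1_le[OF proj_L2I] mult_left_mono[OF norm_proj_le]]) auto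

lemma Pk_L2I: "Pk k h \<in> L2I"
  unfolding Pk_eq by (rule proj_L2I)

lemma norm_Pk_le_L1: "norm_L2I (Pk k h) \<le> kern_norm * norm_L1I (proj k h)"
  unfolding Pk_eq
  by (rule order_trans[OF norm_proj_le[OF PF_L2(1)[OF proj_integrable]] PF_L2(2)[OF proj_integrable]])

lemma norm_Pk_le: "h \<in> L2I \<Longrightarrow> norm_L2I (Pk k h) \<le> kern_norm * sqrt 2 * norm_L2I h"
  using order_trans[OF norm_Pk_le_L1 mult_left_mono[OF norm_L1I_proj_le kern_norm_nonneg]] by (simp add: mult.assoc)

lemma integral_Pk: "(LINT x|lebI. Pk k h x) = (LINT x|lebI. h x)"
  unfolding Pk_eq by (simp add: integral_proj integral_PF[OF proj_integrable])

lemma Pk_diff: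
  assumes "integrable lebI f" "integrable lebI g"
  shows "Pk k (\<lambda>x. f x - g x) = (\<lambda>x. Pk k f x - Pk k g x)"
  unfolding Pk_eq proj_diff[OF assms] PF_diff[OF proj_integrable proj_integrable]
  by (rule proj_diff[OF L2I_integrable[OF PF_L2(1)[OF proj_integrable]] L2I_integrable[OF PF_L2(1)[OF proj_integrable]]])

lemma Pk_cmult: "Pk k (\<lambda>x. c * f x) = (\<lambda>x. c * Pk k f x)"
  unfolding Pk_eq proj_cmult PF_cmult ..

lemma Pk_pow_L2I: "h \<in> L2I \<Longrightarrow> (Pk k ^^ i) h \<in> L2I"
  by (cases i) (auto intro: Pk_L2I)

lemma integral_Pk_pow: "(LINT x|lebI. (Pk k ^^ i) h x) = (LINT x|lebI. h x)"
  by (induction i) (simp_all add: integral_Pk)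

lemma Pk_pow_diff:
  assumes "f \<in> L2I" "g \<in> L2I"
  shows "(Pk k ^^ i) (\<lambda>x. f x - g x) = (\<lambda>x. (Pk k ^^ i) f x - (Pk k ^^ i) g x)"
  by (induction i) (simp_all add: Pk_diff L2I_integrable Pk_pow_L2I assms)

lemma Pk_pow_cmult: "(Pk k ^^ i) (\<lambda>x. c * f x) = (\<lambda>x. c * (Pk k ^^ i) f x)"
  by (induction i) (simp_all add: Pk_cmult)

lemma norm_Pk_pow_le: "h \<in> L2I \<Longrightarrow> norm_L2I ((Pk k ^^ i) h) \<le> (kern_norm * sqrt 2) ^ i * norm_L2I h"
proof (induction i)
  case (Suc i)
  have "norm_L2I ((Pk k ^^ Suc i) h) \<le> kern_norm * sqrt 2 * norm_L2I ((Pk k ^^ i) h)"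
    using norm_Pk_le[OF Pk_pow_L2I[OF Suc.prems]] by simp
  also have "\<dots> \<le> kern_norm * sqrt 2 * ((kern_norm * sqrt 2) ^ i * norm_L2I h)"
    using kern_norm_nonneg Suc by (intro mult_left_mono) auto
  finally show ?case by (simp add: mult_ac)
qed simp

lemma U0_L2I: "h \<in> U0 \<Longrightarrow> h \<in> L2I"
  by (simp add: U0_def)

text \<open>A supremum of reals is informative only when the set is bounded above, which this supplies for
  the operator norms \<open>C\<^bsub>k,i\<^esub>\<close>.\<close>

lemma C_const_bdd: "bdd_above ((\<lambda>f. norm_L2I ((Pk k ^^ i) f)) ` {f \<in> U0. norm_L2I f \<le> 1})"
proof (rule bdd_aboveI2)
  fix f assume f: "f \<in> {f \<in> U0. norm_L2I f \<le> 1}"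
  have "norm_L2I ((Pk k ^^ i) f) \<le> (kern_norm * sqrt 2) ^ i * norm_L2I f"
    using f by (intro norm_Pk_pow_le U0_L2I) auto
  also have "\<dots> \<le> (kern_norm * sqrt 2) ^ i * 1"
    using f kern_norm_nonneg by (intro mult_left_mono) auto
  finally show "norm_L2I ((Pk k ^^ i) f) \<le> (kern_norm * sqrt 2) ^ i" by simp
qed

lemma zero_U0: "(\<lambda>_. 0) \<in> {f \<in> U0. norm_L2I f \<le> 1}"
  using const_L2I[of 0] by (simp add: U0_def)

lemma C_const_nonneg: "0 \<le> C_const T \<sigma> k i"
  unfolding C_const_def opnorm_L2I_def
  by (rule cSUP_upper2[OF C_const_bdd zero_U0]) simp

lemma C_const_le:
  assumes "0 \<le> c" "\<And>h. h \<in> U0 \<Longrightarrow> norm_L2I ((Pk k ^^ i) h) \<le> c * norm_L2I h"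
  shows "C_const T \<sigma> k i \<le> c"
  unfolding C_const_def opnorm_L2I_def
proof (rule cSUP_least)
  show "{f \<in> U0. norm_L2I f \<le> 1} \<noteq> {}" using zero_U0 by blast
  fix f assume f: "f \<in> {f \<in> U0. norm_L2I f \<le> 1}"
  have "norm_L2I ((Pk k ^^ i) f) \<le> c * norm_L2I f" using f assms(2) by simp
  also have "\<dots> \<le> c * 1" using f assms(1) by (intro mult_left_mono) auto
  finally show "norm_L2I ((Pk k ^^ i) f) \<le> c" by simp
qed

text \<open>Scaling to the unit ball fails when \<open>h\<close> has norm 0 without being the zero function; then
  the crude bound on the powers applies.\<close>

lemma norm_Pk_pow_le_C_const:
  assumes h: "h \<in> U0"
  shows "norm_L2I ((Pk k ^^ i) h) \<le> C_const T \<sigma> k i * norm_L2I h"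
proof (cases "norm_L2I h = 0")
  case True
  then show ?thesis using norm_Pk_pow_le[OF U0_L2I[OF h], where k = k and i = i] by simp
next
  case False
  define s where "s = norm_L2I h"
  have s: "s > 0" using False norm_L2I_nonneg[of h] unfolding s_def by linarith
  let ?h = "\<lambda>x. of_real (1 / s) * h x"
  have cs: "cmod (of_real (1 / s)) = 1 / s" using s by (simp only: norm_of_real) simp
  have "?h \<in> U0" using h L2I_cmult[of h "of_real (1 / s)"] by (simp add: U0_def)
  moreover have "norm_L2I ?h \<le> 1"
    unfolding norm_L2I_cmult cs using s by (simp add: s_def[symmetric])
  ultimately have "norm_L2I ((Pk k ^^ i) ?h) \<le> C_const T \<sigma> k i"
    unfolding C_const_def opnorm_L2I_def by (intro cSUP_upper C_const_bdd) simp
  also have "norm_L2I ((Pk k ^^ i) ?h) = norm_L2I ((Pk k ^^ i) h) / s"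
    unfolding Pk_pow_cmult norm_L2I_cmult cs by simp
  finally show ?thesis using s by (simp add: s_def[symmetric] field_simps)
qed

lemma norm_L1I_le_sup:
  assumes "f \<in> borel_measurable lebI" "\<And>x. cmod (f x) \<le> B"
  shows "norm_L1I f \<le> 2 * B"
proof -
  have "norm_L1I f \<le> (LINT x|lebI. B)"
    unfolding norm_L1I_def
    by (intro integral_mono integrable_lebI_bounded[where B = "\<bar>B\<bar>"])
       (use assms in \<open>auto intro: order_trans[OF _ abs_ge_self]\<close>)
  then show ?thesis by simp
qed

lemma norm_L1I_triangle:
  assumes "integrable lebI f" "integrable lebI g"
  shows "norm_L1I (\<lambda>x. f x - g x) \<le> norm_L1I f + norm_L1I g"
proof -
  have "norm_L1I (\<lambda>x. f x - g x) \<le> (LINT x|lebI. cmod (f x) + cmod (g x))"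
    unfolding norm_L1I_def using assms by (intro integral_mono) (auto intro: norm_triangle_ineq4)
  with assms show ?thesis by (simp add: norm_L1I_def)
qed

lemma PF_integrable: "integrable lebI f \<Longrightarrow> integrable lebI (PF T \<sigma> f)"
  by (rule L2I_integrable[OF PF_L2(1)])

lemma PF_tail_L1:
  assumes f: "integrable lebI f"
  shows "norm_L1I (\<lambda>x. PF T \<sigma> f x - proj k (PF T \<sigma> f) x) \<le> Gam1 \<sigma> k * norm_L1I f"
proof -
  have "norm_L1I (\<lambda>x. PF T \<sigma> f x - proj k (PF T \<sigma> f) x) \<le> 2 * (Gam1 \<sigma> k / 2 * norm_L1I f)"
    by (rule norm_L1I_le_sup[OF _ PF_tail_sup[OF f]])
       (intro borel_measurable_diff borel_measurable_integrable[OF PF_integrable[OF f]] borel_measurable_integrable[OF proj_integrable])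
  then show ?thesis by simp
qed

text \<open>With \<open>u = f - \<pi>\<^sub>k f\<close> and \<open>P f = f\<close>, the error is \<open>u + \<pi>\<^sub>k P u\<close>. Because \<open>f = P f\<close>, the
  remainder \<open>u\<close> is a truncation error of the operator, small both in \<open>L\<^sup>2\<close> and in \<open>L\<^sup>1\<close>.\<close>

lemma consistency_error:
  assumes f: "integrable lebI f" and fix_f: "PF T \<sigma> f = f" and n1: "norm_L1I f = 1"
  shows "norm_L2I (\<lambda>x. f x - Pk k f x) \<le> Delta \<sigma> k"
proof -
  have fL2: "f \<in> L2I" using PF_L2(1)[OF f] by (simp add: fix_f)
  let ?u = "\<lambda>x. f x - proj k f x"
  have u: "?u \<in> L2I" by (rule L2I_diff(1)[OF fL2 proj_L2I])
  have eq: "(\<lambda>x. f x - Pk k f x) = (\<lambda>x. ?u x + proj k (PF T \<sigma> ?u) x)"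
  proof -
    have "proj k (PF T \<sigma> ?u) = (\<lambda>x. proj k (PF T \<sigma> f) x - Pk k f x)"
      unfolding PF_diff[OF f proj_integrable] Pk_eq
      by (rule proj_diff[OF PF_integrable[OF f] PF_integrable[OF proj_integrable]])
    then show ?thesis by (simp add: fix_f)
  qed
  have "norm_L2I (\<lambda>x. f x - Pk k f x) \<le> norm_L2I ?u + norm_L2I (proj k (PF T \<sigma> ?u))"
    unfolding eq by (rule L2I_add(2)[OF u proj_L2I])
  also have "norm_L2I ?u \<le> Gam \<sigma> k"
    using PF_tail_L2[OF f, of k] by (simp add: fix_f n1)
  also have "norm_L2I (proj k (PF T \<sigma> ?u)) \<le> kern_norm * Gam1 \<sigma> k"
  proof -
    have "norm_L2I (proj k (PF T \<sigma> ?u)) \<le> norm_L2I (PF T \<sigma> ?u)"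
      by (rule norm_proj_le[OF PF_L2(1)[OF L2I_integrable[OF u]]])
    also have "\<dots> \<le> kern_norm * norm_L1I ?u" by (rule PF_L2(2)[OF L2I_integrable[OF u]])
    also have "\<dots> \<le> kern_norm * Gam1 \<sigma> k"
      using PF_tail_L1[OF f, of k] by (intro mult_left_mono kern_norm_nonneg) (simp add: fix_f n1)
    finally show ?thesis .
  qed
  also have "Gam \<sigma> k + kern_norm * Gam1 \<sigma> k \<le> Delta \<sigma> k"
    using mult_nonneg_nonneg[OF Gam_nonneg[OF sigma_pos, of k] Gam1_nonneg[OF sigma_pos, of k]]
    unfolding Delta_def kern_norm_def by (simp add: algebra_simps)
  finally show ?thesis by simp
qed

text \<open>Telescoping keeps all terms within mean-zero functions, where the powers of \<open>P\<^sub>k\<close> are controlled by the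
  \<open>C\<^bsub>k,i\<^esub>\<close>.\<close>

lemma galerkin_error:
  assumes f: "integrable lebI f" and fix_f: "PF T \<sigma> f = f" and n1: "norm_L1I f = 1"
    and If: "(LINT x|lebI. f x) = 1"
    and g: "g \<in> L2I" "(LINT x|lebI. g x) = 1" and C: "C_const T \<sigma> k n < 1"
  shows "norm_L2I (\<lambda>x. f x - g x) \<le> Err T \<sigma> k n g"
proof -
  have fL2: "f \<in> L2I" using PF_L2(1)[OF f] by (simp add: fix_f)
  let ?d = "\<lambda>x. f x - g x"
  let ?e = "\<lambda>x. ?d x - Pk k ?d x"
  have d: "?d \<in> L2I" by (rule L2I_diff(1)[OF fL2 g(1)])
  have d0: "?d \<in> U0" using d L2I_integrable[OF fL2] L2I_integrable[OF g(1)] by (simp add: U0_def If g)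
  have e: "?e \<in> L2I" by (rule L2I_diff(1)[OF d Pk_L2I])
  have e0: "?e \<in> U0"
    using e L2I_integrable[OF d] L2I_integrable[OF Pk_L2I] by (simp add: U0_def integral_Pk)
  have tele: "(\<lambda>x. \<Sum>i<m. (Pk k ^^ i) ?e x) = (\<lambda>x. ?d x - (Pk k ^^ m) ?d x)" for m
  proof (induction m)
    case (Suc m)
    have "(Pk k ^^ m) ?e = (\<lambda>x. (Pk k ^^ m) ?d x - (Pk k ^^ Suc m) ?d x)"
      unfolding Pk_pow_diff[OF d Pk_L2I] funpow_Suc_right o_def ..
    with Suc show ?case by (simp add: fun_eq_iff)
  qed simp
  have ne: "norm_L2I ?e \<le> Delta \<sigma> k + norm_L2I (\<lambda>x. Pk k g x - g x)"
  proof -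
    have "?e = (\<lambda>x. (f x - Pk k f x) + (Pk k g x - g x))"
      unfolding Pk_diff[OF f L2I_integrable[OF g(1)]] by (simp add: fun_eq_iff)
    then have "norm_L2I ?e \<le> norm_L2I (\<lambda>x. f x - Pk k f x) + norm_L2I (\<lambda>x. Pk k g x - g x)"
      using L2I_add(2)[OF L2I_diff(1)[OF fL2 Pk_L2I] L2I_diff(1)[OF Pk_L2I g(1)]] by simp
    with consistency_error[OF f fix_f n1, of k] show ?thesis by linarith
  qed
  have "?d = (\<lambda>x. (Pk k ^^ n) ?d x + (\<Sum>i<n. (Pk k ^^ i) ?e x))"
    using tele[of n] by (simp add: fun_eq_iff)
  then have "norm_L2I ?d = norm_L2I (\<lambda>x. (Pk k ^^ n) ?d x + (\<Sum>i<n. (Pk k ^^ i) ?e x))"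
    by (rule arg_cong)
  also have "\<dots> \<le> norm_L2I ((Pk k ^^ n) ?d) + norm_L2I (\<lambda>x. \<Sum>i<n. (Pk k ^^ i) ?e x)"
    by (intro L2I_add(2) L2I_sum(1) Pk_pow_L2I d e) simp
  also have "norm_L2I ((Pk k ^^ n) ?d) \<le> C_const T \<sigma> k n * norm_L2I ?d"
    by (rule norm_Pk_pow_le_C_const[OF d0])
  also have "norm_L2I (\<lambda>x. \<Sum>i<n. (Pk k ^^ i) ?e x) \<le> (\<Sum>i<n. norm_L2I ((Pk k ^^ i) ?e))"
    by (rule L2I_sum(2)) (auto intro: Pk_pow_L2I e)
  also have "\<dots> \<le> (\<Sum>i<n. C_const T \<sigma> k i * (Delta \<sigma> k + norm_L2I (\<lambda>x. Pk k g x - g x)))"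
    by (intro sum_mono order_trans[OF norm_Pk_pow_le_C_const[OF e0]] mult_left_mono ne C_const_nonneg)
  finally have "(1 - C_const T \<sigma> k n) * norm_L2I ?d \<le>
      (\<Sum>i<n. C_const T \<sigma> k i * (Delta \<sigma> k + norm_L2I (\<lambda>x. Pk k g x - g x)))"
    by (simp add: algebra_simps)
  then show ?thesis using C unfolding Err_def by (simp add: field_simps)
qed

lemma norm_L1I_proj_PF:
  assumes w: "integrable lebI w" "(LINT x|lebI. w x) = 0"
  shows "norm_L1I (proj k (PF T \<sigma> w)) \<le> (doeblin_rate + Gam1 \<sigma> k) * norm_L1I w"
proof -
  have "norm_L1I (proj k (PF T \<sigma> w)) = norm_L1I (\<lambda>x. PF T \<sigma> w x - (PF T \<sigma> w x - proj k (PF T \<sigma> w) x))"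
    by simp
  also have "\<dots> \<le> norm_L1I (PF T \<sigma> w) + norm_L1I (\<lambda>x. PF T \<sigma> w x - proj k (PF T \<sigma> w) x)"
    by (intro norm_L1I_triangle PF_integrable Bochner_Integration.integrable_diff proj_integrable w)
  also have "\<dots> \<le> doeblin_rate * norm_L1I w + Gam1 \<sigma> k * norm_L1I w"
    by (intro add_mono PF_contraction PF_tail_L1 w)
  finally show ?thesis by (simp add: algebra_simps)
qed

text \<open>The contraction is measured in \<open>L\<^sup>1\<close>, the norm of the Doeblin bound, although the powers are
  eventually needed in \<open>L\<^sup>2\<close>; idempotence of \<open>\<pi>\<^sub>k\<close> lets the projection absorb the inner one.\<close>

lemma norm_L1I_proj_Pk_pow:
  assumes h: "h \<in> U0"
  shows "norm_L1I (proj k ((Pk k ^^ i) h)) \<le> (doeblin_rate + Gam1 \<sigma> k) ^ i * (sqrt 2 * norm_L2I h)"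
proof (induction i)
  case 0
  then show ?case using norm_L1I_proj_le[OF U0_L2I[OF h]] by simp
next
  case (Suc i)
  let ?w = "proj k ((Pk k ^^ i) h)"
  have "norm_L1I (proj k ((Pk k ^^ Suc i) h)) = norm_L1I (proj k (PF T \<sigma> ?w))"
    by (simp add: Pk_eq proj_proj)
  also have "\<dots> \<le> (doeblin_rate + Gam1 \<sigma> k) * norm_L1I ?w"
    using h by (intro norm_L1I_proj_PF proj_integrable) (simp add: integral_proj integral_Pk_pow U0_def)
  also have "\<dots> \<le> (doeblin_rate + Gam1 \<sigma> k) * ((doeblin_rate + Gam1 \<sigma> k) ^ i * (sqrt 2 * norm_L2I h))"
    using Suc doeblin_rate_nonneg Gam1_nonneg[OF sigma_pos, of k] by (intro mult_left_mono) auto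
  finally show ?case by (simp add: mult_ac)
qed

lemma C_const_Suc_le: "C_const T \<sigma> k (Suc i) \<le> kern_norm * sqrt 2 * (doeblin_rate + Gam1 \<sigma> k) ^ i"
proof (rule C_const_le)
  show "0 \<le> kern_norm * sqrt 2 * (doeblin_rate + Gam1 \<sigma> k) ^ i"
    using kern_norm_nonneg doeblin_rate_nonneg Gam1_nonneg[OF sigma_pos, of k] by simp
  fix h assume h: "h \<in> U0"
  have "norm_L2I ((Pk k ^^ Suc i) h) \<le> kern_norm * norm_L1I (proj k ((Pk k ^^ i) h))"
    using norm_Pk_le_L1 by simp
  also have "\<dots> \<le> kern_norm * ((doeblin_rate + Gam1 \<sigma> k) ^ i * (sqrt 2 * norm_L2I h))"
    by (intro mult_left_mono norm_L1I_proj_Pk_pow h kern_norm_nonneg)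
  finally show "norm_L2I ((Pk k ^^ Suc i) h) \<le> kern_norm * sqrt 2 * (doeblin_rate + Gam1 \<sigma> k) ^ i * norm_L2I h"
    by (simp add: mult_ac)
qed

lemma C_const_0_le: "C_const T \<sigma> k 0 \<le> 1"
  by (rule C_const_le) auto

lemma Delta_tendsto: "Delta \<sigma> \<longlonglongrightarrow> 0"
proof -
  have "(\<lambda>k. Gam \<sigma> k * (1 + Gam1 \<sigma> k) + norm_rho \<sigma> * sqrt (coth (1 / (2 * \<sigma>\<^sup>2))) * Gam1 \<sigma> k) \<longlonglongrightarrow>
     0 * (1 + 0) + norm_rho \<sigma> * sqrt (coth (1 / (2 * \<sigma>\<^sup>2))) * 0"
    by (intro tendsto_intros Gam_tendsto Gam1_tendsto sigma_pos)
  then show ?thesis by (simp add: Delta_def [abs_def])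
qed

text \<open>The number \<open>n\<close> of iterations is fixed first, from the contraction rate. After that \<open>k\<close> alone is
  increased, which leaves the sum of the \<open>C\<^bsub>k,i\<^esub>\<close> bounded while \<open>\<Delta>\<^sub>k\<close> and the residual of \<open>\<pi>\<^sub>k f\<close> vanish.\<close>

lemma Err_arbitrarily_small:
  assumes f: "integrable lebI f" and fix_f: "PF T \<sigma> f = f" and n1: "norm_L1I f = 1"
    and If: "(LINT x|lebI. f x) = 1" and \<eta>: "\<eta> > 0"
  shows "\<exists>k n g. C_const T \<sigma> k n < 1 \<and> trig_poly k g \<and> (LINT y|lebI. g y) = 1 \<and> Err T \<sigma> k n g < \<eta>"
proof -
  \<comment> \<open>a rate strictly between the Doeblin rate and 1 that serves all large \<open>k\<close>\<close>
  define r where "r = (1 + doeblin_rate) / 2"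
  have r: "0 \<le> r" "r < 1" using doeblin_rate_nonneg doeblin_rate_less_1 by (auto simp: r_def)
  define b where "b = kern_norm * sqrt 2"
  have b: "0 \<le> b" using kern_norm_nonneg by (simp add: b_def)
  have "(\<lambda>i. b * r ^ i) \<longlonglongrightarrow> b * 0"
    using r by (intro tendsto_intros LIMSEQ_power_zero) auto
  then have "\<forall>\<^sub>F i in sequentially. b * r ^ i < 1 / 2" by (rule order_tendstoD) simp
  then obtain m where m: "b * r ^ m < 1 / 2" by (auto simp: eventually_sequentially)
  define n where "n = Suc m"
  define D where "D = (\<lambda>k. Delta \<sigma> k + kern_norm * Gam1 \<sigma> k)"
  have "(\<lambda>k. 2 * (real n * (1 + b) * D k)) \<longlonglongrightarrow> 2 * (real n * (1 + b) * (0 + kern_norm * 0))"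
    unfolding D_def by (intro tendsto_intros Delta_tendsto Gam1_tendsto sigma_pos)
  then have "\<forall>\<^sub>F k in sequentially. 2 * (real n * (1 + b) * D k) < \<eta>"
    by (rule order_tendstoD) (use \<eta> in simp)
  moreover have "\<forall>\<^sub>F k in sequentially. Gam1 \<sigma> k < (1 - doeblin_rate) / 2"
    by (rule order_tendstoD[OF Gam1_tendsto[OF sigma_pos]]) (use doeblin_rate_less_1 in simp)
  ultimately have "\<forall>\<^sub>F k in sequentially. 2 * (real n * (1 + b) * D k) < \<eta> \<and> Gam1 \<sigma> k < (1 - doeblin_rate) / 2"
    by (rule eventually_conj)
  then obtain k where k: "2 * (real n * (1 + b) * D k) < \<eta>" "Gam1 \<sigma> k < (1 - doeblin_rate) / 2"
    by (auto simp: eventually_sequentially)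
  have rk: "0 \<le> doeblin_rate + Gam1 \<sigma> k" "doeblin_rate + Gam1 \<sigma> k \<le> r"
    using k(2) doeblin_rate_nonneg Gam1_nonneg[OF sigma_pos, of k] by (auto simp: r_def field_simps)
  have CS: "C_const T \<sigma> k (Suc i) \<le> b * r ^ i" for i
    using order_trans[OF C_const_Suc_le mult_left_mono[OF power_mono[OF rk(2) rk(1)] b[unfolded b_def]]] by (simp add: b_def)
  have C1: "C_const T \<sigma> k i \<le> 1 + b" for i
  proof (cases i)
    case 0 then show ?thesis using C_const_0_le[of k] b by simp
  next
    case (Suc l)
    have "b * r ^ l \<le> b * 1" using r b by (intro mult_left_mono power_le_one) auto
    with CS[of l] Suc show ?thesis by simp
  qed
  have Cn: "C_const T \<sigma> k n < 1 / 2" using CS[of m] m by (simp add: n_def)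
  let ?g = "proj k f"
  have fL2: "f \<in> L2I" using PF_L2(1)[OF f] by (simp add: fix_f)
  let ?u = "\<lambda>x. f x - proj k f x"
  have u: "?u \<in> L2I" by (rule L2I_diff(1)[OF fL2 proj_L2I])
  have res: "norm_L2I (\<lambda>x. Pk k ?g x - ?g x) \<le> kern_norm * Gam1 \<sigma> k"
  proof -
    have "proj k (PF T \<sigma> ?u) = (\<lambda>x. ?g x - Pk k ?g x)"
      unfolding PF_diff[OF f proj_integrable] Pk_eq proj_proj fix_f
      by (rule proj_diff[OF f PF_integrable[OF proj_integrable]])
    then have "norm_L2I (\<lambda>x. Pk k ?g x - ?g x) = norm_L2I (proj k (PF T \<sigma> ?u))"
      by (simp add: norm_L2I_def norm_minus_commute)
    also have "\<dots> \<le> norm_L2I (PF T \<sigma> ?u)"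
      by (rule norm_proj_le[OF PF_L2(1)[OF L2I_integrable[OF u]]])
    also have "\<dots> \<le> kern_norm * norm_L1I ?u" by (rule PF_L2(2)[OF L2I_integrable[OF u]])
    also have "\<dots> \<le> kern_norm * Gam1 \<sigma> k"
      using PF_tail_L1[OF f, of k] by (intro mult_left_mono kern_norm_nonneg) (simp add: fix_f n1)
    finally show ?thesis .
  qed
  let ?R = "Delta \<sigma> k + norm_L2I (\<lambda>x. Pk k ?g x - ?g x)"
  have Del: "0 \<le> Delta \<sigma> k"
    by (rule order_trans[OF norm_L2I_nonneg consistency_error[OF f fix_f n1]])
  have R: "0 \<le> ?R" "?R \<le> D k" using res Del by (simp_all add: D_def)
  have "(\<Sum>i<n. C_const T \<sigma> k i * ?R) \<le> (\<Sum>i<n. (1 + b) * D k)"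
    using C1 R b by (intro sum_mono mult_mono) auto
  then have S: "(\<Sum>i<n. C_const T \<sigma> k i * ?R) \<le> real n * (1 + b) * D k" by (simp add: mult.assoc)
  have S0: "0 \<le> (\<Sum>i<n. C_const T \<sigma> k i * ?R)" using R C_const_nonneg by (intro sum_nonneg mult_nonneg_nonneg) auto
  have "1 / (1 - C_const T \<sigma> k n) \<le> 2" using Cn by (simp add: field_simps)
  then have "Err T \<sigma> k n ?g \<le> 2 * (real n * (1 + b) * D k)"
    unfolding Err_def using S S0 by (intro mult_mono) auto
  with k(1) have "Err T \<sigma> k n ?g < \<eta>" by simp
  moreover have "(LINT y|lebI. ?g y) = 1" by (simp add: integral_proj If)
  moreover have "C_const T \<sigma> k n < 1" using Cn by simp
  ultimately show ?thesis using trig_poly_proj by blast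
qed

end


section \<open>The invariant density\<close>

context noisy_map
begin

lemma kern_nonneg: "0 \<le> kern \<sigma> u"
  by (rule less_imp_le[OF kern_pos[OF sigma_pos]])

lemma PF_of_real: "PF T \<sigma> (\<lambda>x. of_real (g x)) x = of_real (LINT y|lebI. kern \<sigma> (x - T y) * g y)"
  unfolding PF_kernel_op kernel_op_def by (simp flip: of_real_mult)

definition density_iter :: "nat \<Rightarrow> real \<Rightarrow> complex" where
  "density_iter n = (PF T \<sigma> ^^ n) (\<lambda>_. 1 / 2)"

lemma density_iter_Suc: "density_iter (Suc n) = PF T \<sigma> (density_iter n)"
  by (simp add: density_iter_def)

lemma density_iter_nonneg: "density_iter n x = of_real (Re (density_iter n x)) \<and> 0 \<le> Re (density_iter n x)"
proof (induction n arbitrary: x)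
  case (Suc n)
  let ?g = "\<lambda>y. Re (density_iter n y)"
  have "density_iter n = (\<lambda>y. of_real (?g y))" using Suc by (intro ext) blast
  then have "density_iter (Suc n) x = PF T \<sigma> (\<lambda>y. of_real (?g y)) x" unfolding density_iter_Suc by (rule arg_cong)
  also have "\<dots> = of_real (LINT y|lebI. kern \<sigma> (x - T y) * ?g y)" by (rule PF_of_real)
  finally have eq: "density_iter (Suc n) x = of_real (LINT y|lebI. kern \<sigma> (x - T y) * ?g y)" .
  have "0 \<le> (LINT y|lebI. kern \<sigma> (x - T y) * ?g y)"
    using Suc kern_nonneg by (intro integral_nonneg_AE AE_I2 mult_nonneg_nonneg) auto
  then show ?case unfolding eq by simp
qed (simp add: density_iter_def)

lemma density_iter_props:
  "integrable lebI (density_iter n) \<and> (LINT x|lebI. density_iter n x) = 1 \<and> density_iter n \<in> borel_measurable borel"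
proof (induction n)
  case 0
  have d0: "density_iter 0 = (\<lambda>_. 1 / 2)" by (simp add: density_iter_def)
  show ?case
    unfolding d0
  proof (intro conjI)
    show "integrable lebI (\<lambda>_. 1 / 2 :: complex)" by (rule integrable_lebI_bounded[where B = 1]) auto
    show "(LINT x|lebI. 1 / 2 :: complex) = 1" by (simp add: scaleR_conv_of_real)
  qed simp
qed (simp add: density_iter_Suc PF_integrable integral_PF PF_borel)

lemma density_iter_integrable: "integrable lebI (density_iter n)" and integral_density_iter: "(LINT x|lebI. density_iter n x) = 1"
  and density_iter_borel: "density_iter n \<in> borel_measurable borel"
  using density_iter_props by auto

lemma norm_L1I_density:
  assumes "\<And>x. x \<in> {-1..1} \<Longrightarrow> 0 \<le> g x" "(LINT x|lebI. complex_of_real (g x)) = 1"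
  shows "norm_L1I (\<lambda>x. complex_of_real (g x)) = 1"
proof -
  have "norm_L1I (\<lambda>x. complex_of_real (g x)) = (LINT x|lebI. g x)"
    unfolding norm_L1I_def using assms(1) by (intro Bochner_Integration.integral_cong) auto
  also have "complex_of_real (LINT x|lebI. g x) = 1" using assms(2) by simp
  then have "(LINT x|lebI. g x) = 1" by simp
  finally show ?thesis .
qed

lemma norm_L1I_density_iter: "norm_L1I (density_iter n) = 1"
proof -
  have eq: "density_iter n = (\<lambda>x. of_real (Re (density_iter n x)))" using density_iter_nonneg by (intro ext) blast
  have "norm_L1I (\<lambda>x. of_real (Re (density_iter n x))) = 1"
    by (rule norm_L1I_density) (use density_iter_nonneg[of n] eq integral_density_iter[of n] in auto)
  then show ?thesis unfolding eq[symmetric] .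
qed

lemma density_iter_diff_Suc:
  "(\<lambda>x. density_iter (Suc (Suc n)) x - density_iter (Suc n) x) = PF T \<sigma> (\<lambda>x. density_iter (Suc n) x - density_iter n x)"
  unfolding PF_diff[OF density_iter_integrable density_iter_integrable] density_iter_Suc[symmetric] ..

text \<open>Consecutive iterates differ by functions of mean zero, so the contraction applies to the increments.\<close>

lemma density_iter_step: "norm_L1I (\<lambda>x. density_iter (Suc n) x - density_iter n x) \<le> 2 * doeblin_rate ^ n"
proof (induction n)
  case 0
  show ?case using norm_L1I_triangle[OF density_iter_integrable density_iter_integrable, of 1 0] by (simp add: norm_L1I_density_iter)
next
  case (Suc n)
  have "norm_L1I (\<lambda>x. density_iter (Suc (Suc n)) x - density_iter (Suc n) x) = norm_L1I (PF T \<sigma> (\<lambda>x. density_iter (Suc n) x - density_iter n x))"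
    unfolding density_iter_diff_Suc ..
  also have "\<dots> \<le> doeblin_rate * norm_L1I (\<lambda>x. density_iter (Suc n) x - density_iter n x)"
    using density_iter_integrable integral_density_iter by (intro PF_contraction) auto
  also have "\<dots> \<le> doeblin_rate * (2 * doeblin_rate ^ n)" using Suc doeblin_rate_nonneg by (intro mult_left_mono) auto
  finally show ?case by (simp add: mult_ac)
qed

text \<open>One more application of the operator turns \<open>L\<^sup>1\<close> smallness into smallness at every point, so the
  limit density is defined pointwise and satisfies the fixed point equation everywhere.\<close>

lemma density_iter_convergent: "convergent (\<lambda>n. density_iter n x)"
proof -
  have "norm (density_iter (Suc (Suc n)) x - density_iter (Suc n) x) \<le> kern_bound * 2 * doeblin_rate ^ n" for n
  proof -
    have "norm (density_iter (Suc (Suc n)) x - density_iter (Suc n) x) = cmod (PF T \<sigma> (\<lambda>x. density_iter (Suc n) x - density_iter n x) x)"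
      unfolding density_iter_diff_Suc[symmetric] ..
    also have "\<dots> \<le> kern_bound * norm_L1I (\<lambda>x. density_iter (Suc n) x - density_iter n x)"
      by (intro PF_sup Bochner_Integration.integrable_diff density_iter_integrable)
    also have "\<dots> \<le> kern_bound * (2 * doeblin_rate ^ n)" using density_iter_step kern_bound_pos by (intro mult_left_mono) auto
    finally show ?thesis by (simp add: mult.assoc)
  qed
  moreover have "summable (\<lambda>n. kern_bound * 2 * doeblin_rate ^ n)"
    using doeblin_rate_nonneg doeblin_rate_less_1 by (intro summable_mult summable_geometric) auto
  ultimately have "summable (\<lambda>n. density_iter (Suc (Suc n)) x - density_iter (Suc n) x)"
    by (rule summable_comparison_test'[rotated])
  then have "convergent (\<lambda>m. density_iter (Suc m) x - density_iter (Suc 0) x)"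
    unfolding summable_iff_convergent sum_lessThan_telescope[of "\<lambda>n. density_iter (Suc n) x"] .
  then have "convergent (\<lambda>m. (density_iter (Suc m) x - density_iter (Suc 0) x) + density_iter (Suc 0) x)"
    by (intro convergent_add convergent_const)
  then have "convergent (\<lambda>m. density_iter (Suc m) x)" by simp
  then show ?thesis by (rule convergent_Suc_iff[of "\<lambda>n. density_iter n x", THEN iffD1])
qed

lemma invariant_density_exists:
  "\<exists>f :: real \<Rightarrow> real. f \<in> borel_measurable borel \<and> (\<forall>x. 0 \<le> f x) \<and> integrable lebI f \<and>
     (LINT x|lebI. f x) = 1 \<and> PF T \<sigma> (\<lambda>x. of_real (f x)) = (\<lambda>x. of_real (f x))"
proof -
  define F where "F = (\<lambda>x. lim (\<lambda>n. density_iter n x))"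
  have lim: "(\<lambda>n. density_iter n x) \<longlonglongrightarrow> F x" for x
    using density_iter_convergent[of x] by (simp add: F_def convergent_LIMSEQ_iff)
  have lim': "(\<lambda>n. density_iter (Suc n) x) \<longlonglongrightarrow> F x" for x using LIMSEQ_Suc[OF lim] .
  have bnd: "cmod (density_iter (Suc n) x) \<le> kern_bound" for n x
    using PF_sup[OF density_iter_integrable, of n x] by (simp add: density_iter_Suc norm_L1I_density_iter)
  have F_borel [measurable]: "F \<in> borel_measurable borel"
    by (rule borel_measurable_LIMSEQ_metric[OF _ lim]) (rule density_iter_borel)
  have [measurable]: "density_iter n \<in> borel_measurable borel" for n by (rule density_iter_borel)
  have Mi: "integrable lebI (\<lambda>_. c :: real)" for c by (rule integrable_lebI_bounded[where B = "\<bar>c\<bar>"]) auto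
  have FB: "cmod (F x) \<le> kern_bound" for x
    using bnd by (intro LIMSEQ_le_const2[OF tendsto_norm[OF lim']]) auto
  have Fi: "integrable lebI F" by (rule integrable_lebI_bounded[OF _ FB]) measurable
  have "(\<lambda>n. LINT x|lebI. density_iter (Suc n) x) \<longlonglongrightarrow> (LINT x|lebI. F x)"
    by (rule integral_dominated_convergence[where w = "\<lambda>_. kern_bound"]) (auto simp: bnd lim' Mi intro: measurable_lebI_borel)
  then have F1: "(LINT x|lebI. F x) = 1"
    unfolding integral_density_iter by (simp add: LIMSEQ_const_iff)
  have FF: "PF T \<sigma> F x = F x" for x
  proof (rule LIMSEQ_unique)
    show "(\<lambda>n. density_iter (Suc (Suc n)) x) \<longlonglongrightarrow> F x" using LIMSEQ_Suc[OF lim'] .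
    show "(\<lambda>n. density_iter (Suc (Suc n)) x) \<longlonglongrightarrow> PF T \<sigma> F x"
      unfolding density_iter_Suc[of "Suc _"] PF_kernel_op kernel_op_def
    proof (rule integral_dominated_convergence[where w = "\<lambda>_. kern_bound * kern_bound"])
      show "AE y in lebI. (\<lambda>n. of_real (kern \<sigma> (x - T y)) * density_iter (Suc n) y) \<longlonglongrightarrow> of_real (kern \<sigma> (x - T y)) * F y"
        by (intro AE_I2 tendsto_intros lim')
      show "AE y in lebI. norm (of_real (kern \<sigma> (x - T y)) * density_iter (Suc n) y) \<le> kern_bound * kern_bound" for n
        using kern_abs_le bnd kern_bound_pos by (intro AE_I2) (auto simp: norm_mult intro!: mult_mono)
      show "integrable lebI (\<lambda>_. kern_bound * kern_bound)" by (rule Mi)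
    qed measurable
  qed
  have Freal: "F x = of_real (Re (F x))" "0 \<le> Re (F x)" for x
  proof -
    have "Im (density_iter n x) = Im (of_real (Re (density_iter n x)))" for n using density_iter_nonneg[of n x] by (rule arg_cong[OF conjunct1])
    then have "Im (density_iter n x) = 0" for n by simp
    moreover have "(\<lambda>n. Im (density_iter n x)) \<longlonglongrightarrow> Im (F x)" by (intro tendsto_Im lim)
    ultimately have "Im (F x) = 0" by (simp add: LIMSEQ_const_iff)
    then show "F x = of_real (Re (F x))" by (simp add: complex_eq_iff)
    have "(\<lambda>n. Re (density_iter n x)) \<longlonglongrightarrow> Re (F x)" by (intro tendsto_Re lim)
    then show "0 \<le> Re (F x)" by (rule LIMSEQ_le_const) (use density_iter_nonneg in blast)
  qed
  have eq: "(\<lambda>x. complex_of_real (Re (F x))) = F" using Freal(1) by (simp add: fun_eq_iff)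
  show ?thesis
  proof (intro exI[of _ "\<lambda>x. Re (F x)"] conjI allI)
    show "PF T \<sigma> (\<lambda>x. of_real (Re (F x))) = (\<lambda>x. of_real (Re (F x)))"
      unfolding eq by (rule ext) (rule FF)
    show "(LINT x|lebI. Re (F x)) = 1" using F1 Fi by simp
    show "integrable lebI (\<lambda>x. Re (F x))" using Fi by simp
  qed (use Freal in auto)
qed

lemma T_measurable: "sets \<nu> = sets (restrict_space borel {-1..1}) \<Longrightarrow> T \<in> borel_measurable \<nu>"
  using T_meas by (subst measurable_cong_sets[of _ lebI]) (auto simp: sets_lebI)

text \<open>The law after one step has a density, whatever the law before it was.\<close>

lemma distr_step:
  assumes "prob_space \<nu>" and sets: "sets \<nu> = sets (restrict_space borel {-1..1})"
  shows "distr (\<nu> \<Otimes>\<^sub>M gauss \<sigma>) (restrict_space borel {-1..1}) (\<lambda>(x, w). wrap (T x + w)) =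
    density lebI (\<lambda>z. \<integral>\<^sup>+x. ennreal (kern \<sigma> (z - T x)) \<partial>\<nu>)"
proof (rule measure_eqI)
  interpret \<nu>: prob_space \<nu> by fact
  interpret g: prob_space "gauss \<sigma>" by (rule prob_space_gauss[OF sigma_pos])
  interpret lebI: finite_measure lebI by (rule finite_measure_lebI)
  interpret pair_sigma_finite \<nu> lebI ..
  have [measurable]: "T \<in> borel_measurable \<nu>" by (rule T_measurable[OF sets])
  have m: "(\<lambda>(x, w). wrap (T x + w)) \<in> \<nu> \<Otimes>\<^sub>M gauss \<sigma> \<rightarrow>\<^sub>M restrict_space borel {-1..1}"
  proof (rule measurable_restrict_space2)
    show "(\<lambda>(x, w). wrap (T x + w)) \<in> space (\<nu> \<Otimes>\<^sub>M gauss \<sigma>) \<rightarrow> {- 1..1}"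
      using wrap_range by (auto simp: less_imp_le)
  qed measurable
  fix A assume "A \<in> sets (distr (\<nu> \<Otimes>\<^sub>M gauss \<sigma>) (restrict_space borel {-1..1}) (\<lambda>(x, w). wrap (T x + w)))"
  then have A: "A \<in> sets (restrict_space borel {-1..1::real})" by simp
  then have [measurable]: "A \<in> sets borel" by (auto simp: sets_restrict_space)
  have [measurable]: "A \<in> sets lebI" using A by (simp add: sets_lebI)
  have "emeasure (distr (\<nu> \<Otimes>\<^sub>M gauss \<sigma>) (restrict_space borel {-1..1}) (\<lambda>(x, w). wrap (T x + w))) A =
      (\<integral>\<^sup>+p. indicator A (case p of (x, w) \<Rightarrow> wrap (T x + w)) \<partial>(\<nu> \<Otimes>\<^sub>M gauss \<sigma>))"
    using m A by (subst nn_integral_indicator[symmetric], simp, subst nn_integral_distr) auto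
  also have "\<dots> = (\<integral>\<^sup>+x. \<integral>\<^sup>+w. indicator A (wrap (T x + w)) \<partial>gauss \<sigma> \<partial>\<nu>)"
    by (subst g.nn_integral_fst[symmetric]) auto
  also have "\<dots> = (\<integral>\<^sup>+x. \<integral>\<^sup>+z. ennreal (kern \<sigma> (z - T x)) * indicator A z \<partial>lebI \<partial>\<nu>)"
    by (intro nn_integral_cong nn_integral_gauss_wrap sigma_pos) simp
  also have "\<dots> = (\<integral>\<^sup>+z. \<integral>\<^sup>+x. ennreal (kern \<sigma> (z - T x)) * indicator A z \<partial>\<nu> \<partial>lebI)"
    by (rule Fubini'[symmetric]) measurable
  also have "\<dots> = (\<integral>\<^sup>+z. (\<integral>\<^sup>+x. ennreal (kern \<sigma> (z - T x)) \<partial>\<nu>) * indicator A z \<partial>lebI)"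
    by (intro nn_integral_cong nn_integral_multc) measurable
  also have "\<dots> = emeasure (density lebI (\<lambda>z. \<integral>\<^sup>+x. ennreal (kern \<sigma> (z - T x)) \<partial>\<nu>)) A"
    by (subst emeasure_density) auto
  finally show "emeasure (distr (\<nu> \<Otimes>\<^sub>M gauss \<sigma>) (restrict_space borel {-1..1}) (\<lambda>(x, w). wrap (T x + w))) A =
     emeasure (density lebI (\<lambda>z. \<integral>\<^sup>+x. ennreal (kern \<sigma> (z - T x)) \<partial>\<nu>)) A" .
qed (simp add: sets_lebI)

lemma nn_integral_kern_density:
  assumes [measurable]: "f \<in> borel_measurable borel" and "\<And>x. 0 \<le> f x" and i: "integrable lebI f"
  shows "(\<integral>\<^sup>+x. ennreal (kern \<sigma> (z - T x)) \<partial>density lebI (\<lambda>x. ennreal (f x))) = ennreal (LINT x|lebI. kern \<sigma> (z - T x) * f x)"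
proof -
  have "integrable lebI (\<lambda>x. complex_of_real (f x))" using i by simp
  from kernel_op_integrable[OF kern_measurable kern_abs_le this, where x = z]
  have "integrable lebI (\<lambda>x. Re (complex_of_real (kern \<sigma> (z - T x)) * complex_of_real (f x)))" by (rule integrable_Re)
  then have i': "integrable lebI (\<lambda>x. kern \<sigma> (z - T x) * f x)" by simp
  have "(\<integral>\<^sup>+x. ennreal (kern \<sigma> (z - T x)) \<partial>density lebI (\<lambda>x. ennreal (f x))) = (\<integral>\<^sup>+x. ennreal (kern \<sigma> (z - T x) * f x) \<partial>lebI)"
    using assms(2) kern_nonneg
    by (subst nn_integral_density) (auto simp: ennreal_mult mult.commute)
  also have "\<dots> = ennreal (LINT x|lebI. kern \<sigma> (z - T x) * f x)"
    using assms(2) kern_nonneg by (intro nn_integral_eq_integral i' AE_I2 mult_nonneg_nonneg) auto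
  finally show ?thesis .
qed

lemma prob_space_density_lebI:
  assumes "f \<in> borel_measurable borel" "\<And>x. 0 \<le> f x" "integrable lebI f" "(LINT x|lebI. f x) = 1"
  shows "prob_space (density lebI (\<lambda>x. ennreal (f x)))"
proof (rule prob_spaceI)
  have "emeasure (density lebI (\<lambda>x. ennreal (f x))) (space (density lebI (\<lambda>x. ennreal (f x)))) = (\<integral>\<^sup>+x. ennreal (f x) \<partial>lebI)"
    using assms(1) by (subst emeasure_density) (auto intro!: measurable_lebI_borel nn_integral_cong simp: sets.top[of lebI, simplified])
  also have "\<dots> = 1" using assms by (subst nn_integral_eq_integral) auto
  finally show "emeasure (density lebI (\<lambda>x. ennreal (f x))) (space (density lebI (\<lambda>x. ennreal (f x)))) = 1" .
qed

lemma stationary_density: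
  assumes "f \<in> borel_measurable borel" "\<And>x. 0 \<le> f x" "integrable lebI f" "(LINT x|lebI. f x) = 1"
    and fix_f: "PF T \<sigma> (\<lambda>x. of_real (f x)) = (\<lambda>x. of_real (f x))"
  shows "stationary T \<sigma> (density lebI (\<lambda>x. ennreal (f x)))"
proof -
  have P: "prob_space (density lebI (\<lambda>x. ennreal (f x)))" by (rule prob_space_density_lebI[OF assms(1-4)])
  have S: "sets (density lebI (\<lambda>x. ennreal (f x))) = sets (restrict_space borel {-1..1})" by (simp add: sets_lebI)
  have "(LINT x|lebI. kern \<sigma> (z - T x) * f x) = f z" for z
    using fun_cong[OF fix_f, of z] unfolding PF_of_real by simp
  then show ?thesis
    unfolding stationary_def using P S distr_step[OF P S] by (simp add: nn_integral_kern_density[OF assms(1-3)])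
qed

text \<open>A stationary law has a bounded density \<open>g\<close> by the previous description of a step. The difference of
  the two fixed points has mean zero and is its own image, so the contraction makes it vanish almost everywhere.\<close>

lemma stationary_unique:
  assumes "f \<in> borel_measurable borel" "\<And>x. 0 \<le> f x" "integrable lebI f" "(LINT x|lebI. f x) = 1"
    and fix_f: "PF T \<sigma> (\<lambda>x. of_real (f x)) = (\<lambda>x. of_real (f x))"
    and st: "stationary T \<sigma> \<nu>"
  shows "\<nu> = density lebI (\<lambda>x. ennreal (f x))"
proof -
  have P: "prob_space \<nu>" and S: "sets \<nu> = sets (restrict_space borel {-1..1})"
    and D: "distr (\<nu> \<Otimes>\<^sub>M gauss \<sigma>) (restrict_space borel {-1..1}) (\<lambda>(x, w). wrap (T x + w)) = \<nu>"
    using st by (auto simp: stationary_def)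
  interpret \<nu>: prob_space \<nu> by (rule P)
  have [measurable]: "T \<in> borel_measurable \<nu>" by (rule T_measurable[OF S])
  define g where "g = (\<lambda>z. LINT x|\<nu>. kern \<sigma> (z - T x))"
  have ik: "integrable \<nu> (\<lambda>x. kern \<sigma> (z - T x))" for z
    by (rule \<nu>.integrable_const_bound[where B = kern_bound]) (use kern_abs_le in auto)
  have g0: "0 \<le> g z" for z
    unfolding g_def using kern_nonneg by (intro integral_nonneg_AE AE_I2) auto
  have gB: "g z \<le> kern_bound" for z
  proof -
    have "g z \<le> (LINT x|\<nu>. kern_bound)"
      unfolding g_def using kern_abs_le by (intro integral_mono ik) (auto intro: order_trans[OF abs_ge_self])
    then show ?thesis by (simp add: \<nu>.prob_space)
  qed
  have gb [measurable]: "g \<in> borel_measurable borel" unfolding g_def by measurable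
  have gi: "integrable lebI g"
    by (rule integrable_lebI_bounded[where B = kern_bound]) (use g0 gB in \<open>auto intro: measurable_lebI_borel\<close>)
  have "(\<integral>\<^sup>+x. ennreal (kern \<sigma> (z - T x)) \<partial>\<nu>) = ennreal (g z)" for z
    unfolding g_def using kern_nonneg by (intro nn_integral_eq_integral ik AE_I2) auto
  then have \<nu>: "\<nu> = density lebI (\<lambda>x. ennreal (g x))"
    using distr_step[OF P S] D by simp
  have gfix: "(LINT x|lebI. kern \<sigma> (z - T x) * g x) = g z" for z
  proof -
    have "ennreal (g z) = ennreal (LINT x|lebI. kern \<sigma> (z - T x) * g x)"
      using \<open>(\<integral>\<^sup>+x. ennreal (kern \<sigma> (z - T x)) \<partial>\<nu>) = ennreal (g z)\<close> nn_integral_kern_density[OF gb g0 gi, of z]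
      unfolding \<nu>[symmetric] by simp
    moreover have "0 \<le> (LINT x|lebI. kern \<sigma> (z - T x) * g x)"
      using g0 kern_nonneg by (intro integral_nonneg_AE AE_I2 mult_nonneg_nonneg) auto
    ultimately show ?thesis using g0[of z] by simp
  qed
  have g1: "(LINT x|lebI. g x) = 1"
  proof -
    have "ennreal (LINT x|lebI. g x) = (\<integral>\<^sup>+x. ennreal (g x) \<partial>lebI)"
      using g0 by (intro nn_integral_eq_integral[symmetric] gi) auto
    also have "\<dots> = emeasure \<nu> (space \<nu>)"
      unfolding \<nu> by (subst emeasure_density) (auto intro!: measurable_lebI_borel nn_integral_cong simp: sets.top[of lebI, simplified])
    also have "\<dots> = 1" by (rule \<nu>.emeasure_space_1)
    finally show ?thesis by simp
  qed
  let ?F = "\<lambda>x. complex_of_real (f x)" and ?G = "\<lambda>x. complex_of_real (g x)"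
  let ?D = "\<lambda>x. ?F x - ?G x"
  have Gfix: "PF T \<sigma> ?G = ?G" by (rule ext) (simp add: PF_of_real gfix)
  have Fi: "integrable lebI ?F" and Gi: "integrable lebI ?G" using assms(3) gi by auto
  have "PF T \<sigma> ?D = ?D" unfolding PF_diff[OF Fi Gi] Gfix fix_f ..
  moreover have "(LINT x|lebI. ?D x) = 0" using Fi Gi assms(3,4) gi g1 by simp
  ultimately have "norm_L1I ?D \<le> doeblin_rate * norm_L1I ?D"
    using PF_contraction[of ?D] Fi Gi by simp
  then have "norm_L1I ?D * (1 - doeblin_rate) \<le> 0" by (simp add: algebra_simps)
  then have "norm_L1I ?D = 0"
    using doeblin_rate_less_1 norm_L1I_nonneg[of ?D] by (auto simp: mult_le_0_iff)
  then have "AE x in lebI. cmod (?D x) = 0"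
    unfolding norm_L1I_def using Fi Gi by (subst (asm) integral_nonneg_eq_0_iff_AE) auto
  then have "AE x in lebI. ennreal (g x) = ennreal (f x)"
    by eventually_elim (simp flip: of_real_diff)
  then have "density lebI (\<lambda>x. ennreal (g x)) = density lebI (\<lambda>x. ennreal (f x))"
    using assms(1) by (intro density_cong measurable_lebI_borel) auto
  with \<nu> show ?thesis by simp
qed

lemma cmod_fourier_coeff_PF_le:
  assumes f: "integrable lebI f"
  shows "cmod (fourier_coeff (PF T \<sigma> f) j) \<le> gauss_coeff \<sigma> (of_int j) / 2 * norm_L1I f"
proof -
  have "cmod (LINT y|lebI. e_mode (- j) (T y) * f y) \<le> (LINT y|lebI. cmod (e_mode (- j) (T y) * f y))"
    by (rule integral_norm_bound)
  then have "cmod (LINT y|lebI. e_mode (- j) (T y) * f y) \<le> norm_L1I f"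
    by (simp add: norm_mult norm_L1I_def)
  then show ?thesis
    unfolding fourier_coeff_PF[OF f] norm_mult norm_of_real
    by (simp add: mult_left_mono less_imp_le abs_of_pos)
qed

text \<open>The coefficients \<open>c j\<close> decay like \<open>exp (- const * j\<^sup>2)\<close> while the mode \<open>j\<close> grows at most like
  \<open>exp (\<pi> R \<bar>j\<bar>)\<close> for \<open>\<bar>Im z\<bar> \<le> R\<close>. The Fourier series therefore converges locally uniformly on the
  complex plane to an entire function \<open>H\<close>, and the real parts of the Taylor coefficients of \<open>H\<close> expand \<open>f\<close>.\<close>

lemma real_analytic_fixed_point:
  assumes i: "integrable lebI f" and fix_f: "PF T \<sigma> (\<lambda>x. of_real (f x)) = (\<lambda>x. of_real (f x))"
  shows "real_analytic_on f {-1..1}"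
proof -
  let ?F = "\<lambda>x. complex_of_real (f x)"
  have Fi: "integrable lebI ?F" using i by simp
  define c where "c = fourier_coeff ?F"
  define N where "N = norm_L1I ?F"
  have c: "cmod (c j) \<le> gauss_coeff \<sigma> (of_int j) / 2 * N" for j
    using cmod_fourier_coeff_PF_le[OF Fi, of j] by (simp add: fix_f c_def N_def)
  define E where "E = (\<lambda>(j::int) z. exp (of_int j * of_real pi * \<i> * z))"
  \<comment> \<open>the modes of index \<open>Suc i\<close> and \<open>- Suc i\<close> are taken together\<close>
  define b where "b = (\<lambda>i z. c (int (Suc i)) * E (int (Suc i)) z + c (- int (Suc i)) * E (- int (Suc i)) z)"
  define H where "H = (\<lambda>z. c 0 + (\<Sum>i. b i z))"
  have lim: "uniform_limit (cball z 1) (\<lambda>m z. c 0 + (\<Sum>i<m. b i z)) H sequentially" for z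
  proof -
    define R where "R = cmod z + 1"
    have "uniform_limit (cball z 1) (\<lambda>m z. \<Sum>i<m. b i z) (\<lambda>z. \<Sum>i. b i z) sequentially"
    proof (rule Weierstrass_m_test)
      have "summable (\<lambda>i. exp (pi * R * real i - \<sigma>\<^sup>2 * pi\<^sup>2 / 2 * (real i)\<^sup>2))"
        using sigma_pos by (intro summable_exp_gauss) simp
      then have "summable (\<lambda>i. exp (pi * R * real (Suc i) - \<sigma>\<^sup>2 * pi\<^sup>2 / 2 * (real (Suc i))\<^sup>2))"
        by (subst summable_Suc_iff[of "\<lambda>i. exp (pi * R * real i - \<sigma>\<^sup>2 * pi\<^sup>2 / 2 * (real i)\<^sup>2)"])
      then show "summable (\<lambda>i. N * exp (pi * R * real (Suc i) - \<sigma>\<^sup>2 * pi\<^sup>2 / 2 * (real (Suc i))\<^sup>2))"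
        by (rule summable_mult)
      fix i w assume w: "w \<in> cball z 1"
      have Ebound: "cmod (E j w) \<le> exp (pi * R * real (Suc i))" if j: "\<bar>j\<bar> = int (Suc i)" for j
      proof -
        have "cmod w \<le> R"
          using w norm_triangle_ineq2[of w z] by (simp add: R_def dist_norm norm_minus_commute)
        then have "\<bar>Im w\<bar> \<le> R" using abs_Im_le_cmod[of w] by linarith
        have "Re (of_int j * of_real pi * \<i> * w) = - (of_int j * pi * Im w)" by simp
        also have "\<dots> \<le> \<bar>of_int j * pi * Im w\<bar>" by (rule abs_ge_minus_self)
        also have "\<dots> = of_int \<bar>j\<bar> * pi * \<bar>Im w\<bar>" by (simp add: abs_mult)
        also have "\<dots> \<le> of_int \<bar>j\<bar> * pi * R" using \<open>\<bar>Im w\<bar> \<le> R\<close> by (intro mult_left_mono) auto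
        finally show ?thesis unfolding E_def norm_exp_eq_Re j by (simp add: mult_ac)
      qed
      have g: "gauss_coeff \<sigma> (of_int (- int (Suc i))) = gauss_coeff \<sigma> (real (Suc i))" "gauss_coeff \<sigma> (of_int (int (Suc i))) = gauss_coeff \<sigma> (real (Suc i))"
        unfolding of_int_minus gauss_coeff_minus of_int_of_nat_eq by (rule refl)+
      have N0: "0 \<le> N" by (simp add: N_def)
      have t: "cmod (c j * E j w) \<le> gauss_coeff \<sigma> (real (Suc i)) / 2 * N * exp (pi * R * real (Suc i))"
        if j: "j = int (Suc i) \<or> j = - int (Suc i)" for j
      proof -
        have "cmod (c j) \<le> gauss_coeff \<sigma> (real (Suc i)) / 2 * N" using c[of j] j g by metis
        moreover have "cmod (E j w) \<le> exp (pi * R * real (Suc i))" using j by (intro Ebound) auto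
        ultimately show ?thesis
          unfolding norm_mult using N0 less_imp_le[OF gauss_coeff_pos[of \<sigma> "real (Suc i)"]]
          by (intro mult_mono mult_nonneg_nonneg) (simp_all del: of_nat_Suc)
      qed
      have "norm (b i w) \<le> gauss_coeff \<sigma> (real (Suc i)) / 2 * N * exp (pi * R * real (Suc i)) + gauss_coeff \<sigma> (real (Suc i)) / 2 * N * exp (pi * R * real (Suc i))"
        unfolding b_def by (rule order_trans[OF norm_triangle_ineq add_mono[OF t t]]) auto
      also have "\<dots> = N * (exp (pi * R * real (Suc i)) * gauss_coeff \<sigma> (real (Suc i)))" by (simp del: of_nat_Suc)
      also have "exp (pi * R * real (Suc i)) * gauss_coeff \<sigma> (real (Suc i)) = exp (pi * R * real (Suc i) - \<sigma>\<^sup>2 * pi\<^sup>2 / 2 * (real (Suc i))\<^sup>2)"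
        unfolding gauss_coeff_def exp_add[symmetric] by (simp del: of_nat_Suc)
      finally show "norm (b i w) \<le> N * exp (pi * R * real (Suc i) - \<sigma>\<^sup>2 * pi\<^sup>2 / 2 * (real (Suc i))\<^sup>2)" .
    qed
    then show ?thesis unfolding H_def by (intro uniform_limit_intros)
  qed
  have hol: "H holomorphic_on UNIV"
  proof (rule holomorphic_uniform_sequence)
    show "(\<lambda>z. c 0 + (\<Sum>i<m. b i z)) holomorphic_on UNIV" for m
      unfolding b_def E_def by (intro holomorphic_intros)
    show "\<exists>d>0. cball z d \<subseteq> UNIV \<and> uniform_limit (cball z d) (\<lambda>m z. c 0 + (\<Sum>i<m. b i z)) H sequentially" for z
      using lim[of z] by (intro exI[of _ 1]) auto
  qed simp
  have HF: "H (of_real x) = ?F x" for x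
  proof (rule LIMSEQ_unique)
    have eq: "c 0 + (\<Sum>i<m. b i (of_real x)) = proj m ?F x" for m
      unfolding proj_def sum_symmetric_int b_def c_def E_def e_mode_def by simp
    show "(\<lambda>m. proj m ?F x) \<longlonglongrightarrow> H (of_real x)"
      using tendsto_uniform_limitI[OF lim[of "of_real x"], of "of_real x"] unfolding eq by simp
    have z: "(\<lambda>m. N / 2 * Gam1 \<sigma> m) \<longlonglongrightarrow> 0"
      by (rule tendsto_mult_right_zero[OF Gam1_tendsto[OF sigma_pos]])
    have "cmod (?F x - proj m ?F x) \<le> N / 2 * Gam1 \<sigma> m" for m
      using PF_tail_sup[OF Fi, of x m] unfolding fix_f N_def[symmetric] by (simp add: mult.commute)
    then have "(\<lambda>m. ?F x - proj m ?F x) \<longlonglongrightarrow> 0"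
      by (intro Lim_null_comparison[OF always_eventually z]) blast
    from tendsto_diff[OF tendsto_const[of "?F x"] this] show "(\<lambda>m. proj m ?F x) \<longlonglongrightarrow> ?F x" by simp
  qed
  show ?thesis
    unfolding real_analytic_on_def
  proof (intro ballI exI[of _ "1::real"] conjI)
    fix x :: real
    show "\<exists>a. \<forall>y\<in>{- 1..1}. \<bar>y - x\<bar> < 1 \<longrightarrow> (\<lambda>n. a n * (y - x) ^ n) sums f y"
    proof (intro exI[of _ "\<lambda>n. Re ((deriv ^^ n) H (of_real x) / fact n)"] ballI impI)
      fix y :: real assume y: "\<bar>y - x\<bar> < 1"
      have "(\<lambda>n. (deriv ^^ n) H (of_real x) / fact n * (of_real y - of_real x) ^ n) sums H (of_real y)"
        by (rule holomorphic_power_series[where r = 1])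
           (use y in \<open>auto intro: holomorphic_on_subset[OF hol] simp: dist_norm norm_minus_commute simp flip: of_real_diff\<close>)
      from sums_Re[OF this] have "(\<lambda>n. Re ((deriv ^^ n) H (of_real x) / fact n * (of_real y - of_real x) ^ n)) sums f y"
        unfolding HF Re_complex_of_real .
      moreover have "Re (u * (of_real y - of_real x) ^ n) = Re u * (y - x) ^ n" for u n
        by (simp flip: of_real_diff of_real_power)
      ultimately show "(\<lambda>n. Re ((deriv ^^ n) H (of_real x) / fact n) * (y - x) ^ n) sums f y"
        by (simp only:)
    qed
  qed simp
qed

end


section \<open>A strong law under decaying correlations\<close>

text \<open>For nonnegative terms the sums are monotone, and consecutive squares have ratio tending to 1, so the
  averages between two squares are squeezed.\<close>

lemma averages_from_squares:
  fixes Y :: "nat \<Rightarrow> real"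
  assumes Y: "\<And>i. 0 \<le> Y i"
    and sq: "(\<lambda>k. (\<Sum>i<k\<^sup>2. Y i) / real (k\<^sup>2)) \<longlonglongrightarrow> m"
  shows "(\<lambda>n. (\<Sum>i<n. Y i) / real n) \<longlonglongrightarrow> m"
proof -
  define A where "A = (\<lambda>k::nat. (\<Sum>i<k\<^sup>2. Y i) / real (k\<^sup>2))"
  define s where "s = (\<lambda>n. floor_sqrt n)"
  have s_le: "(s n)\<^sup>2 \<le> n" and s_gt: "n < (Suc (s n))\<^sup>2" for n
    unfolding s_def by (rule floor_sqrt_power2_le, rule Suc_floor_sqrt_power2_gt)
  have s_top: "filterlim s at_top sequentially"
    unfolding filterlim_at_top s_def
    by (auto simp: eventually_sequentially le_floor_sqrt_iff intro: exI[of _ "_\<^sup>2"])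
  have sum_mono': "a \<le> b \<Longrightarrow> (\<Sum>i<a. Y i) \<le> (\<Sum>i<b. Y i)" for a b
    by (rule sum_mono2) (use Y in auto)
  have ratio1: "(\<lambda>k. real (k\<^sup>2) / real ((Suc k)\<^sup>2)) \<longlonglongrightarrow> 1" by real_asymp
  have ratio2: "(\<lambda>k. real ((Suc k)\<^sup>2) / real (k\<^sup>2)) \<longlonglongrightarrow> 1" by real_asymp
  have lo: "(\<lambda>n. A (s n) * (real ((s n)\<^sup>2) / real ((Suc (s n))\<^sup>2))) \<longlonglongrightarrow> m * 1"
    unfolding A_def by (intro tendsto_mult filterlim_compose[OF sq s_top] filterlim_compose[OF ratio1 s_top])
  have hi: "(\<lambda>n. A (Suc (s n)) * (real ((Suc (s n))\<^sup>2) / real ((s n)\<^sup>2))) \<longlonglongrightarrow> m * 1"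
    unfolding A_def by (intro tendsto_mult filterlim_compose[OF LIMSEQ_Suc[OF sq] s_top] filterlim_compose[OF ratio2 s_top])
  have pos: "\<forall>\<^sub>F n in sequentially. 0 < s n"
    by (rule eventually_compose_filterlim[OF eventually_gt_at_top s_top])
  show ?thesis
  proof (rule tendsto_sandwich[OF _ _ lo[unfolded mult_1_right] hi[unfolded mult_1_right]])
    show "\<forall>\<^sub>F n in sequentially. A (s n) * (real ((s n)\<^sup>2) / real ((Suc (s n))\<^sup>2)) \<le> (\<Sum>i<n. Y i) / real n"
      using pos
    proof eventually_elim
      case (elim n)
      have n: "0 < real n" using elim s_le[of n] by (cases n) auto
      have "A (s n) * (real ((s n)\<^sup>2) / real ((Suc (s n))\<^sup>2)) = (\<Sum>i<(s n)\<^sup>2. Y i) / real ((Suc (s n))\<^sup>2)"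
        using elim by (simp add: A_def)
      also have "\<dots> \<le> (\<Sum>i<n. Y i) / real n"
      proof (intro frac_le sum_nonneg Y n sum_mono'[OF s_le])
        show "real n \<le> real ((Suc (s n))\<^sup>2)" using s_gt[of n] by (simp only: of_nat_le_iff less_imp_le)
      qed
      finally show ?case .
    qed
    show "\<forall>\<^sub>F n in sequentially. (\<Sum>i<n. Y i) / real n \<le> A (Suc (s n)) * (real ((Suc (s n))\<^sup>2) / real ((s n)\<^sup>2))"
      using pos
    proof eventually_elim
      case (elim n)
      have "(\<Sum>i<n. Y i) / real n \<le> (\<Sum>i<(Suc (s n))\<^sup>2. Y i) / real ((s n)\<^sup>2)"
      proof (intro frac_le sum_nonneg Y sum_mono'[OF less_imp_le[OF s_gt]])
        show "real ((s n)\<^sup>2) \<le> real n" using s_le[of n] by (simp only: of_nat_le_iff)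
        show "0 < real ((s n)\<^sup>2)" using elim by simp
      qed
      also have "\<dots> = A (Suc (s n)) * (real ((Suc (s n))\<^sup>2) / real ((s n)\<^sup>2))"
        by (simp add: A_def del: of_nat_Suc power_Suc)
      finally show ?case .
    qed
  qed
qed

lemma sum_geometric_dist_le:
  fixes r :: real
  assumes r: "0 \<le> r" "r < 1"
  shows "(\<Sum>j\<in>{..<n} - {i}. r ^ ((if i < j then j - i else i - j) - 1)) \<le> 2 / (1 - r)"
proof -
  have geo: "sum ((^) r) A \<le> 1 / (1 - r)" if "finite A" for A
    using r sum_le_suminf[OF summable_geometric[of r] that] suminf_geometric[of r] by auto
  let ?t = "\<lambda>j. r ^ ((if i < j then j - i else i - j) - 1)"
  have "(\<Sum>j\<in>{..<n} - {i}. ?t j) \<le> (\<Sum>j\<in>{j. j < i}. ?t j) + (\<Sum>j\<in>{j. i < j \<and> j < n}. ?t j)"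
  proof -
    have "(\<Sum>j\<in>{..<n} - {i}. ?t j) \<le> (\<Sum>j\<in>{j. j < i} \<union> {j. i < j \<and> j < n}. ?t j)"
      using r by (intro sum_mono2) auto
    also have "\<dots> = (\<Sum>j\<in>{j. j < i}. ?t j) + (\<Sum>j\<in>{j. i < j \<and> j < n}. ?t j)"
      by (intro sum.union_disjoint) auto
    finally show ?thesis .
  qed
  also have "(\<Sum>j\<in>{j. j < i}. ?t j) = (\<Sum>l\<in>(\<lambda>j. i - j - 1) ` {j. j < i}. r ^ l)"
    by (subst sum.reindex) (auto simp: inj_on_def)
  also have "\<dots> \<le> 1 / (1 - r)" by (rule geo) auto
  also have "(\<Sum>j\<in>{j. i < j \<and> j < n}. ?t j) = (\<Sum>l\<in>(\<lambda>j. j - i - 1) ` {j. i < j \<and> j < n}. r ^ l)"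
    by (subst sum.reindex) (auto simp: inj_on_def)
  also have "\<dots> \<le> 1 / (1 - r)" by (rule geo) auto
  finally show ?thesis by simp
qed

text \<open>An upper bound on the correlations suffices: the variance is a sum of covariances, and only an upper
  bound on it is needed.\<close>

lemma (in prob_space) second_moment_sum_le:
  fixes Y :: "nat \<Rightarrow> 'a \<Rightarrow> real"
  assumes meas [measurable]: "\<And>i. Y i \<in> borel_measurable M"
    and i2: "\<And>i. integrable M (\<lambda>\<omega>. (Y i \<omega>)\<^sup>2)" and m: "\<And>i. expectation (Y i) = m"
    and q: "\<And>i. expectation (\<lambda>\<omega>. (Y i \<omega>)\<^sup>2) \<le> q"
    and cov: "\<And>i l. expectation (\<lambda>\<omega>. Y i \<omega> * Y (i + Suc l) \<omega>) \<le> m\<^sup>2 + K * r ^ l"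
    and r: "0 \<le> r" "r < 1" and K: "0 \<le> K"
  shows "integrable M (\<lambda>\<omega>. ((\<Sum>i<n. Y i \<omega>) - real n * m)\<^sup>2)"
    "expectation (\<lambda>\<omega>. ((\<Sum>i<n. Y i \<omega>) - real n * m)\<^sup>2) \<le> real n * (q + K * (2 / (1 - r)))"
proof -
  have ii: "integrable M (\<lambda>\<omega>. Y i \<omega> * Y j \<omega>)" for i j
    by (rule Cauchy_Schwarz_integral(1)[OF meas meas i2 i2])
  have i1: "integrable M (Y i)" for i
    using Cauchy_Schwarz_integral(1)[OF meas[of i] _ i2[of i], of "\<lambda>_. 1"] by simp
  have eq: "((\<Sum>i<n. Y i \<omega>) - real n * m)\<^sup>2 = (\<Sum>i<n. \<Sum>j<n. Y i \<omega> * Y j \<omega> - m * Y i \<omega> - m * Y j \<omega> + m\<^sup>2)" for \<omega>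
  proof -
    have "(\<Sum>i<n. Y i \<omega>) - real n * m = (\<Sum>i<n. Y i \<omega> - m)" by (simp add: sum_subtractf)
    then show ?thesis
      unfolding power2_eq_square by (simp add: sum_product algebra_simps)
  qed
  show "integrable M (\<lambda>\<omega>. ((\<Sum>i<n. Y i \<omega>) - real n * m)\<^sup>2)"
    unfolding eq using ii i1 by simp
  have "expectation (\<lambda>\<omega>. ((\<Sum>i<n. Y i \<omega>) - real n * m)\<^sup>2) = (\<Sum>i<n. \<Sum>j<n. expectation (\<lambda>\<omega>. Y i \<omega> * Y j \<omega>) - m\<^sup>2)"
    unfolding eq using ii i1 by (simp add: m prob_space power2_eq_square)
  also have "\<dots> \<le> (\<Sum>i<n. q + K * (2 / (1 - r)))"
  proof (rule sum_mono)
    fix i assume i: "i \<in> {..<n}"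
    let ?t = "\<lambda>j. r ^ ((if i < j then j - i else i - j) - 1)"
    have t: "expectation (\<lambda>\<omega>. Y i \<omega> * Y j \<omega>) - m\<^sup>2 \<le> K * ?t j" if "j \<noteq> i" for j
    proof (cases "i < j")
      case True
      then show ?thesis using cov[of i "j - i - 1"] by simp
    next
      case False
      with that show ?thesis using cov[of j "i - j - 1"] by (simp add: mult.commute)
    qed
    have "(\<Sum>j<n. expectation (\<lambda>\<omega>. Y i \<omega> * Y j \<omega>) - m\<^sup>2) =
        (expectation (\<lambda>\<omega>. Y i \<omega> * Y i \<omega>) - m\<^sup>2) + (\<Sum>j\<in>{..<n} - {i}. expectation (\<lambda>\<omega>. Y i \<omega> * Y j \<omega>) - m\<^sup>2)"
      using i by (intro sum.remove) auto
    also have "\<dots> \<le> q + (\<Sum>j\<in>{..<n} - {i}. K * ?t j)"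
    proof (intro add_mono sum_mono)
      show "expectation (\<lambda>\<omega>. Y i \<omega> * Y i \<omega>) - m\<^sup>2 \<le> q"
        using q[of i] zero_le_power2[of m] unfolding power2_eq_square by linarith
    qed (use t in auto)
    also have "\<dots> \<le> q + K * (2 / (1 - r))"
      unfolding sum_distrib_left[symmetric] by (intro add_left_mono mult_left_mono sum_geometric_dist_le r K)
    finally show "(\<Sum>j<n. expectation (\<lambda>\<omega>. Y i \<omega> * Y j \<omega>) - m\<^sup>2) \<le> q + K * (2 / (1 - r))" .
  qed
  finally show "expectation (\<lambda>\<omega>. ((\<Sum>i<n. Y i \<omega>) - real n * m)\<^sup>2) \<le> real n * (q + K * (2 / (1 - r)))"
    by simp
qed

text \<open>Along the squares the variances of the averages are \<open>O(1 / k\<^sup>2)\<close> and hence summable, so the averages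
  converge almost surely there.\<close>

lemma (in prob_space) strong_law_nonneg:
  fixes Y :: "nat \<Rightarrow> 'a \<Rightarrow> real"
  assumes meas [measurable]: "\<And>i. Y i \<in> borel_measurable M" and Y: "\<And>i \<omega>. 0 \<le> Y i \<omega>"
    and i2: "\<And>n. integrable M (\<lambda>\<omega>. ((\<Sum>i<n. Y i \<omega>) - real n * m)\<^sup>2)"
    and C: "\<And>n. expectation (\<lambda>\<omega>. ((\<Sum>i<n. Y i \<omega>) - real n * m)\<^sup>2) \<le> real n * C"
  shows "AE \<omega> in M. (\<lambda>n. (\<Sum>i<n. Y i \<omega>) / real n) \<longlonglongrightarrow> m"
proof -
  define Z where "Z = (\<lambda>k \<omega>. (((\<Sum>i<(Suc k)\<^sup>2. Y i \<omega>) - real ((Suc k)\<^sup>2) * m) / real ((Suc k)\<^sup>2))\<^sup>2)"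
  have C0: "0 \<le> C" using order_trans[OF _ C[of 1]] by (simp add: integral_nonneg_AE)
  have [measurable]: "Z k \<in> borel_measurable M" for k unfolding Z_def by measurable
  have Zn: "(\<integral>\<^sup>+\<omega>. ennreal (Z k \<omega>) \<partial>M) \<le> ennreal (C * (1 / (real (Suc k))\<^sup>2))" for k
  proof -
    let ?N = "(Suc k)\<^sup>2"
    have Z: "Z k = (\<lambda>\<omega>. ((\<Sum>i<?N. Y i \<omega>) - real ?N * m)\<^sup>2 / (real ?N)\<^sup>2)"
      unfolding Z_def by (simp only: power_divide)
    have "integrable M (Z k)" unfolding Z using i2[of ?N] by (rule integrable_divide)
    then have "(\<integral>\<^sup>+\<omega>. ennreal (Z k \<omega>) \<partial>M) = ennreal (expectation (Z k))"
      by (intro nn_integral_eq_integral) (auto simp: Z)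
    also have "expectation (Z k) = expectation (\<lambda>\<omega>. ((\<Sum>i<?N. Y i \<omega>) - real ?N * m)\<^sup>2) / (real ?N)\<^sup>2"
      unfolding Z by (rule integral_divide_zero)
    also have "\<dots> \<le> real ?N * C / (real ?N)\<^sup>2" by (intro divide_right_mono C) auto
    also have "\<dots> = C * (1 / (real (Suc k))\<^sup>2)"
    proof -
      have "a * C / a\<^sup>2 = C * (1 / a)" if "a > 0" for a :: real
        using that by (simp add: power2_eq_square)
      from this[of "(real (Suc k))\<^sup>2"] show ?thesis unfolding of_nat_power by (simp only: zero_less_power of_nat_0_less_iff zero_less_Suc)
    qed
    finally show ?thesis by (simp add: ennreal_leI)
  qed
  have sum2: "summable (\<lambda>k. C * (1 / (real (Suc k))\<^sup>2))"
    using inverse_power_summable[of 2, where 'a = real]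
    by (intro summable_mult) (simp add: summable_Suc_iff[of "\<lambda>k. 1 / (real k)\<^sup>2"] inverse_eq_divide del: of_nat_Suc)
  have "(\<integral>\<^sup>+\<omega>. (\<Sum>k. ennreal (Z k \<omega>)) \<partial>M) = (\<Sum>k. \<integral>\<^sup>+\<omega>. ennreal (Z k \<omega>) \<partial>M)"
    by (rule nn_integral_suminf) measurable
  also have "\<dots> \<le> (\<Sum>k. ennreal (C * (1 / (real (Suc k))\<^sup>2)))"
    by (intro suminf_le Zn) auto
  also have "\<dots> = ennreal (\<Sum>k. C * (1 / (real (Suc k))\<^sup>2))"
    by (rule suminf_ennreal2[OF _ sum2]) (rule mult_nonneg_nonneg[OF C0], simp)
  also have "\<dots> < \<infinity>" by (rule ennreal_less_top[folded infinity_ennreal_def])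
  finally have fin: "(\<integral>\<^sup>+\<omega>. (\<Sum>k. ennreal (Z k \<omega>)) \<partial>M) \<noteq> \<infinity>"
    by (rule less_imp_neq)
  have "AE \<omega> in M. (\<Sum>k. ennreal (Z k \<omega>)) \<noteq> \<infinity>"
    by (rule nn_integral_PInf_AE[OF _ fin]) measurable
  then show ?thesis
  proof eventually_elim
    case (elim \<omega>)
    have Z0: "0 \<le> Z k \<omega>" for k by (simp add: Z_def)
    have "summable (\<lambda>k. Z k \<omega>)"
      using elim by (intro summable_suminf_not_top Z0) simp
    then have "(\<lambda>k. Z k \<omega>) \<longlonglongrightarrow> 0" by (rule summable_LIMSEQ_zero)
    then have "(\<lambda>k. sqrt (Z k \<omega>)) \<longlonglongrightarrow> sqrt 0" by (rule tendsto_real_sqrt)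
    moreover have "sqrt (Z k \<omega>) = \<bar>(\<Sum>i<(Suc k)\<^sup>2. Y i \<omega>) / real ((Suc k)\<^sup>2) - m\<bar>" for k
      unfolding Z_def real_sqrt_abs by (simp add: diff_divide_distrib del: of_nat_Suc power_Suc)
    ultimately have "(\<lambda>k. (\<Sum>i<(Suc k)\<^sup>2. Y i \<omega>) / real ((Suc k)\<^sup>2) - m) \<longlonglongrightarrow> 0"
      by (simp add: tendsto_rabs_zero_iff del: of_nat_Suc)
    then have "(\<lambda>k. (\<Sum>i<(Suc k)\<^sup>2. Y i \<omega>) / real ((Suc k)\<^sup>2)) \<longlonglongrightarrow> m"
      by (simp add: LIM_zero_iff del: of_nat_Suc)
    then have "(\<lambda>k. (\<Sum>i<k\<^sup>2. Y i \<omega>) / real (k\<^sup>2)) \<longlonglongrightarrow> m"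
      by (rule LIMSEQ_imp_Suc[where f = "\<lambda>k. (\<Sum>i<k\<^sup>2. Y i \<omega>) / real (k\<^sup>2)"])
    then show ?case by (rule averages_from_squares[rotated]) (rule Y)
  qed
qed

section \<open>The stationary chain\<close>

locale noisy_chain = noisy_map T \<sigma> + prob_space M
  for T \<sigma> and M :: "'a measure" +
  fixes \<Omega> :: "nat \<Rightarrow> 'a \<Rightarrow> real" and f :: "real \<Rightarrow> real"
  assumes indep: "indep_vars (\<lambda>_. borel) \<Omega> UNIV"
    and law: "\<And>n. distr M borel (\<Omega> n) = gauss \<sigma>"
    and f_borel [measurable]: "f \<in> borel_measurable borel"
    and f_nonneg: "\<And>x. 0 \<le> f x"
    and f_integrable: "integrable lebI f"
    and f_integral: "(LINT x|lebI. f x) = 1"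
    and f_fixed: "PF T \<sigma> (\<lambda>x. of_real (f x)) = (\<lambda>x. of_real (f x))"
begin

text \<open>Outside \<open>[-1,1]\<close> nothing is known about \<open>T\<close>, not even measurability. Setting it to 0 there gives a
  Borel map of the line with the same orbits.\<close>

definition T_ext :: "real \<Rightarrow> real" where "T_ext x = indicator {-1..1} x *\<^sub>R T x"

lemma T_ext_borel [measurable]: "T_ext \<in> borel_measurable borel"
proof -
  have "(\<lambda>x. indicator {-1..1} x *\<^sub>R T x) \<in> borel_measurable lborel"
    using T_meas unfolding lebI_def by (subst (asm) borel_measurable_restrict_space_iff) auto
  then show ?thesis unfolding T_ext_def [abs_def] by simp
qed

lemma T_ext_eq: "x \<in> {-1..1} \<Longrightarrow> T_ext x = T x"
  by (simp add: T_ext_def)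

lemma orbit_T_ext:
  assumes "x \<in> {-1..1}"
  shows "orbit T w x n = orbit T_ext w x n \<and> orbit T_ext w x n \<in> {-1..1}"
proof (induction n)
  case (Suc n)
  then show ?case using wrap_range[of "T_ext (orbit T_ext w x n) + w n"] by (simp add: T_ext_eq)
qed (use assms in simp)

lemma orbit_restrict: "n \<le> N \<Longrightarrow> orbit T_ext (restrict w {..<N}) x n = orbit T_ext w x n"
  by (induction n) auto

lemma orbit_measurable: "n \<le> N \<Longrightarrow> (\<lambda>v. orbit T_ext v x n) \<in> borel_measurable (PiM {..<N} (\<lambda>_. borel))"
proof (induction n)
  case (Suc n)
  then have [measurable]: "(\<lambda>v. orbit T_ext v x n) \<in> borel_measurable (PiM {..<N} (\<lambda>_. borel))" by simp
  have [measurable]: "(\<lambda>v. v n) \<in> borel_measurable (PiM {..<N} (\<lambda>_. borel :: real measure))"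
    using Suc by (intro measurable_component_singleton) auto
  show ?case by simp
qed simp

lemma noise_measurable [measurable]: "\<Omega> n \<in> borel_measurable M"
  using indep unfolding indep_vars_def by auto

text \<open>The past noise and the next noise variable are compared as families of reals, because independence
  of two variables requires them to have the same type.\<close>

lemma nn_integral_fresh_noise:
  assumes H [measurable]: "H \<in> borel_measurable (PiM {..<n} (\<lambda>_. borel) \<Otimes>\<^sub>M borel)"
  shows "(\<integral>\<^sup>+\<omega>. H (restrict (\<lambda>i. \<Omega> i \<omega>) {..<n}, \<Omega> n \<omega>) \<partial>M) =
    (\<integral>\<^sup>+\<omega>. \<integral>\<^sup>+w. H (restrict (\<lambda>i. \<Omega> i \<omega>) {..<n}, w) \<partial>gauss \<sigma> \<partial>M)"
proof -
  let ?P = "PiM {..<n} (\<lambda>_. borel :: real measure)"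
  let ?V = "\<lambda>\<omega>. restrict (\<lambda>i. \<Omega> i \<omega>) {..<n}"
  let ?Q = "PiM {n} (\<lambda>_. borel :: real measure)"
  let ?W = "\<lambda>\<omega>. restrict (\<lambda>i. \<Omega> i \<omega>) {n}"
  have [measurable]: "?V \<in> M \<rightarrow>\<^sub>M ?P" by measurable
  have [measurable]: "?W \<in> M \<rightarrow>\<^sub>M ?Q" by measurable
  have [measurable]: "(\<lambda>u. u n) \<in> ?Q \<rightarrow>\<^sub>M borel"
    by (rule measurable_component_singleton) simp
  interpret W: prob_space "distr M ?Q ?W" by (rule prob_space_distr) measurable
  have "indep_var ?P ?V ?Q ?W"
    by (rule indep_var_restrict[OF indep]) auto
  then have D: "distr M ?P ?V \<Otimes>\<^sub>M distr M ?Q ?W = distr M (?P \<Otimes>\<^sub>M ?Q) (\<lambda>\<omega>. (?V \<omega>, ?W \<omega>))"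
    unfolding indep_var_distribution_eq by simp
  have Hm: "(\<lambda>(v, u). H (v, u n)) \<in> borel_measurable (?P \<Otimes>\<^sub>M ?Q)" by measurable
  have "(\<integral>\<^sup>+\<omega>. H (?V \<omega>, \<Omega> n \<omega>) \<partial>M) = (\<integral>\<^sup>+p. (\<lambda>(v, u). H (v, u n)) p \<partial>distr M (?P \<Otimes>\<^sub>M ?Q) (\<lambda>\<omega>. (?V \<omega>, ?W \<omega>)))"
    using Hm by (subst nn_integral_distr) simp_all
  also have "\<dots> = (\<integral>\<^sup>+v. \<integral>\<^sup>+u. H (v, u n) \<partial>distr M ?Q ?W \<partial>distr M ?P ?V)"
    unfolding D[symmetric] by (subst W.nn_integral_fst[symmetric]) simp_all
  also have "\<dots> = (\<integral>\<^sup>+\<omega>. \<integral>\<^sup>+u. H (?V \<omega>, u n) \<partial>distr M ?Q ?W \<partial>M)"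
    by (rule nn_integral_distr) measurable
  also have "\<dots> = (\<integral>\<^sup>+\<omega>. \<integral>\<^sup>+w. H (?V \<omega>, w) \<partial>gauss \<sigma> \<partial>M)"
  proof (rule nn_integral_cong)
    fix \<omega> assume "\<omega> \<in> space M"
    then have [measurable]: "?V \<omega> \<in> space ?P" by (rule measurable_space[rotated]) measurable
    have "(\<integral>\<^sup>+u. H (?V \<omega>, u n) \<partial>distr M ?Q ?W) = (\<integral>\<^sup>+\<omega>'. H (?V \<omega>, \<Omega> n \<omega>') \<partial>M)"
      by (subst nn_integral_distr) simp_all
    also have "\<dots> = (\<integral>\<^sup>+w. H (?V \<omega>, w) \<partial>gauss \<sigma>)"
      unfolding law[of n, symmetric] by (subst nn_integral_distr) simp_all
    finally show "(\<integral>\<^sup>+u. H (?V \<omega>, u n) \<partial>distr M ?Q ?W) = (\<integral>\<^sup>+w. H (?V \<omega>, w) \<partial>gauss \<sigma>)" .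
  qed
  finally show ?thesis .
qed

text \<open>The dual of \<open>PF\<close>, acting on observables.\<close>

definition transfer :: "(real \<Rightarrow> ennreal) \<Rightarrow> real \<Rightarrow> ennreal" where
  "transfer \<psi> y = (\<integral>\<^sup>+z. ennreal (kern \<sigma> (z - T_ext y)) * \<psi> z \<partial>lebI)"

lemma transfer_borel [measurable]:
  assumes [measurable]: "\<psi> \<in> borel_measurable borel"
  shows "transfer \<psi> \<in> borel_measurable borel"
proof -
  interpret finite_measure lebI by (rule finite_measure_lebI)
  show ?thesis unfolding transfer_def [abs_def] by measurable
qed

text \<open>The Markov property at fixed initial state, in the form needed for correlations.\<close>

lemma orbit_step:
  assumes [measurable]: "\<phi> \<in> borel_measurable borel" "\<psi> \<in> borel_measurable borel" and mn: "m \<le> n"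
  shows "(\<integral>\<^sup>+\<omega>. \<phi> (orbit T_ext (\<lambda>i. \<Omega> i \<omega>) x m) * \<psi> (orbit T_ext (\<lambda>i. \<Omega> i \<omega>) x (Suc n)) \<partial>M) =
    (\<integral>\<^sup>+\<omega>. \<phi> (orbit T_ext (\<lambda>i. \<Omega> i \<omega>) x m) * transfer \<psi> (orbit T_ext (\<lambda>i. \<Omega> i \<omega>) x n) \<partial>M)"
proof -
  let ?V = "\<lambda>\<omega>. restrict (\<lambda>i. \<Omega> i \<omega>) {..<n}"
  define H where "H = (\<lambda>(v, w). \<phi> (orbit T_ext v x m) * \<psi> (wrap (T_ext (orbit T_ext v x n) + w)))"
  note [measurable] = orbit_measurable[OF mn, where x = x] orbit_measurable[OF order_refl, where x = x, of n]
  have Hm: "H \<in> borel_measurable (PiM {..<n} (\<lambda>_. borel) \<Otimes>\<^sub>M borel)"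
    unfolding H_def by measurable
  have "(\<integral>\<^sup>+\<omega>. \<phi> (orbit T_ext (\<lambda>i. \<Omega> i \<omega>) x m) * \<psi> (orbit T_ext (\<lambda>i. \<Omega> i \<omega>) x (Suc n)) \<partial>M) =
      (\<integral>\<^sup>+\<omega>. H (?V \<omega>, \<Omega> n \<omega>) \<partial>M)"
    unfolding H_def by (simp add: orbit_restrict mn)
  also have "\<dots> = (\<integral>\<^sup>+\<omega>. \<integral>\<^sup>+w. H (?V \<omega>, w) \<partial>gauss \<sigma> \<partial>M)"
    by (rule nn_integral_fresh_noise[OF Hm])
  also have "\<dots> = (\<integral>\<^sup>+\<omega>. \<phi> (orbit T_ext (\<lambda>i. \<Omega> i \<omega>) x m) * transfer \<psi> (orbit T_ext (\<lambda>i. \<Omega> i \<omega>) x n) \<partial>M)"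
    unfolding H_def transfer_def
    by (simp add: orbit_restrict mn nn_integral_cmult nn_integral_gauss_wrap[OF sigma_pos])
  finally show ?thesis .
qed

definition stat_law :: "real measure" where "stat_law = density lebI (\<lambda>x. ennreal (f x))"

lemma prob_space_stat: "prob_space stat_law"
  unfolding stat_law_def by (rule prob_space_density_lebI[OF f_borel f_nonneg f_integrable f_integral])

lemma sets_stat: "sets stat_law = sets lebI" and space_stat [simp]: "space stat_law = {-1..1}"
  by (simp_all add: stat_law_def)

lemma stat_id [measurable (raw)]: "(\<lambda>x. x) \<in> stat_law \<rightarrow>\<^sub>M borel"
  using lebI_id by (subst measurable_cong_sets[OF sets_stat refl])

lemma stat_fst [measurable (raw)]: "(\<lambda>p. fst p) \<in> stat_law \<Otimes>\<^sub>M N \<rightarrow>\<^sub>M borel"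
  by (rule measurable_compose[OF measurable_fst stat_id])

lemma f_lebI [measurable]: "f \<in> borel_measurable lebI"
  by (rule measurable_lebI_borel[OF f_borel])

lemma nn_integral_stat:
  assumes [measurable]: "\<psi> \<in> borel_measurable borel"
  shows "(\<integral>\<^sup>+x. \<psi> x \<partial>stat_law) = (\<integral>\<^sup>+x. ennreal (f x) * \<psi> x \<partial>lebI)"
  unfolding stat_law_def by (rule nn_integral_density) measurable

lemma nn_integral_transfer_stat:
  assumes [measurable]: "\<psi> \<in> borel_measurable borel"
  shows "(\<integral>\<^sup>+x. transfer \<psi> x \<partial>stat_law) = (\<integral>\<^sup>+x. \<psi> x \<partial>stat_law)"
proof -
  interpret s: prob_space stat_law by (rule prob_space_stat)
  interpret l: finite_measure lebI by (rule finite_measure_lebI)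
  interpret pair_sigma_finite stat_law lebI ..
  have kf: "(LINT x|lebI. kern \<sigma> (z - T x) * f x) = f z" for z
    using fun_cong[OF f_fixed, of z] unfolding PF_of_real by simp
  have "(\<integral>\<^sup>+x. transfer \<psi> x \<partial>stat_law) = (\<integral>\<^sup>+z. \<integral>\<^sup>+x. ennreal (kern \<sigma> (z - T_ext x)) * \<psi> z \<partial>stat_law \<partial>lebI)"
    unfolding transfer_def by (rule Fubini'[symmetric]) measurable
  also have "\<dots> = (\<integral>\<^sup>+z. (\<integral>\<^sup>+x. ennreal (kern \<sigma> (z - T_ext x)) \<partial>stat_law) * \<psi> z \<partial>lebI)"
    by (intro nn_integral_cong nn_integral_multc) measurable
  also have "\<dots> = (\<integral>\<^sup>+z. (\<integral>\<^sup>+x. ennreal (kern \<sigma> (z - T x)) \<partial>stat_law) * \<psi> z \<partial>lebI)"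
    by (intro nn_integral_cong arg_cong2[where f = "(*)"] refl) (simp add: T_ext_eq)
  also have "\<dots> = (\<integral>\<^sup>+z. ennreal (f z) * \<psi> z \<partial>lebI)"
    unfolding stat_law_def nn_integral_kern_density[OF f_borel f_nonneg f_integrable] kf ..
  finally show ?thesis by (simp add: nn_integral_stat)
qed

definition path_measure :: "(real \<times> 'a) measure" where "path_measure = stat_law \<Otimes>\<^sub>M M"

definition state :: "nat \<Rightarrow> real \<times> 'a \<Rightarrow> real" where
  "state n p = orbit T_ext (\<lambda>i. \<Omega> i (snd p)) (fst p) n"

lemma state_borel [measurable]: "state n \<in> borel_measurable path_measure"
proof (induction n)
  case 0
  have "state 0 = fst" by (simp add: state_def fun_eq_iff)
  moreover have "fst \<in> borel_measurable (stat_law \<Otimes>\<^sub>M M)"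
    by (rule measurable_compose[OF measurable_fst stat_id])
  ultimately show ?case by (simp add: path_measure_def)
next
  case (Suc n)
  note [measurable] = Suc[unfolded path_measure_def]
  have "state (Suc n) = (\<lambda>p. wrap (T_ext (state n p) + \<Omega> n (snd p)))" by (simp add: state_def fun_eq_iff)
  then show ?case unfolding path_measure_def by simp
qed

lemma prob_space_path: "prob_space path_measure"
proof -
  interpret s: prob_space stat_law by (rule prob_space_stat)
  interpret pair_prob_space stat_law M ..
  show ?thesis unfolding path_measure_def by unfold_locales
qed

lemma AE_path: "(AE p in path_measure. R p) \<Longrightarrow> AE x in stat_law. AE \<omega> in M. R (x, \<omega>)"
proof -
  interpret s: prob_space stat_law by (rule prob_space_stat)
  interpret pair_prob_space stat_law M ..
  show "(AE p in path_measure. R p) \<Longrightarrow> ?thesis" unfolding path_measure_def by (rule AE_pair)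
qed

lemma nn_integral_path:
  assumes "g \<in> borel_measurable path_measure"
  shows "(\<integral>\<^sup>+p. g p \<partial>path_measure) = (\<integral>\<^sup>+x. \<integral>\<^sup>+\<omega>. g (x, \<omega>) \<partial>M \<partial>stat_law)"
  using assms unfolding path_measure_def by (rule nn_integral_fst[symmetric])

lemma state_step:
  assumes [measurable]: "\<phi> \<in> borel_measurable borel" "\<psi> \<in> borel_measurable borel" and mn: "m \<le> n"
  shows "(\<integral>\<^sup>+p. \<phi> (state m p) * \<psi> (state (Suc n) p) \<partial>path_measure) =
    (\<integral>\<^sup>+p. \<phi> (state m p) * transfer \<psi> (state n p) \<partial>path_measure)"
proof -
  have 1: "(\<lambda>p. \<phi> (state m p) * \<psi> (state (Suc n) p)) \<in> borel_measurable path_measure" by measurable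
  have 2: "(\<lambda>p. \<phi> (state m p) * transfer \<psi> (state n p)) \<in> borel_measurable path_measure" by measurable
  show ?thesis
    unfolding nn_integral_path[OF 1] nn_integral_path[OF 2] unfolding state_def fst_conv snd_conv orbit_step[OF assms] ..
qed

lemma nn_integral_state:
  assumes "\<psi> \<in> borel_measurable borel"
  shows "(\<integral>\<^sup>+p. \<psi> (state n p) \<partial>path_measure) = (\<integral>\<^sup>+x. \<psi> x \<partial>stat_law)"
  using assms
proof (induction n arbitrary: \<psi>)
  case 0
  note [measurable] = 0
  have 1: "(\<lambda>p. \<psi> (state 0 p)) \<in> borel_measurable path_measure" by measurable
  show ?case unfolding nn_integral_path[OF 1] by (simp add: state_def emeasure_space_1)
next
  case (Suc n)
  note [measurable] = Suc.prems
  have "(\<integral>\<^sup>+p. 1 * \<psi> (state (Suc n) p) \<partial>path_measure) = (\<integral>\<^sup>+p. 1 * transfer \<psi> (state n p) \<partial>path_measure)"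
    by (rule state_step[of "\<lambda>_. 1" \<psi> n n]) auto
  also have "\<dots> = (\<integral>\<^sup>+x. transfer \<psi> x \<partial>stat_law)" by (simp add: Suc.IH[OF transfer_borel[OF Suc.prems]])
  also have "\<dots> = (\<integral>\<^sup>+x. \<psi> x \<partial>stat_law)" by (rule nn_integral_transfer_stat[OF Suc.prems])
  finally show ?case by simp
qed

lemma kern_times_integrable:
  assumes "integrable lebI \<psi>"
  shows "integrable lebI (\<lambda>z. kern \<sigma> (z - a) * \<psi> z :: real)"
proof -
  have [measurable]: "\<psi> \<in> borel_measurable lebI" using assms by simp
  have "norm (kern \<sigma> (z - a) * \<psi> z) \<le> norm (kern_bound * \<psi> z)" for z
    using kern_abs_le[of "z - a"] kern_bound_pos by (simp add: abs_mult mult_right_mono)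
  then show ?thesis
    by (intro Bochner_Integration.integrable_bound[OF integrable_mult_right[OF assms, of kern_bound] _ AE_I2]) auto
qed

lemma transfer_real:
  assumes "\<And>z. 0 \<le> \<psi> z" "integrable lebI \<psi>"
  shows "transfer (\<lambda>z. ennreal (\<psi> z)) y = ennreal (LINT z|lebI. kern \<sigma> (z - T_ext y) * \<psi> z)"
  unfolding transfer_def using assms kern_nonneg
  by (subst nn_integral_eq_integral[OF kern_times_integrable[OF assms(2)], symmetric])
     (auto simp: ennreal_mult intro!: AE_I2 mult_nonneg_nonneg)

text \<open>Dual form of the contraction: the minorising part of the kernel contributes the same constant at
  every \<open>y\<close>, and the remaining part has mass \<open>doeblin_rate\<close>.\<close>

lemma transfer_oscillation:
  assumes [measurable]: "\<psi> \<in> borel_measurable borel" and \<psi>: "\<And>z. lo \<le> \<psi> z" "\<And>z. \<psi> z \<le> hi" and lo: "0 \<le> lo"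
  shows "\<exists>lo'\<ge>0. \<forall>y. lo' \<le> (LINT z|lebI. kern \<sigma> (z - T_ext y) * \<psi> z) \<and>
    (LINT z|lebI. kern \<sigma> (z - T_ext y) * \<psi> z) \<le> lo' + doeblin_rate * (hi - lo)"
proof -
  let ?c = "normal_density 0 \<sigma> 1"
  have i: "integrable lebI (\<lambda>z. \<psi> z - lo)"
    by (rule integrable_lebI_bounded[where B = "hi - lo"]) (use \<psi> in \<open>auto intro: measurable_lebI_borel\<close>)
  define I where "I = (LINT z|lebI. \<psi> z - lo)"
  have I: "0 \<le> I" unfolding I_def using \<psi> by (intro integral_nonneg_AE AE_I2) auto
  have c: "0 \<le> kern \<sigma> u - ?c" for u using kern_ge[OF sigma_pos, of u] by simp
  show ?thesis
  proof (intro exI[of _ "lo + ?c * I"] conjI allI)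
    show "0 \<le> lo + ?c * I" using lo I by simp
    fix y
    let ?k = "\<lambda>z. kern \<sigma> (z - T_ext y)"
    have ik: "integrable lebI (\<lambda>z. ?k z * (\<psi> z - lo))" by (rule kern_times_integrable[OF i])
    define J where "J = (LINT z|lebI. (?k z - ?c) * (\<psi> z - lo))"
    have iJ: "integrable lebI (\<lambda>z. (?k z - ?c) * (\<psi> z - lo))"
      using ik i by (simp add: left_diff_distrib)
    have "(LINT z|lebI. ?k z * \<psi> z) = (LINT z|lebI. lo * ?k z + (?c * (\<psi> z - lo) + (?k z - ?c) * (\<psi> z - lo)))"
      by (intro Bochner_Integration.integral_cong refl) (simp add: algebra_simps)
    also have "\<dots> = lo * (LINT z|lebI. ?k z) + (?c * I + J)"
      unfolding I_def J_def using i iJ integrable_kern by simp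
    finally have eq: "(LINT z|lebI. ?k z * \<psi> z) = lo + ?c * I + J" by (simp add: integral_kern)
    have J0: "0 \<le> J" unfolding J_def using c \<psi> by (intro integral_nonneg_AE AE_I2 mult_nonneg_nonneg) auto
    have "J \<le> (LINT z|lebI. (?k z - ?c) * (hi - lo))"
      unfolding J_def
    proof (rule integral_mono[OF iJ])
      show "integrable lebI (\<lambda>z. (?k z - ?c) * (hi - lo))"
        by (intro integrable_mult_left Bochner_Integration.integrable_diff integrable_kern integrable_lebI_bounded[where B = ?c]) auto
      show "(?k z - ?c) * (\<psi> z - lo) \<le> (?k z - ?c) * (hi - lo)" for z
        using c \<psi> by (intro mult_left_mono) auto
    qed
    also have "\<dots> = doeblin_rate * (hi - lo)" by (simp add: integral_kern_minus)
    finally have "J \<le> doeblin_rate * (hi - lo)" .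
    with J0 eq show "lo + ?c * I \<le> (LINT z|lebI. ?k z * \<psi> z)"
      "(LINT z|lebI. ?k z * \<psi> z) \<le> lo + ?c * I + doeblin_rate * (hi - lo)" by auto
  qed
qed

text \<open>The mean of \<open>\<psi>\<close> under the stationary law is preserved by \<open>transfer\<close> while its oscillation shrinks
  geometrically, so after \<open>l\<close> steps the observable is at most its mean plus \<open>doeblin_rate ^ l * (hi - lo)\<close>.\<close>

lemma correlation_bounded:
  assumes \<phi> [measurable]: "\<phi> \<in> borel_measurable borel"
  shows "\<psi> \<in> borel_measurable borel \<Longrightarrow> (\<And>z. lo \<le> \<psi> z) \<Longrightarrow> (\<And>z. \<psi> z \<le> hi) \<Longrightarrow> 0 \<le> lo \<Longrightarrow>
    (\<integral>\<^sup>+p. \<phi> (state m p) * ennreal (\<psi> (state (m + l) p)) \<partial>path_measure) \<le>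
    (\<integral>\<^sup>+x. \<phi> x \<partial>stat_law) * ((\<integral>\<^sup>+x. ennreal (\<psi> x) \<partial>stat_law) + ennreal (doeblin_rate ^ l * (hi - lo)))"
proof (induction l arbitrary: \<psi> lo hi)
  case 0
  interpret s: prob_space stat_law by (rule prob_space_stat)
  note [measurable] = 0(1)
  have "lo \<le> hi" using 0(2,3) order_trans by blast
  have "ennreal lo = (\<integral>\<^sup>+x. ennreal lo \<partial>stat_law)" by (simp add: s.emeasure_space_1[simplified])
  also have "\<dots> \<le> (\<integral>\<^sup>+x. ennreal (\<psi> x) \<partial>stat_law)" using 0 by (intro nn_integral_mono ennreal_leI) auto
  finally have lo: "ennreal lo \<le> (\<integral>\<^sup>+x. ennreal (\<psi> x) \<partial>stat_law)" .
  have b: "ennreal (\<psi> z) \<le> (\<integral>\<^sup>+x. ennreal (\<psi> x) \<partial>stat_law) + ennreal (hi - lo)" for z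
  proof -
    have "ennreal (\<psi> z) \<le> ennreal (lo + (hi - lo))" using 0 by (intro ennreal_leI) auto
    also have "\<dots> = ennreal lo + ennreal (hi - lo)" using 0(4) \<open>lo \<le> hi\<close> by (intro ennreal_plus) auto
    also have "\<dots> \<le> (\<integral>\<^sup>+x. ennreal (\<psi> x) \<partial>stat_law) + ennreal (hi - lo)" by (intro add_right_mono lo)
    finally show ?thesis .
  qed
  have "(\<integral>\<^sup>+p. \<phi> (state m p) * ennreal (\<psi> (state (m + 0) p)) \<partial>path_measure) \<le>
     (\<integral>\<^sup>+p. \<phi> (state m p) * ((\<integral>\<^sup>+x. ennreal (\<psi> x) \<partial>stat_law) + ennreal (hi - lo)) \<partial>path_measure)"
    by (intro nn_integral_mono mult_left_mono b) auto
  also have "\<dots> = (\<integral>\<^sup>+p. \<phi> (state m p) \<partial>path_measure) * ((\<integral>\<^sup>+x. ennreal (\<psi> x) \<partial>stat_law) + ennreal (hi - lo))"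
    by (rule nn_integral_multc) measurable
  finally show ?case by (simp add: nn_integral_state)
next
  case (Suc l)
  note [measurable] = Suc.prems(1)
  have \<psi>0: "0 \<le> \<psi> z" for z using Suc.prems(2)[of z] Suc.prems(4) by linarith
  have i: "integrable lebI \<psi>"
    by (rule integrable_lebI_bounded[where B = hi]) (use Suc.prems(3) \<psi>0 in \<open>auto intro: measurable_lebI_borel\<close>)
  let ?U = "\<lambda>y. LINT z|lebI. kern \<sigma> (z - T_ext y) * \<psi> z"
  have tr: "transfer (\<lambda>z. ennreal (\<psi> z)) = (\<lambda>y. ennreal (?U y))"
    by (rule ext) (rule transfer_real[OF \<psi>0 i])
  obtain lo' where lo': "0 \<le> lo'" "\<And>y. lo' \<le> ?U y" "\<And>y. ?U y \<le> lo' + doeblin_rate * (hi - lo)"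
    using transfer_oscillation[OF Suc.prems] by blast
  have Ub: "?U \<in> borel_measurable borel"
  proof -
    interpret finite_measure lebI by (rule finite_measure_lebI)
    show ?thesis by measurable
  qed
  have "(\<integral>\<^sup>+p. \<phi> (state m p) * ennreal (\<psi> (state (m + Suc l) p)) \<partial>path_measure) =
     (\<integral>\<^sup>+p. \<phi> (state m p) * ennreal (?U (state (m + l) p)) \<partial>path_measure)"
    using state_step[of \<phi> "\<lambda>z. ennreal (\<psi> z)" m "m + l"] by (simp add: tr)
  also have "\<dots> \<le> (\<integral>\<^sup>+x. \<phi> x \<partial>stat_law) * ((\<integral>\<^sup>+x. ennreal (?U x) \<partial>stat_law) + ennreal (doeblin_rate ^ l * (lo' + doeblin_rate * (hi - lo) - lo')))"
    by (rule Suc.IH[OF Ub lo'(2,3,1)])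
  also have "(\<integral>\<^sup>+x. ennreal (?U x) \<partial>stat_law) = (\<integral>\<^sup>+x. ennreal (\<psi> x) \<partial>stat_law)"
    using nn_integral_transfer_stat[of "\<lambda>z. ennreal (\<psi> z)"] by (simp add: tr)
  finally show ?case by (simp add: mult_ac)
qed

lemma f_le: "f x \<le> kern_bound"
proof -
  have "cmod (PF T \<sigma> (\<lambda>x. of_real (f x)) x) \<le> kern_bound * norm_L1I (\<lambda>x. of_real (f x))"
    using f_integrable by (intro PF_sup) simp
  also have "norm_L1I (\<lambda>x. of_real (f x)) = 1"
    using f_nonneg f_integral by (intro norm_L1I_density) auto
  finally show ?thesis unfolding f_fixed using f_nonneg[of x] by simp
qed

lemma integrable_stat:
  fixes g :: "real \<Rightarrow> 'b :: {banach, second_countable_topology}"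
  assumes g: "integrable lebI g"
  shows "integrable stat_law g"
proof -
  have g_meas [measurable]: "g \<in> borel_measurable lebI" using g by (rule borel_measurable_integrable)
  have "norm (f x *\<^sub>R g x) \<le> norm (kern_bound * norm (g x))" for x
    using f_le[of x] f_nonneg[of x] kern_bound_pos by (simp add: mult_right_mono)
  then have "integrable lebI (\<lambda>x. f x *\<^sub>R g x)"
    by (intro Bochner_Integration.integrable_bound[OF integrable_mult_right[OF integrable_norm[OF g], of kern_bound] _ AE_I2]) auto
  moreover have "integrable stat_law g \<longleftrightarrow> integrable lebI (\<lambda>x. f x *\<^sub>R g x)"
    unfolding stat_law_def
  proof (rule integrable_density)
    show "AE x in lebI. 0 \<le> f x" by (rule AE_I2) (rule f_nonneg)
  qed (rule g_meas f_lebI)+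
  ultimately show ?thesis by blast
qed

text \<open>A square integrable observable need not be bounded, but its image under one step of \<open>transfer\<close> is,
  which is why the correlation bound starts at lag 1.\<close>

lemma strong_law_chain_nonneg:
  assumes \<phi> [measurable]: "\<phi> \<in> borel_measurable borel" and \<phi>0: "\<And>x. 0 \<le> \<phi> x" and sq: "integrable lebI (\<lambda>x. (\<phi> x)\<^sup>2)"
  shows "AE x in stat_law. AE \<omega> in M. (\<lambda>n. (\<Sum>i<n. \<phi> (orbit T_ext (\<lambda>i. \<Omega> i \<omega>) x i)) / real n) \<longlonglongrightarrow> (LINT x|stat_law. \<phi> x)"
proof -
  interpret Q: prob_space path_measure by (rule prob_space_path)
  have i1: "integrable lebI \<phi>"
  proof -
    have "integrable lebI (\<lambda>_. 1\<^sup>2 :: real)" by (rule integrable_lebI_bounded[where B = 1]) simp_all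
    from Cauchy_Schwarz_integral(1)[OF measurable_lebI_borel[OF \<phi>] borel_measurable_const sq this]
    show ?thesis by (simp only: mult_1_right)
  qed
  have is1: "integrable stat_law \<phi>" by (rule integrable_stat[OF i1])
  have is2: "integrable stat_law (\<lambda>x. (\<phi> x)\<^sup>2)" by (rule integrable_stat[OF sq])
  define m where "m = (LINT x|stat_law. \<phi> x)"
  define q where "q = (LINT x|stat_law. (\<phi> x)\<^sup>2)"
  define B where "B = kern_bound * (LINT z|lebI. \<phi> z)"
  have m0: "0 \<le> m" unfolding m_def using \<phi>0 by (intro integral_nonneg_AE AE_I2) auto
  have B0: "0 \<le> B" unfolding B_def using \<phi>0 kern_bound_pos by (intro mult_nonneg_nonneg integral_nonneg_AE AE_I2) auto
  have nm: "(\<integral>\<^sup>+x. ennreal (\<phi> x) \<partial>stat_law) = ennreal m"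
    unfolding m_def using \<phi>0 by (intro nn_integral_eq_integral is1) auto
  have nq: "(\<integral>\<^sup>+x. ennreal ((\<phi> x)\<^sup>2) \<partial>stat_law) = ennreal q"
    unfolding q_def by (intro nn_integral_eq_integral is2) auto
  define Y where "Y = (\<lambda>i p. \<phi> (state i p))"
  have Ym [measurable]: "Y i \<in> borel_measurable path_measure" for i unfolding Y_def by measurable
  have Y0: "0 \<le> Y i p" for i p by (simp add: Y_def \<phi>0)
  have nY: "(\<integral>\<^sup>+p. ennreal (Y i p) \<partial>path_measure) = ennreal m" for i
    unfolding Y_def nm[symmetric] by (rule nn_integral_state[of "\<lambda>x. ennreal (\<phi> x)"]) measurable
  have nY2: "(\<integral>\<^sup>+p. ennreal ((Y i p)\<^sup>2) \<partial>path_measure) = ennreal q" for i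
    unfolding Y_def nq[symmetric] by (rule nn_integral_state[of "\<lambda>x. ennreal ((\<phi> x)\<^sup>2)"]) measurable
  have iY2: "integrable path_measure (\<lambda>p. (Y i p)\<^sup>2)" for i
    by (rule integrableI_nonneg) (use nY2[of i] in auto)
  have eY: "Q.expectation (Y i) = m" for i
    using nY[of i] m0 Y0 by (subst integral_eq_nn_integral) auto
  have q0: "0 \<le> q" unfolding q_def by (intro integral_nonneg_AE AE_I2) auto
  have eY2: "Q.expectation (\<lambda>p. (Y i p)\<^sup>2) \<le> q" for i
    using nY2[of i] q0 by (subst integral_eq_nn_integral) auto
  let ?U = "\<lambda>y. LINT z|lebI. kern \<sigma> (z - T_ext y) * \<phi> z"
  have Ub: "?U \<in> borel_measurable borel"
  proof -
    interpret finite_measure lebI by (rule finite_measure_lebI)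
    show ?thesis by measurable
  qed
  have U0: "0 \<le> ?U y" for y using \<phi>0 kern_nonneg by (intro integral_nonneg_AE AE_I2 mult_nonneg_nonneg) auto
  have UB: "?U y \<le> B" for y
  proof -
    have "?U y \<le> (LINT z|lebI. kern_bound * \<phi> z)"
      using kern_abs_le \<phi>0 by (intro integral_mono kern_times_integrable integrable_mult_right i1 mult_right_mono) (auto intro: order_trans[OF abs_ge_self])
    then show ?thesis by (simp add: B_def)
  qed
  have tr: "transfer (\<lambda>z. ennreal (\<phi> z)) = (\<lambda>y. ennreal (?U y))"
    by (rule ext) (rule transfer_real[OF \<phi>0 i1])
  have cov: "Q.expectation (\<lambda>p. Y i p * Y (i + Suc l) p) \<le> m\<^sup>2 + m * B * doeblin_rate ^ l" for i l
  proof -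
    have "(\<integral>\<^sup>+p. ennreal (Y i p * Y (i + Suc l) p) \<partial>path_measure) = (\<integral>\<^sup>+p. ennreal (\<phi> (state i p)) * ennreal (\<phi> (state (Suc (i + l)) p)) \<partial>path_measure)"
      using \<phi>0 by (simp add: Y_def ennreal_mult)
    also have "\<dots> = (\<integral>\<^sup>+p. ennreal (\<phi> (state i p)) * ennreal (?U (state (i + l) p)) \<partial>path_measure)"
      using state_step[of "\<lambda>z. ennreal (\<phi> z)" "\<lambda>z. ennreal (\<phi> z)" i "i + l"] by (simp add: tr)
    also have "\<dots> \<le> (\<integral>\<^sup>+x. ennreal (\<phi> x) \<partial>stat_law) * ((\<integral>\<^sup>+x. ennreal (?U x) \<partial>stat_law) + ennreal (doeblin_rate ^ l * (B - 0)))"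
      by (rule correlation_bounded[OF _ Ub U0 UB]) auto
    also have "(\<integral>\<^sup>+x. ennreal (?U x) \<partial>stat_law) = ennreal m"
      using nn_integral_transfer_stat[of "\<lambda>z. ennreal (\<phi> z)"] by (simp add: tr nm)
    also have "(\<integral>\<^sup>+x. ennreal (\<phi> x) \<partial>stat_law) * (ennreal m + ennreal (doeblin_rate ^ l * (B - 0))) = ennreal (m * (m + doeblin_rate ^ l * B))"
      unfolding nm using m0 B0 doeblin_rate_nonneg by (simp add: ennreal_mult ennreal_plus)
    finally have le: "(\<integral>\<^sup>+p. ennreal (Y i p * Y (i + Suc l) p) \<partial>path_measure) \<le> ennreal (m * (m + doeblin_rate ^ l * B))" .
    have "Q.expectation (\<lambda>p. Y i p * Y (i + Suc l) p) = enn2real (\<integral>\<^sup>+p. ennreal (Y i p * Y (i + Suc l) p) \<partial>path_measure)"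
      using Y0 by (intro integral_eq_nn_integral) auto
    also have "\<dots> \<le> m * (m + doeblin_rate ^ l * B)"
      using m0 B0 doeblin_rate_nonneg by (intro enn2real_leI le) auto
    finally show ?thesis by (simp add: power2_eq_square algebra_simps)
  qed
  have mB: "0 \<le> m * B" using m0 B0 by simp
  note sm = Q.second_moment_sum_le[OF Ym iY2 eY eY2 cov doeblin_rate_nonneg doeblin_rate_less_1 mB]
  have "AE p in path_measure. (\<lambda>n. (\<Sum>i<n. Y i p) / real n) \<longlonglongrightarrow> m"
    by (rule Q.strong_law_nonneg[OF Ym Y0 sm])
  then have "AE x in stat_law. AE \<omega> in M. (\<lambda>n. (\<Sum>i<n. Y i (x, \<omega>)) / real n) \<longlonglongrightarrow> m"
    by (rule AE_path)
  then show ?thesis unfolding Y_def state_def m_def by simp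
qed

end

context noisy_chain
begin

text \<open>Apply the nonnegative case to the positive and negative parts of the real and imaginary parts.\<close>

lemma strong_law_chain:
  assumes \<phi>: "\<phi> \<in> L2I"
  shows "AE x in stat_law. AE \<omega> in M.
    (\<lambda>N. (\<Sum>n<N. \<phi> (orbit T (\<lambda>i. \<Omega> i \<omega>) x n)) / of_nat N) \<longlonglongrightarrow> (LINT y|stat_law. \<phi> y)"
proof -
  define \<phi>0 where "\<phi>0 = (\<lambda>x. indicator {-1..1} x *\<^sub>R \<phi> x)"
  have m0 [measurable]: "\<phi>0 \<in> borel_measurable borel"
  proof -
    have "\<phi>0 \<in> borel_measurable lborel"
      using L2I_measurable[OF \<phi>] unfolding lebI_def \<phi>0_def by (subst (asm) borel_measurable_restrict_space_iff) auto
    then show ?thesis by simp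
  qed
  have eq: "\<phi>0 x = \<phi> x" if "x \<in> {-1..1}" for x using that by (simp add: \<phi>0_def)
  have L2: "\<phi>0 \<in> L2I" by (rule L2I_cong[OF \<phi>]) (simp add: eq)
  define part :: "(complex \<Rightarrow> real) \<Rightarrow> real \<Rightarrow> real" where "part h = (\<lambda>x. max 0 (h (\<phi>0 x)))" for h
  define A where "A = (\<lambda>g x \<omega> N. (\<Sum>n<N. g (orbit T_ext (\<lambda>i. \<Omega> i \<omega>) x n)) / real N)"
  have part: "integrable stat_law (part h) \<and> (AE x in stat_law. AE \<omega> in M. A (part h) x \<omega> \<longlonglongrightarrow> (LINT x|stat_law. part h x))"
    if h: "h \<in> borel_measurable borel" "\<And>z. \<bar>h z\<bar> \<le> cmod z" for h
  proof -
    note [measurable] = h(1)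
    have pm: "part h \<in> borel_measurable borel" unfolding part_def by measurable
    have p0: "0 \<le> part h x" for x by (simp add: part_def)
    have le: "\<bar>part h x\<bar> \<le> cmod (\<phi>0 x)" for x using h(2)[of "\<phi>0 x"] by (auto simp: part_def max_def)
    have i1: "integrable lebI (part h)"
      by (rule Bochner_Integration.integrable_bound[OF L2I_integrable[OF L2]])
         (use le measurable_lebI_borel[OF pm] in auto)
    have i2: "integrable lebI (\<lambda>x. (part h x)\<^sup>2)"
    proof (rule Bochner_Integration.integrable_bound[OF L2I_integrable_sq[OF L2]])
      show "(\<lambda>x. (part h x)\<^sup>2) \<in> borel_measurable lebI"
        using measurable_lebI_borel[OF pm] by (rule borel_measurable_power)
      show "AE x in lebI. norm ((part h x)\<^sup>2) \<le> norm ((cmod (\<phi>0 x))\<^sup>2)"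
      proof (rule AE_I2)
        fix x
        show "norm ((part h x)\<^sup>2) \<le> norm ((cmod (\<phi>0 x))\<^sup>2)" using power_mono[OF le[of x], of 2] by simp
      qed
    qed
    show ?thesis
      using integrable_stat[OF i1] strong_law_chain_nonneg[OF pm p0 i2] unfolding A_def by blast
  qed
  have hs: "Re \<in> borel_measurable borel" "(\<lambda>z. - Re z) \<in> borel_measurable borel"
    "Im \<in> borel_measurable borel" "(\<lambda>z. - Im z) \<in> borel_measurable borel" by measurable
  have b: "\<bar>Re z\<bar> \<le> cmod z" "\<bar>- Re z\<bar> \<le> cmod z" "\<bar>Im z\<bar> \<le> cmod z" "\<bar>- Im z\<bar> \<le> cmod z" for z
    by (simp_all add: abs_Re_le_cmod abs_Im_le_cmod)
  let ?p1 = "part Re" and ?p2 = "part (\<lambda>z. - Re z)" and ?p3 = "part Im" and ?p4 = "part (\<lambda>z. - Im z)"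
  note p1 = part[OF hs(1) b(1)] and p2 = part[OF hs(2) b(2)] and p3 = part[OF hs(3) b(3)] and p4 = part[OF hs(4) b(4)]
  have split: "\<phi>0 x = (of_real (?p1 x) - of_real (?p2 x)) + \<i> * (of_real (?p3 x) - of_real (?p4 x))" for x
    by (simp add: part_def complex_eq_iff max_def)
  define I where "I = (\<lambda>p. LINT x|stat_law. p x :: real)"
  have int: "(LINT y|stat_law. \<phi> y) = (of_real (I ?p1) - of_real (I ?p2)) + \<i> * (of_real (I ?p3) - of_real (I ?p4))"
  proof -
    have "(LINT y|stat_law. \<phi> y) = (LINT y|stat_law. \<phi>0 y)" by (rule Bochner_Integration.integral_cong) (simp_all add: eq)
    also have "\<dots> = (of_real (I ?p1) - of_real (I ?p2)) + \<i> * (of_real (I ?p3) - of_real (I ?p4))"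
      unfolding split I_def using p1 p2 p3 p4 by simp
    finally show ?thesis .
  qed
  have "AE x in stat_law. AE \<omega> in M. A ?p1 x \<omega> \<longlonglongrightarrow> I ?p1 \<and> A ?p2 x \<omega> \<longlonglongrightarrow> I ?p2 \<and> A ?p3 x \<omega> \<longlonglongrightarrow> I ?p3 \<and> A ?p4 x \<omega> \<longlonglongrightarrow> I ?p4"
    using p1[THEN conjunct2] p2[THEN conjunct2] p3[THEN conjunct2] p4[THEN conjunct2]
    unfolding I_def by eventually_elim (intro eventually_conj)
  moreover have "AE x in stat_law. x \<in> {-1..1}" by (rule AE_I2) simp
  ultimately show ?thesis
  proof eventually_elim
    case (elim x)
    note x = elim(2)
    from elim(1) show ?case
    proof eventually_elim
      case (elim \<omega>)
      have "(\<lambda>N. (of_real (A ?p1 x \<omega> N) - of_real (A ?p2 x \<omega> N)) + \<i> * (of_real (A ?p3 x \<omega> N) - of_real (A ?p4 x \<omega> N)))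
          \<longlonglongrightarrow> (LINT y|stat_law. \<phi> y)"
        unfolding int using elim by (intro tendsto_intros) auto
      moreover have "(\<Sum>n<N. \<phi> (orbit T (\<lambda>i. \<Omega> i \<omega>) x n)) / of_nat N =
          (of_real (A ?p1 x \<omega> N) - of_real (A ?p2 x \<omega> N)) + \<i> * (of_real (A ?p3 x \<omega> N) - of_real (A ?p4 x \<omega> N))" for N
      proof -
        have "\<phi> (orbit T (\<lambda>i. \<Omega> i \<omega>) x n) = \<phi>0 (orbit T_ext (\<lambda>i. \<Omega> i \<omega>) x n)" for n
          using orbit_T_ext[OF x, of "\<lambda>i. \<Omega> i \<omega>" n] by (simp add: eq)
        then show ?thesis
          unfolding A_def split
          by (simp only: of_real_divide of_real_sum of_real_of_nat_eq sum.distrib sum_subtractf sum_distrib_left[symmetric]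
              add_divide_distrib diff_divide_distrib times_divide_eq_right[symmetric])
      qed
      ultimately show ?case by (simp only:)
    qed
  qed
qed

lemma galerkin_enclosure:
  assumes C: "C_const T \<sigma> k n < 1" and g: "trig_poly k g" "(LINT y|lebI. g y) = 1" and \<phi>: "\<phi> \<in> L2I"
  shows "cmod ((LINT y|stat_law. \<phi> y) - (LINT y|lebI. \<phi> y * g y)) \<le> norm_L2I \<phi> * Err T \<sigma> k n g"
proof -
  let ?F = "\<lambda>x. complex_of_real (f x)"
  have Fi: "integrable lebI ?F" using f_integrable by simp
  have FL2: "?F \<in> L2I" using PF_L2(1)[OF Fi] by (simp add: f_fixed)
  have gL2: "g \<in> L2I" by (rule trig_poly_L2I[OF g(1)])
  have FI: "(LINT x|lebI. ?F x) = 1" by (simp add: f_integral)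
  have n1: "norm_L1I ?F = 1" using f_nonneg FI by (intro norm_L1I_density)
  have st: "(LINT y|stat_law. \<phi> y) = (LINT y|lebI. \<phi> y * ?F y)"
  proof -
    have "(LINT y|stat_law. \<phi> y) = (LINT y|lebI. f y *\<^sub>R \<phi> y)"
      unfolding stat_law_def
    proof (rule integral_density)
      show "AE x in lebI. 0 \<le> f x" by (rule AE_I2) (rule f_nonneg)
    qed (rule L2I_measurable[OF \<phi>] f_lebI)+
    then show ?thesis by (simp add: scaleR_conv_of_real mult.commute)
  qed
  have "(LINT y|stat_law. \<phi> y) - (LINT y|lebI. \<phi> y * g y) = (LINT y|lebI. \<phi> y * (?F y - g y))"
    unfolding st right_diff_distrib
    by (rule Bochner_Integration.integral_diff[symmetric]) (rule L2I_Cauchy_Schwarz(1)[OF \<phi>] FL2 gL2)+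
  then have "cmod ((LINT y|stat_law. \<phi> y) - (LINT y|lebI. \<phi> y * g y)) \<le> norm_L2I \<phi> * norm_L2I (\<lambda>x. ?F x - g x)"
    using L2I_Cauchy_Schwarz(3)[OF \<phi> L2I_diff(1)[OF FL2 gL2]] by simp
  also have "\<dots> \<le> norm_L2I \<phi> * Err T \<sigma> k n g"
    by (intro mult_left_mono galerkin_error[OF Fi f_fixed n1 FI gL2 g(2) C]) simp
  finally show ?thesis .
qed

end

section \<open>Stationary law, Birkhoff averages and rigorous enclosure\<close>

theorem mainTheorem1:
  fixes T :: "real \<Rightarrow> real" and \<sigma> :: real
    and M :: "'a measure" and \<Omega> :: "nat \<Rightarrow> 'a \<Rightarrow> real"
  assumes T_meas: "T \<in> borel_measurable lebI"
    and T_ac: "absolutely_continuous lborel (distr lebI borel T)"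
    and sigma_pos: "\<sigma> > 0"
    and M_prob: "prob_space M"
    and noise_indep: "prob_space.indep_vars M (\<lambda>_. borel) \<Omega> UNIV"
    and noise_law: "\<And>n. distr M borel (\<Omega> n) = gauss \<sigma>"
  shows "\<exists>\<mu> f.
      (stationary T \<sigma> \<mu> \<and> (\<forall>\<nu>. stationary T \<sigma> \<nu> \<longrightarrow> \<nu> = \<mu>) \<and>
       (\<forall>x\<in>{-1..1}. 0 \<le> f x) \<and> \<mu> = density lebI (\<lambda>x. ennreal (f x)) \<and>
       real_analytic_on f {-1..1}) \<and>
      (\<forall>\<phi>\<in>L2I. AE x in \<mu>. AE \<omega> in M.
         (\<lambda>N. (\<Sum>n<N. \<phi> (orbit T (\<lambda>i. \<Omega> i \<omega>) x n)) / of_nat N)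
           \<longlonglongrightarrow> (LINT y|\<mu>. \<phi> y)) \<and>
      (\<forall>k n g. C_const T \<sigma> k n < 1 \<and> trig_poly k g \<and> (LINT y|lebI. g y) = 1 \<longrightarrow>
         (\<forall>\<phi>\<in>L2I. cmod ((LINT y|\<mu>. \<phi> y) - (LINT y|lebI. \<phi> y * g y))
                   \<le> norm_L2I \<phi> * Err T \<sigma> k n g)) \<and>
      (\<forall>\<eta>>0. \<exists>k n g. C_const T \<sigma> k n < 1 \<and> trig_poly k g \<and> (LINT y|lebI. g y) = 1 \<and>
         Err T \<sigma> k n g < \<eta>)"
proof -
  have nm: "noisy_map T \<sigma>" by unfold_locales (rule T_meas, rule sigma_pos)
  obtain f :: "real \<Rightarrow> real" where f: "f \<in> borel_measurable borel" "\<And>x. 0 \<le> f x" "integrable lebI f"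
      "(LINT x|lebI. f x) = 1" "PF T \<sigma> (\<lambda>x. of_real (f x)) = (\<lambda>x. of_real (f x))"
    using noisy_map.invariant_density_exists[OF nm] by blast
  interpret noisy_chain T \<sigma> M \<Omega> f
    by (rule noisy_chain.intro[OF nm M_prob], unfold_locales) (rule noise_indep noise_law f)+
  have Fi: "integrable lebI (\<lambda>x. complex_of_real (f x))" using f(3) by simp
  have FI: "(LINT x|lebI. complex_of_real (f x)) = 1" by (simp add: f(4))
  have n1: "norm_L1I (\<lambda>x. complex_of_real (f x)) = 1" using f(2) FI by (intro norm_L1I_density)
  show ?thesis
  proof (intro exI[of _ stat_law] exI[of _ f] conjI ballI allI impI)
    show "stationary T \<sigma> stat_law" unfolding stat_law_def by (rule stationary_density[OF f])
    show "\<nu> = stat_law" if "stationary T \<sigma> \<nu>" for \<nu> unfolding stat_law_def by (rule stationary_unique[OF f that])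
    show "stat_law = density lebI (\<lambda>x. ennreal (f x))" by (rule stat_law_def)
    show "real_analytic_on f {-1..1}" by (rule real_analytic_fixed_point[OF f(3,5)])
    show "\<exists>k n g. C_const T \<sigma> k n < 1 \<and> trig_poly k g \<and> (LINT y|lebI. g y) = 1 \<and> Err T \<sigma> k n g < \<eta>"
      if "\<eta> > 0" for \<eta>
      by (rule Err_arbitrarily_small[OF Fi f(5) n1 FI that])
  qed (use f(2) strong_law_chain galerkin_enclosure in auto)
qed

end
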